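(* Let $M$ be a $2$-dimensional complex manifold which is the union of an increasing sequence of open subsets $M_j\subset M_{j+1}$, each biholomorphic to a fixed domain $\Omega\subset\mathbb{C}^2$ which is a bounded Levi corank one domain, a smoothly bounded convex domain, or a strongly pseudoconvex polyhedral domain. Assume that $M$ is not (Kobayashi) hyperbolic, that the corank of $F_M$ is one, and that $\pi_1(\Omega)=0$. If $Z\subset\Omega$ is a holomorphic retract of $\Omega$ such that $M$ is biholomorphic to a locally trivial holomorphic fibre bundle over $Z$ with fibre $\mathbb{C}$, then $Z$ is simply connected and hence biholomorphic to the unit disc $\Delta$.
   Context: $F_M$ is the infinitesimal Kobayashi metric of $M$; its corank is the complex dimension of $\{v\in T_pM:F_M(p,v)=0\}$, which is independent of $p$ in this setting. A holomorphic retract of a complex manifold $X$ is the image of a holomorphic map $r:X\to X$ with $r\circ r=r$. Levi corank one domain in $\mathbb{C}^n$: $\partial\Omega$ is smooth, pseudoconvex, of finite type (D'Angelo $1$-type), and its Levi form has at least $n-2$ positive eigenvalues everywhere on $\partial\Omega$ (here $n=2$). Strongly pseudoconvex polyhedral domain in $\mathbb{C}^n$ (here $n=2$): a bounded domain $\Omega=\{z\in\mathbb{C}^n:\rho_1(z)<0,\dots,\rho_k(z)<0\}$, $k\ge2$, with $\rho_i:\mathbb{C}^n\to\mathbb{R}$ of class $C^2$, such that for every $\{i_1,\dots,i_l\}\subset\{1,\dots,k\}$ the gradient vectors $\nabla\rho_{i_1}(p),\dots,\nabla\rho_{i_l}(p)$ are linearly independent over $\mathbb{C}$ at every $p$ with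 $\rho_{i_1}(p)=\dots=\rho_{i_l}(p)=0$, where $\nabla\rho_i=2(\partial\rho_i/\partial\bar z_1,\dots,\partial\rho_i/\partial\bar z_n)$, and $\partial\Omega$ is strongly pseudoconvex at every smooth boundary point. *)

theory Defs
  imports
    "HOL-Analysis.Analysis"
    "HOL-Library.Function_Algebras"
    "HOL-Library.Landau_Symbols"
begin

section \<open>Holomorphic maps between complex normed spaces\<close>

class complex_normed_space = real_normed_vector +
  fixes scaleC :: "complex \<Rightarrow> 'a \<Rightarrow> 'a"  (infixr \<open>*\<^sub>C\<close> 75)
  assumes scaleC_add_right: "c *\<^sub>C (x + y) = c *\<^sub>C x + c *\<^sub>C y"
    and scaleC_add_left: "(c + d) *\<^sub>C x = c *\<^sub>C x + d *\<^sub>C x"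
    and scaleC_scaleC: "c *\<^sub>C d *\<^sub>C x = (c * d) *\<^sub>C x"
    and scaleC_of_real: "complex_of_real r *\<^sub>C x = r *\<^sub>R x"
    and norm_scaleC: "norm (c *\<^sub>C x) = norm c * norm x"

instantiation complex :: complex_normed_space
begin

definition scaleC_complex :: "complex \<Rightarrow> complex \<Rightarrow> complex"
  where "scaleC_complex c z = c * z"

instance
  by standard (auto simp: scaleC_complex_def algebra_simps scaleR_conv_of_real norm_mult)

end

instantiation vec :: (complex_normed_space, finite) complex_normed_space
begin

definition scaleC_vec :: "complex \<Rightarrow> 'a ^ 'b \<Rightarrow> 'a ^ 'b"
  where "scaleC_vec c v = (\<chi> i. c *\<^sub>C (v $ i))"

instance
  by standard
    (auto simp: scaleC_vec_def vec_eq_iff scaleC_add_right scaleC_add_left scaleC_scaleC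
      scaleC_of_real norm_scaleC norm_vec_def L2_set_right_distrib)

end

instantiation prod :: (complex_normed_space, complex_normed_space) complex_normed_space
begin

definition scaleC_prod :: "complex \<Rightarrow> 'a \<times> 'b \<Rightarrow> 'a \<times> 'b"
  where "scaleC_prod c v = (c *\<^sub>C fst v, c *\<^sub>C snd v)"

instance
proof
  fix c :: complex and x :: "'a \<times> 'b"
  have "norm (c *\<^sub>C x) = sqrt ((norm c)\<^sup>2 * ((norm (fst x))\<^sup>2 + (norm (snd x))\<^sup>2))"
    by (simp add: scaleC_prod_def norm_prod_def norm_scaleC power_mult_distrib algebra_simps)
  then show "norm (c *\<^sub>C x) = norm c * norm x"
    by (simp add: norm_prod_def real_sqrt_mult)
qed (auto simp: scaleC_prod_def prod_eq_iff scaleC_add_right scaleC_add_left scaleC_scaleC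
      scaleC_of_real)

end

definition complex_differentiable_at ::
    "('e::complex_normed_space \<Rightarrow> 'f::complex_normed_space) \<Rightarrow> 'e \<Rightarrow> bool" where
  "complex_differentiable_at f x \<longleftrightarrow>
     (\<exists>D. (f has_derivative D) (at x) \<and> (\<forall>c v. D (c *\<^sub>C v) = c *\<^sub>C D v))"

text \<open>
  Holomorphy on an arbitrary subset: locally the restriction of a map that is holomorphic on an
  open set of the ambient space. On open sets this is complex differentiability at every point;
  on a complex submanifold (such as a holomorphic retract) it is holomorphy with respect to the
  induced complex structure, irrespective of the dimension of the submanifold.
\<close>

definition holo_on ::
    "('e::complex_normed_space \<Rightarrow> 'f::complex_normed_space) \<Rightarrow> 'e set \<Rightarrow> bool" where
  "holo_on f S \<longleftrightarrow>
     (\<forall>x\<in>S. \<exists>U F. open U \<and> x \<in> U \<and> (\<forall>y\<in>U. complex_differentiable_at F y) \<and>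
        (\<forall>y\<in>U \<inter> S. F y = f y))"


section \<open>Complex manifolds\<close>

text \<open>
  A topological space with charts in a complex normed space. Images of charts need not be open, so
  that an embedded set (with the identity as its only chart) is also covered; openness of the
  images is part of the predicate \<open>complex_manifold\<close>.
\<close>

record ('a, 'e) holspace =
  underlying :: "'a topology"
  charts :: "('a set \<times> ('a \<Rightarrow> 'e)) set"

definition complex_manifold :: "('a, 'e::complex_normed_space) holspace \<Rightarrow> bool" where
  "complex_manifold X \<longleftrightarrow>
     Hausdorff_space (underlying X) \<and> second_countable (underlying X) \<and>
     \<Union> (fst ` charts X) = topspace (underlying X) \<and>
     (\<forall>(V, \<phi>)\<in>charts X. openin (underlying X) V \<and> open (\<phi> ` V) \<and>
        homeomorphic_map (subtopology (underlying X) V) (top_of_set (\<phi> ` V)) \<phi>) \<and>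
     (\<forall>(V, \<phi>)\<in>charts X. \<forall>(W, \<psi>)\<in>charts X. holo_on (\<psi> \<circ> inv_into V \<phi>) (\<phi> ` (V \<inter> W)))"

definition embedded :: "'e::complex_normed_space set \<Rightarrow> ('e, 'e) holspace" where
  "embedded S = \<lparr>underlying = top_of_set S, charts = {(S, id)}\<rparr>"

definition restrict_space_to :: "('a, 'e) holspace \<Rightarrow> 'a set \<Rightarrow> ('a, 'e) holspace" where
  "restrict_space_to X U =
     \<lparr>underlying = subtopology (underlying X) U, charts = (\<lambda>(V, \<phi>). (V \<inter> U, \<phi>)) ` charts X\<rparr>"

definition product_space ::
    "('a, 'e) holspace \<Rightarrow> ('b, 'f) holspace \<Rightarrow> ('a \<times> 'b, 'e \<times> 'f) holspace" where
  "product_space X Y =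
     \<lparr>underlying = prod_topology (underlying X) (underlying Y),
      charts = {(V \<times> W, map_prod \<phi> \<psi>) |V \<phi> W \<psi>. (V, \<phi>) \<in> charts X \<and> (W, \<psi>) \<in> charts Y}\<rparr>"

definition holomorphic_map ::
    "('a, 'e::complex_normed_space) holspace \<Rightarrow> ('b, 'f::complex_normed_space) holspace \<Rightarrow>
     ('a \<Rightarrow> 'b) \<Rightarrow> bool" where
  "holomorphic_map X Y f \<longleftrightarrow>
     continuous_map (underlying X) (underlying Y) f \<and>
     (\<forall>(V, \<phi>)\<in>charts X. \<forall>(W, \<psi>)\<in>charts Y.
        holo_on (\<psi> \<circ> f \<circ> inv_into V \<phi>) (\<phi> ` {x \<in> V. f x \<in> W}))"

definition biholomorphism ::
    "('a, 'e::complex_normed_space) holspace \<Rightarrow> ('b, 'f::complex_normed_space) holspace \<Rightarrow>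
     ('a \<Rightarrow> 'b) \<Rightarrow> bool" where
  "biholomorphism X Y f \<longleftrightarrow>
     holomorphic_map X Y f \<and>
     (\<exists>g. holomorphic_map Y X g \<and>
        (\<forall>x\<in>topspace (underlying X). g (f x) = x) \<and>
        (\<forall>y\<in>topspace (underlying Y). f (g y) = y))"

definition biholomorphic ::
    "('a, 'e::complex_normed_space) holspace \<Rightarrow> ('b, 'f::complex_normed_space) holspace \<Rightarrow> bool" where
  "biholomorphic X Y \<longleftrightarrow> (\<exists>f. biholomorphism X Y f)"

definition holomorphic_retract :: "('a, 'e::complex_normed_space) holspace \<Rightarrow> 'a set \<Rightarrow> bool" where
  "holomorphic_retract X Z \<longleftrightarrow>
     (\<exists>r. holomorphic_map X X r \<and> (\<forall>x\<in>topspace (underlying X). r (r x) = r x) \<and>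
        Z = r ` topspace (underlying X))"

definition holomorphic_fibre_bundle ::
    "('a, 'e::complex_normed_space) holspace \<Rightarrow> ('b, 'f::complex_normed_space) holspace \<Rightarrow>
     ('c, 'g::complex_normed_space) holspace \<Rightarrow> ('a \<Rightarrow> 'b) \<Rightarrow> bool" where
  "holomorphic_fibre_bundle E B F \<pi> \<longleftrightarrow>
     holomorphic_map E B \<pi> \<and>
     (\<forall>b\<in>topspace (underlying B). \<exists>U h. openin (underlying B) U \<and> b \<in> U \<and>
        biholomorphism
          (restrict_space_to E {x \<in> topspace (underlying E). \<pi> x \<in> U})
          (product_space (restrict_space_to B U) F) h \<and>
        (\<forall>x\<in>topspace (underlying E). \<pi> x \<in> U \<longrightarrow> fst (h x) = \<pi> x))"


section \<open>The Kobayashi pseudodistance and the infinitesimal Kobayashi metric\<close>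

abbreviation unit_disc :: "complex set" where
  "unit_disc \<equiv> ball 0 1"

definition poincare_dist :: "complex \<Rightarrow> complex \<Rightarrow> real" where
  "poincare_dist a b = artanh (norm ((a - b) / (1 - cnj b * a)))"

inductive disc_chain :: "('a, 'e::complex_normed_space) holspace \<Rightarrow> 'a \<Rightarrow> 'a \<Rightarrow> real \<Rightarrow> bool"
  for X where
  refl: "p \<in> topspace (underlying X) \<Longrightarrow> disc_chain X p p 0"
| step: "disc_chain X p (f a) s \<Longrightarrow> holomorphic_map (embedded unit_disc) X f \<Longrightarrow>
     a \<in> unit_disc \<Longrightarrow> b \<in> unit_disc \<Longrightarrow> disc_chain X p (f b) (s + poincare_dist a b)"

definition kobayashi_dist :: "('a, 'e::complex_normed_space) holspace \<Rightarrow> 'a \<Rightarrow> 'a \<Rightarrow> ereal" where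
  "kobayashi_dist X p q = Inf {ereal s |s. disc_chain X p q s}"

definition kobayashi_hyperbolic :: "('a, 'e::complex_normed_space) holspace \<Rightarrow> bool" where
  "kobayashi_hyperbolic X \<longleftrightarrow>
     (\<forall>p\<in>topspace (underlying X). \<forall>q\<in>topspace (underlying X). p \<noteq> q \<longrightarrow> 0 < kobayashi_dist X p q)"

text \<open>
  A tangent vector at \<open>p\<close> is a family of coordinate vectors indexed by the charts around \<open>p\<close> and
  transforming by the derivatives of the coordinate changes (and \<open>0\<close> at all other indices).
\<close>

type_synonym ('a, 'e) tangent = "'a set \<times> ('a \<Rightarrow> 'e) \<Rightarrow> 'e"

definition charts_at :: "('a, 'e) holspace \<Rightarrow> 'a \<Rightarrow> ('a set \<times> ('a \<Rightarrow> 'e)) set" where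
  "charts_at X p = {c \<in> charts X. p \<in> fst c}"

definition tangent_space ::
    "('a, 'e::complex_normed_space) holspace \<Rightarrow> 'a \<Rightarrow> ('a, 'e) tangent set" where
  "tangent_space X p =
     {\<xi>. (\<forall>c. c \<notin> charts_at X p \<longrightarrow> \<xi> c = 0) \<and>
         (\<forall>(V, \<phi>)\<in>charts_at X p. \<forall>(W, \<psi>)\<in>charts_at X p.
            \<xi> (W, \<psi>) = frechet_derivative (\<psi> \<circ> inv_into V \<phi>) (at (\<phi> p)) (\<xi> (V, \<phi>)))}"

definition tangent_scale ::
    "complex \<Rightarrow> ('a, 'e::complex_normed_space) tangent \<Rightarrow> ('a, 'e) tangent" where
  "tangent_scale a \<xi> = (\<lambda>c. a *\<^sub>C \<xi> c)"

lemma vector_space_tangent_scale: "vector_space tangent_scale"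
proof
  fix \<xi> :: "('a, 'e::complex_normed_space) tangent"
  have "1 *\<^sub>C y = y" for y :: 'e
    using scaleC_of_real[of 1 y] by simp
  then show "tangent_scale 1 \<xi> = \<xi>"
    by (simp add: tangent_scale_def)
qed (auto simp: tangent_scale_def fun_eq_iff scaleC_add_right scaleC_add_left scaleC_scaleC)

definition disc_velocity ::
    "('a, 'e::complex_normed_space) holspace \<Rightarrow> (complex \<Rightarrow> 'a) \<Rightarrow> ('a, 'e) tangent" where
  "disc_velocity X f =
     (\<lambda>c. if c \<in> charts_at X (f 0) then frechet_derivative (snd c \<circ> f) (at 0) 1 else 0)"

definition kobayashi_metric ::
    "('a, 'e::complex_normed_space) holspace \<Rightarrow> 'a \<Rightarrow> ('a, 'e) tangent \<Rightarrow> real" where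
  "kobayashi_metric X p \<xi> =
     Inf {\<alpha>. \<alpha> > 0 \<and> (\<exists>f. holomorphic_map (embedded unit_disc) X f \<and> f 0 = p \<and>
            tangent_scale (of_real \<alpha>) (disc_velocity X f) = \<xi>)}"

definition kobayashi_corank_at :: "('a, 'e::complex_normed_space) holspace \<Rightarrow> 'a \<Rightarrow> nat" where
  "kobayashi_corank_at X p =
     vector_space.dim tangent_scale {\<xi> \<in> tangent_space X p. kobayashi_metric X p \<xi> = 0}"

definition has_kobayashi_corank :: "('a, 'e::complex_normed_space) holspace \<Rightarrow> nat \<Rightarrow> bool" where
  "has_kobayashi_corank X k \<longleftrightarrow> (\<forall>p\<in>topspace (underlying X). kobayashi_corank_at X p = k)"


section \<open>Boundary regularity and the Levi form\<close>

primrec Ck_on :: "nat \<Rightarrow> ('a::real_normed_vector \<Rightarrow> 'b::real_normed_vector) \<Rightarrow> 'a set \<Rightarrow> bool" where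
  "Ck_on 0 f U \<longleftrightarrow> continuous_on U f"
| "Ck_on (Suc k) f U \<longleftrightarrow>
     (\<forall>x\<in>U. f differentiable (at x)) \<and> (\<forall>v. Ck_on k (\<lambda>x. frechet_derivative f (at x) v) U)"

definition C_on :: "enat \<Rightarrow> ('a::real_normed_vector \<Rightarrow> 'b::real_normed_vector) \<Rightarrow> 'a set \<Rightarrow> bool" where
  "C_on n f U \<longleftrightarrow> (\<forall>k. enat k \<le> n \<longrightarrow> Ck_on k f U)"

definition domain :: "'a::topological_space set \<Rightarrow> bool" where
  "domain \<Omega> \<longleftrightarrow> open \<Omega> \<and> connected \<Omega> \<and> \<Omega> \<noteq> {}"

definition local_defining_function ::
    "enat \<Rightarrow> 'a::real_normed_vector set \<Rightarrow> 'a \<Rightarrow> 'a set \<Rightarrow> ('a \<Rightarrow> real) \<Rightarrow> bool" where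
  "local_defining_function n \<Omega> p U \<rho> \<longleftrightarrow>
     open U \<and> p \<in> U \<and> C_on n \<rho> U \<and> \<Omega> \<inter> U = {z \<in> U. \<rho> z < 0} \<and>
     (\<forall>z\<in>U. \<rho> z = 0 \<longrightarrow> frechet_derivative \<rho> (at z) \<noteq> (\<lambda>v. 0))"

definition smooth_boundary :: "'a::real_normed_vector set \<Rightarrow> bool" where
  "smooth_boundary \<Omega> \<longleftrightarrow> (\<forall>p\<in>frontier \<Omega>. \<exists>U \<rho>. local_defining_function \<infinity> \<Omega> p U \<rho>)"

text \<open>The Wirtinger derivatives \<open>\<partial>f/\<partial>z\<^sub>j\<close> and \<open>\<partial>f/\<partial>(cnj z\<^sub>j)\<close>.\<close>

definition wirtinger :: "'n::finite \<Rightarrow> (complex ^ 'n \<Rightarrow> complex) \<Rightarrow> complex ^ 'n \<Rightarrow> complex" where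
  "wirtinger j f z =
     (frechet_derivative f (at z) (axis j 1) - \<i> * frechet_derivative f (at z) (axis j \<i>)) / 2"

definition wirtinger_bar :: "'n::finite \<Rightarrow> (complex ^ 'n \<Rightarrow> complex) \<Rightarrow> complex ^ 'n \<Rightarrow> complex" where
  "wirtinger_bar j f z =
     (frechet_derivative f (at z) (axis j 1) + \<i> * frechet_derivative f (at z) (axis j \<i>)) / 2"

definition complex_gradient :: "(complex ^ 'n::finite \<Rightarrow> real) \<Rightarrow> complex ^ 'n \<Rightarrow> complex ^ 'n" where
  "complex_gradient \<rho> z = (\<chi> j. 2 * wirtinger_bar j (\<lambda>w. of_real (\<rho> w)) z)"

definition complex_tangent_space :: "(complex ^ 'n::finite \<Rightarrow> real) \<Rightarrow> complex ^ 'n \<Rightarrow> (complex ^ 'n) set" where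
  "complex_tangent_space \<rho> p = {v. (\<Sum>j\<in>UNIV. wirtinger j (\<lambda>w. of_real (\<rho> w)) p * v $ j) = 0}"

definition levi_form ::
    "(complex ^ 'n::finite \<Rightarrow> real) \<Rightarrow> complex ^ 'n \<Rightarrow> complex ^ 'n \<Rightarrow> complex ^ 'n \<Rightarrow> complex" where
  "levi_form \<rho> p v w =
     (\<Sum>j\<in>UNIV. \<Sum>k\<in>UNIV.
        wirtinger j (wirtinger_bar k (\<lambda>z. of_real (\<rho> z))) p * v $ j * cnj (w $ k))"

definition hermitian_inner :: "complex ^ 'n::finite \<Rightarrow> complex ^ 'n \<Rightarrow> complex" where
  "hermitian_inner v w = (\<Sum>j\<in>UNIV. v $ j * cnj (w $ j))"

text \<open>
  The number of positive eigenvalues (with multiplicity) of the Levi form on the complex tangent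
  space: eigenspaces of a Hermitian form are independent, so this is the dimension of the span of
  all eigenvectors with positive eigenvalue.
\<close>

definition levi_positive_eigenvalues :: "(complex ^ 'n::finite \<Rightarrow> real) \<Rightarrow> complex ^ 'n \<Rightarrow> nat" where
  "levi_positive_eigenvalues \<rho> p =
     vec.dim {v \<in> complex_tangent_space \<rho> p. \<exists>l::real. l > 0 \<and>
        (\<forall>w\<in>complex_tangent_space \<rho> p. levi_form \<rho> p v w = of_real l * hermitian_inner v w)}"

definition levi_positive_semidefinite :: "(complex ^ 'n::finite \<Rightarrow> real) \<Rightarrow> complex ^ 'n \<Rightarrow> bool" where
  "levi_positive_semidefinite \<rho> p \<longleftrightarrow>
     (\<forall>v\<in>complex_tangent_space \<rho> p. 0 \<le> Re (levi_form \<rho> p v v))"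

definition levi_positive_definite :: "(complex ^ 'n::finite \<Rightarrow> real) \<Rightarrow> complex ^ 'n \<Rightarrow> bool" where
  "levi_positive_definite \<rho> p \<longleftrightarrow>
     (\<forall>v\<in>complex_tangent_space \<rho> p. v \<noteq> 0 \<longrightarrow> 0 < Re (levi_form \<rho> p v v))"


section \<open>D'Angelo 1-type\<close>

definition vanishing_order :: "(complex \<Rightarrow> 'b::real_normed_vector) \<Rightarrow> enat" where
  "vanishing_order f = Sup {enat k |k. (\<lambda>\<zeta>. norm (f \<zeta>)) \<in> O[at 0](\<lambda>\<zeta>. norm \<zeta> ^ k)}"

definition holomorphic_curve_germ :: "complex ^ 'n::finite \<Rightarrow> (complex \<Rightarrow> complex ^ 'n) \<Rightarrow> bool" where
  "holomorphic_curve_germ p \<gamma> \<longleftrightarrow>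
     (\<exists>V. open V \<and> 0 \<in> V \<and> holo_on \<gamma> V) \<and> \<gamma> 0 = p \<and> \<not> eventually (\<lambda>\<zeta>. \<gamma> \<zeta> = p) (nhds 0)"

definition dangelo_type :: "(complex ^ 'n::finite \<Rightarrow> real) \<Rightarrow> complex ^ 'n \<Rightarrow> ereal" where
  "dangelo_type \<rho> p =
     (SUP \<gamma>\<in>{\<gamma>. holomorphic_curve_germ p \<gamma>}.
        ereal_of_enat (vanishing_order (\<rho> \<circ> \<gamma>)) /
        ereal_of_enat (vanishing_order (\<lambda>\<zeta>. \<gamma> \<zeta> - p)))"


section \<open>The three classes of domains\<close>

definition levi_corank_one_domain :: "(complex ^ 'n::finite) set \<Rightarrow> bool" where
  "levi_corank_one_domain \<Omega> \<longleftrightarrow>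
     domain \<Omega> \<and>
     (\<forall>p\<in>frontier \<Omega>. \<exists>U \<rho>. local_defining_function \<infinity> \<Omega> p U \<rho> \<and>
        levi_positive_semidefinite \<rho> p \<and>
        dangelo_type \<rho> p < \<infinity> \<and>
        CARD('n) \<le> levi_positive_eigenvalues \<rho> p + 2)"

definition smoothly_bounded_convex_domain :: "(complex ^ 'n::finite) set \<Rightarrow> bool" where
  "smoothly_bounded_convex_domain \<Omega> \<longleftrightarrow>
     domain \<Omega> \<and> bounded \<Omega> \<and> convex \<Omega> \<and> smooth_boundary \<Omega>"

text \<open>
  A smooth boundary point is one near which the boundary is a hypersurface of class \<open>C\<^sup>2\<close>, the
  regularity of the \<open>\<rho> i\<close>; positive definiteness does not depend on the local defining function.
\<close>

definition strongly_pseudoconvex_polyhedral_domain :: "(complex ^ 'n::finite) set \<Rightarrow> bool" where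
  "strongly_pseudoconvex_polyhedral_domain \<Omega> \<longleftrightarrow>
     domain \<Omega> \<and> bounded \<Omega> \<and>
     (\<exists>(k::nat) \<rho>. k \<ge> 2 \<and>
        (\<forall>i<k. C_on 2 (\<rho> i) UNIV) \<and>
        \<Omega> = {z. \<forall>i<k. \<rho> i z < 0} \<and>
        (\<forall>I\<subseteq>{..<k}. \<forall>p. (\<forall>i\<in>I. \<rho> i p = 0) \<longrightarrow>
           (\<forall>a. (\<Sum>i\<in>I. a i *s complex_gradient (\<rho> i) p) = 0 \<longrightarrow> (\<forall>i\<in>I. a i = 0)))) \<and>
     (\<forall>p\<in>frontier \<Omega>. \<forall>U \<rho>. local_defining_function 2 \<Omega> p U \<rho> \<longrightarrow> levi_positive_definite \<rho> p)"

end

theory Submission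
  imports Defs "HOL-Complex_Analysis.Complex_Analysis"
begin

text \<open>
  A retract of a simply connected space is simply connected. At a fixed point of the retraction \<open>r\<close> its
  derivative is a projection. If it had rank 0 or 2, the base \<open>Z\<close> of the line bundle would have an
  isolated or an interior point, and invariance of domain would contradict \<open>dim E = 2\<close>. So the rank
  is 1 and \<open>Z\<close> is a Riemann surface, on which the coordinates of the bounded domain \<open>\<Omega>\<close> are bounded
  holomorphic functions that separate points.

  Such a surface has a Green's function \<open>g p\<close> for each pole \<open>p\<close>, obtained by Perron's method. Everything is
  written multiplicatively, with moduli of holomorphic functions in place of harmonic functions. As
  \<open>Z\<close> is simply connected, there is a holomorphic \<open>F p\<close> with modulus \<open>exp (- g p)\<close>, and \<open>F p\<close>
  dominates every holomorphic \<open>h\<close> into the disc with \<open>h p = 0\<close>. Applied to \<open>F p\<close>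
  followed by the disc automorphism taking \<open>F p q\<close> to 0, domination by \<open>F q\<close> yields the symmetry of Green's
  function; hence both functions have equal modulus at \<open>p\<close> and then everywhere, so that \<open>F p\<close> is injective. Its image
  is a disc by the Riemann mapping theorem.
\<close>

section \<open>Potential theory on the disc\<close>

text \<open>Exponentiation turns Green's function, infinite at its pole, into a continuous function
  with values in the interval from 0 to 1 that vanishes at \<open>p\<close>. Comparison and limit
  arguments then become maximum modulus, Montel and Hurwitz. A harmonic conjugate becomes a local
  holomorphic function of prescribed modulus, unique up to a unimodular constant. These constants
  form a locally constant cocycle, which is trivialised by transport along paths.

  The obstacle in uniformization is that a Riemann surface may have no Green's function. Here the
  differences \<open>x z - x p\<close> and \<open>y z - y p\<close> have \<open>p\<close> as their
  only common zero, so the larger of their moduli is a competitor that is positive elsewhere, and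
  the Perron supremum cannot degenerate. Symmetry is classically an application of Green's formula
  on an exhaustion; the extremal property replaces every integral.

  For the retract, a bound on \<open>r z - r z' - P (z - z')\<close> for pairs of points near a
  fixed point serves in all three rank cases, in place of an implicit function theorem or a constant
  rank argument.\<close>

lemma norm_maximum_principle:
  fixes V :: "complex set" and q :: "complex \<Rightarrow> real"
  assumes "open V" "bounded V" and cont: "continuous_on (closure V) q"
    and loc: "\<And>z. z \<in> V \<Longrightarrow> \<exists>U Q. open U \<and> z \<in> U \<and> Q holomorphic_on U \<and> (\<forall>w\<in>U. norm (Q w) = q w)"
    and front: "\<And>z. z \<in> frontier V \<Longrightarrow> q z \<le> B"
    and "z \<in> V"
  shows "q z \<le> B"
proof (rule ccontr)
  assume "\<not> q z \<le> B"
  have cpt: "compact (closure V)"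
    using \<open>bounded V\<close> by simp
  have "closure V \<noteq> {}"
    using \<open>z \<in> V\<close> closure_subset by blast
  then obtain z0 where z0: "z0 \<in> closure V" "\<And>w. w \<in> closure V \<Longrightarrow> q w \<le> q z0"
    using continuous_attains_sup[OF cpt _ cont] by blast
  define K where "K = {w \<in> closure V. q w = q z0}"
  have "closed K"
    using continuous_closed_preimage_constant[OF cont] by (simp add: K_def)
  moreover have "closure V \<inter> K = K"
    by (auto simp: K_def)
  ultimately have "compact K"
    using compact_Int_closed[OF cpt, of K] by simp
  moreover have "K \<noteq> {}"
    using z0 by (auto simp: K_def)
  \<comment> \<open>\<open>V\<close> may be disconnected, so constancy is not propagated. The
    rightmost maximum point is taken instead: inside \<open>V\<close>, constancy near it would give
    a maximum point further right.\<close>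
  ultimately obtain z1 where z1: "z1 \<in> K" "\<And>w. w \<in> K \<Longrightarrow> Re w \<le> Re z1"
    using continuous_attains_sup[of K Re] continuous_on_Re[OF continuous_on_id] by blast
  have "q z1 > B"
    using z1(1) z0(2)[of z] \<open>z \<in> V\<close> \<open>\<not> q z \<le> B\<close> closure_subset[of V] by (auto simp: K_def)
  then have "z1 \<in> V"
    using front[of z1] z1(1) \<open>open V\<close> by (force simp: K_def frontier_def interior_open)
  then obtain U Q where UQ: "open U" "z1 \<in> U" "Q holomorphic_on U" "\<forall>w\<in>U. norm (Q w) = q w"
    using loc by blast
  obtain e where e: "e > 0" "ball z1 e \<subseteq> U \<inter> V"
    using UQ(1,2) \<open>open V\<close> \<open>z1 \<in> V\<close> by (meson IntI open_Int open_contains_ball)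
  have le: "norm (Q w) \<le> norm (Q z1)" if "w \<in> ball z1 e" for w
  proof -
    have "w \<in> U" "w \<in> closure V"
      using that e closure_subset[of V] by auto
    then show ?thesis
      using UQ(2,4) z0(2)[of w] z1(1) by (simp add: K_def)
  qed
  have "Q constant_on ball z1 e"
  proof (rule maximum_modulus_principle[of Q "ball z1 e" "ball z1 e" z1])
    show "Q holomorphic_on ball z1 e"
      using UQ(3) e(2) holomorphic_on_subset by blast
  qed (use e le in auto)
  then obtain c where c: "\<And>w. w \<in> ball z1 e \<Longrightarrow> Q w = c"
    by (auto simp: constant_on_def)
  define w where "w = z1 + of_real (e/2)"
  have w: "w \<in> ball z1 e"
    using e by (simp add: w_def dist_norm)
  have "q w = q z1"
  proof -
    have "w \<in> U"
      using w e by auto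
    then show ?thesis
      using c[OF w] c[of z1] e(1) UQ(2,4) by (metis centre_in_ball)
  qed
  then have "w \<in> K"
    using z1(1) w e closure_subset[of V] by (auto simp: K_def)
  then show False
    using z1(2)[of w] e by (simp add: w_def)
qed

lemma holomorphic_on_divide_zero:
  assumes "f holomorphic_on A" "open A" "f 0 = 0"
  obtains T where "T holomorphic_on A" "\<And>z. z \<in> A \<Longrightarrow> f z = z * T z"
proof -
  let ?T = "\<lambda>z. if z = 0 then deriv f 0 else f z / z"
  have "?T holomorphic_on A"
    using pole_theorem_open_0[of f A 0] assms pole_lemma_open[of f A 0] by simp
  moreover have "f z = z * ?T z" for z
    using assms by simp
  ultimately show thesis
    by (rule that)
qed

text \<open>Near a point with \<open>g \<noteq> 0\<close> the quotient has modulus 1 and is constant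
  by the maximum principle. The relation \<open>f = c * g\<close>, free of division, then continues
  analytically across the zeros of \<open>g\<close>.\<close>

lemma norm_eq_imp_unimodular_multiple:
  assumes "f holomorphic_on V" "g holomorphic_on V" "open V" "connected V"
    and eq: "\<And>z. z \<in> V \<Longrightarrow> norm (f z) = norm (g z)"
  obtains c where "norm c = 1" "\<And>z. z \<in> V \<Longrightarrow> f z = c * g z"
proof (cases "\<forall>z\<in>V. g z = 0")
  case True
  then show thesis
    using that[of 1] eq by simp
next
  case False
  then obtain a where a: "a \<in> V" "g a \<noteq> 0" by blast
  have "continuous_on V g"
    using assms(2) holomorphic_on_imp_continuous_on by blast
  then have "open (V \<inter> g -` (- {0}))"
    using \<open>open V\<close> continuous_open_preimage[of V g "- {0}"] by blast
  then obtain e where e: "e > 0" "ball a e \<subseteq> V \<inter> g -` (- {0})"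
    using a by (metis ComplI IntI open_contains_ball singletonD vimageI)
  have hol: "(\<lambda>z. f z / g z) holomorphic_on ball a e"
    by (intro holomorphic_intros holomorphic_on_subset[OF assms(1)] holomorphic_on_subset[OF assms(2)])
      (use e in auto)
  have n1: "norm (f z / g z) = 1" if "z \<in> ball a e" for z
  proof -
    have "z \<in> V" "g z \<noteq> 0"
      using that e by auto
    then show ?thesis
      using eq by (simp add: norm_divide)
  qed
  have "(\<lambda>z. f z / g z) constant_on ball a e"
    by (rule maximum_modulus_principle[of _ "ball a e" "ball a e" a]) (use e hol n1 in auto)
  then obtain c where c: "\<And>z. z \<in> ball a e \<Longrightarrow> f z / g z = c"
    by (auto simp: constant_on_def)
  have "f z - c * g z = 0" if "z \<in> V" for z
  proof (rule analytic_continuation_open[of "ball a e" V "\<lambda>z. f z - c * g z" "\<lambda>_. 0"])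
    show "f z - c * g z = 0" if "z \<in> ball a e" for z
    proof -
      have "g z \<noteq> 0"
        using e(2) that by auto
      then show ?thesis
        using c[OF that] by (simp add: field_simps)
    qed
  qed (use assms e that in \<open>auto intro!: holomorphic_intros\<close>)
  moreover have "norm c = 1"
    using c[of a] n1[of a] e by simp
  ultimately show thesis
    using that by simp
qed

section \<open>The Dirichlet problem on the unit disc\<close>

lemma Re_holomorphic_le:
  assumes "u holomorphic_on ball 0 1" "continuous_on (cball 0 1) u"
    and "\<And>z. z \<in> sphere 0 1 \<Longrightarrow> Re (u z) \<le> B" and "z \<in> cball 0 1"
  shows "Re (u z) \<le> B"
proof (cases "z \<in> ball 0 1")
  case True
  have "exp (Re (u z)) \<le> exp B"
  proof (rule norm_maximum_principle[of "ball 0 1" "\<lambda>z. exp (Re (u z))"])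
    fix z :: complex assume "z \<in> ball 0 1"
    have "(\<lambda>z. exp (u z)) holomorphic_on ball 0 1"
      using assms by (auto intro: holomorphic_intros)
    then show "\<exists>U Q. open U \<and> z \<in> U \<and> Q holomorphic_on U \<and> (\<forall>w\<in>U. norm (Q w) = exp (Re (u w)))"
      using \<open>z \<in> ball 0 1\<close> by (intro exI[of _ "ball 0 1"] exI[of _ "\<lambda>z. exp (u z)"]) auto
  qed (use assms True in \<open>auto intro!: continuous_intros\<close>)
  then show ?thesis by simp
next
  case False
  then show ?thesis
    using assms by auto
qed

text \<open>On the unit circle \<open>cnj z = inverse z\<close>, so real parts of polynomials form an algebra there.\<close>

inductive circle_polynomial :: "(complex \<Rightarrow> complex) \<Rightarrow> bool" where
  monomial: "circle_polynomial (\<lambda>z. c * z ^ n)"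
| add: "circle_polynomial f \<Longrightarrow> circle_polynomial g \<Longrightarrow> circle_polynomial (\<lambda>z. f z + g z)"

lemma circle_polynomial_holomorphic: "circle_polynomial f \<Longrightarrow> f holomorphic_on A"
  by (induction rule: circle_polynomial.induct) (auto intro!: holomorphic_intros)

lemma circle_polynomial_mult:
  assumes "circle_polynomial f" "circle_polynomial g"
  shows "\<exists>h. circle_polynomial h \<and> (\<forall>z\<in>sphere 0 1. Re (h z) = Re (f z) * Re (g z))"
  using assms
proof (induction rule: circle_polynomial.induct)
  case (monomial a n)
  from monomial.prems show ?case
  proof (induction rule: circle_polynomial.induct)
    case (monomial b m)
    \<comment> \<open>The product of real parts is
      \<open>Re (x * y) / 2 + Re (x * cnj y) / 2\<close>. On the circle the mixed term is a monomial
      of exponent \<open>n - m\<close>; if that is negative, the term is conjugated, which keeps its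
      real part. \<open>d\<close> and \<open>k\<close> are the resulting coefficient and
      exponent.\<close>
    define d where "d = (if m \<le> n then a * cnj b else cnj a * b)"
    define k where "k = (if m \<le> n then n - m else m - n)"
    have "Re (a * b / 2 * z ^ (n + m) + d / 2 * z ^ k) = Re (a * z ^ n) * Re (b * z ^ m)"
      if z: "z \<in> sphere 0 1" for z
    proof -
      have zz: "z * cnj z = 1"
        using z by (simp add: complex_norm_square[symmetric])
      have pw: "z ^ j * cnj z ^ j = 1" for j
        using zz by (metis power_mult_distrib power_one)
      have "Re (d * z ^ k) = Re (a * z ^ n * cnj (b * z ^ m))"
      proof (cases "m \<le> n")
        case True
        then have "z ^ n * cnj z ^ m = z ^ (n - m) * (z ^ m * cnj z ^ m)"
          by (metis le_add_diff_inverse2 mult.assoc power_add)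
        then show ?thesis
          using True pw[of m] by (simp add: d_def k_def algebra_simps)
      next
        case False
        then have "z ^ m * cnj z ^ n = z ^ (m - n) * (z ^ n * cnj z ^ n)"
          by (metis le_add_diff_inverse2 mult.assoc power_add nat_le_linear)
        then have "d * z ^ k = cnj (a * z ^ n * cnj (b * z ^ m))"
          using False pw[of n] by (simp add: d_def k_def algebra_simps)
        then show ?thesis
          by (metis cnj.sel(1))
      qed
      moreover have "Re x * Re y = Re (x * y) / 2 + Re (x * cnj y) / 2" for x y
        by (simp add: field_simps)
      moreover have "a * b / 2 * z ^ (n + m) = a * z ^ n * (b * z ^ m) / 2" "d / 2 * z ^ k = d * z ^ k / 2"
        by (simp_all add: power_add)
      ultimately show ?thesis
        by (simp only: plus_complex.sel Re_divide_numeral)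
    qed
    then show ?case
      using circle_polynomial.add[OF circle_polynomial.monomial[of "a * b / 2" "n + m"]
          circle_polynomial.monomial[of "d / 2" k]]
      by blast
  next
    case (add f g)
    then obtain h1 h2 where
      "circle_polynomial h1" "\<forall>z\<in>sphere 0 1. Re (h1 z) = Re (a * z ^ n) * Re (f z)"
      "circle_polynomial h2" "\<forall>z\<in>sphere 0 1. Re (h2 z) = Re (a * z ^ n) * Re (g z)"
      by blast
    then show ?case
      by (intro exI[of _ "\<lambda>z. h1 z + h2 z"])
        (auto intro: circle_polynomial.add simp del: times_complex.sel simp: distrib_left)
  qed
next
  case (add f1 f2)
  then obtain h1 h2 where
    "circle_polynomial h1" "\<forall>z\<in>sphere 0 1. Re (h1 z) = Re (f1 z) * Re (g z)"
    "circle_polynomial h2" "\<forall>z\<in>sphere 0 1. Re (h2 z) = Re (f2 z) * Re (g z)"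
    by blast
  then show ?case
    by (intro exI[of _ "\<lambda>z. h1 z + h2 z"])
      (auto intro: circle_polynomial.add simp: distrib_right)
qed

text \<open>Stone-Weierstrass for trigonometric polynomials. Written as real parts of polynomials in
  \<open>z\<close>, they come with their harmonic extension to the disc, so that no Poisson kernel
  is involved.\<close>

lemma circle_polynomial_dense:
  assumes "continuous_on (sphere 0 1) b" "e > 0"
  obtains f where "circle_polynomial f" "\<And>z. z \<in> sphere 0 1 \<Longrightarrow> \<bar>b z - Re (f z)\<bar> < e"
proof -
  define R :: "(complex \<Rightarrow> real) set"
    where "R = {g. continuous_on (sphere 0 1) g \<and> (\<exists>f. circle_polynomial f \<and> (\<forall>z\<in>sphere 0 1. g z = Re (f z)))}"
  have cont: "continuous_on (sphere 0 1) (\<lambda>z. Re (f z))" if "circle_polynomial f" for f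
    using that circle_polynomial_holomorphic holomorphic_on_imp_continuous_on
    by (intro continuous_intros) blast
  interpret function_ring_on R "sphere 0 1"
  proof
    fix c :: real
    show "(\<lambda>_. c) \<in> R"
      using monomial[of "of_real c" 0] by (auto simp: R_def intro!: exI[of _ "\<lambda>z. of_real c * z ^ 0"])
  next
    fix f g assume "f \<in> R" "g \<in> R"
    then show "(\<lambda>x. f x + g x) \<in> R"
      by (auto simp: R_def intro!: continuous_intros) (metis add plus_complex.sel(1))
    from \<open>f \<in> R\<close> \<open>g \<in> R\<close> show "(\<lambda>x. f x * g x) \<in> R"
      by (auto simp: R_def intro!: continuous_intros) (metis circle_polynomial_mult mem_sphere_0)
  next
    fix x y :: complex assume "x \<noteq> y"
    have "Re x \<noteq> Re y \<or> Re (- \<i> * x) \<noteq> Re (- \<i> * y)"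
      using \<open>x \<noteq> y\<close> by (simp add: complex_eq_iff)
    moreover have "circle_polynomial (\<lambda>z. c * z)" for c
      using monomial[of c 1] by simp
    then have "(\<lambda>z. Re (c * z)) \<in> R" for c
      using cont by (force simp: R_def)
    from this[of 1] this[of "- \<i>"] have "Re \<in> R" "(\<lambda>z. Re (- \<i> * z)) \<in> R"
      by simp_all
    ultimately show "\<exists>f\<in>R. f x \<noteq> f y"
      by metis
  qed (auto simp: R_def)
  obtain g where "g \<in> R" "\<forall>x\<in>sphere 0 1. \<bar>b x - g x\<bar> < e"
    using Stone_Weierstrass_basic assms by blast
  then show thesis
    using that by (auto simp: R_def)
qed

text \<open>In multiplicative form: \<open>ln k\<close> is the harmonic extension of \<open>ln b\<close>.\<close>

lemma disc_Dirichlet: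
  fixes b :: "complex \<Rightarrow> real"
  assumes "continuous_on (sphere 0 1) b" and pos: "\<And>z. z \<in> sphere 0 1 \<Longrightarrow> b z > 0"
  obtains k H where "continuous_on (cball 0 1) k" "\<And>z. z \<in> cball 0 1 \<Longrightarrow> k z > 0"
    "\<And>z. z \<in> sphere 0 1 \<Longrightarrow> k z = b z"
    "H holomorphic_on ball 0 1" "\<And>z. z \<in> ball 0 1 \<Longrightarrow> norm (H z) = k z"
proof -
  have lncont: "continuous_on (sphere 0 1) (\<lambda>z. ln (b z))"
    using assms by (intro continuous_intros) (auto dest: pos)
  have "\<exists>f. circle_polynomial f \<and> (\<forall>z\<in>sphere 0 1. \<bar>ln (b z) - Re (f z)\<bar> < 1 / Suc n)" for n
    using circle_polynomial_dense[OF lncont, of "1 / Suc n"]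
    by (metis of_nat_0_less_iff zero_less_Suc zero_less_divide_1_iff)
  then obtain f where f: "\<And>n. circle_polynomial (f n)"
    and fb: "\<And>n z. z \<in> sphere 0 1 \<Longrightarrow> \<bar>ln (b z) - Re (f n z)\<bar> < 1 / Suc n"
    by metis
  have hol: "f n holomorphic_on A" for n A
    using f circle_polynomial_holomorphic by blast
  have contf: "continuous_on A (f n)" for n A
    using hol holomorphic_on_imp_continuous_on by blast
  \<comment> \<open>Two approximants are close on the circle because both are close to
    \<open>ln b\<close>; the maximum principle carries the estimate into the disc and gives uniform
    convergence of the real parts.\<close>
  have diff: "Re (f n z) - Re (f m z) \<le> 1 / Suc n + 1 / Suc m" if "z \<in> cball 0 1" for n m z
  proof -
    have "Re (f n z - f m z) \<le> 1 / Suc n + 1 / Suc m"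
    proof (rule Re_holomorphic_le[of "\<lambda>z. f n z - f m z"])
      show "Re (f n z - f m z) \<le> 1 / Suc n + 1 / Suc m" if "z \<in> sphere 0 1" for z
        using fb[OF that, of n] fb[OF that, of m] by (auto simp: minus_complex.sel)
    qed (use that hol contf in \<open>auto intro!: holomorphic_intros continuous_intros\<close>)
    then show ?thesis by simp
  qed
  have "uniformly_Cauchy_on (cball 0 1) (\<lambda>n z. Re (f n z))"
    unfolding uniformly_Cauchy_on_def
  proof (intro allI impI)
    fix e :: real assume "e > 0"
    then obtain N where N: "1 / Suc N < e / 2"
      using nat_approx_posE half_gt_zero by blast
    have "dist (Re (f m x)) (Re (f n x)) < e" if "x \<in> cball 0 1" "m \<ge> N" "n \<ge> N" for x m n
    proof -
      have "1 / Suc m \<le> 1 / Suc N" "1 / Suc n \<le> 1 / Suc N"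
        using that by (auto simp: frac_le)
      then show ?thesis
        using diff[OF that(1), of m n] diff[OF that(1), of n m] N by (auto simp: dist_real_def)
    qed
    then show "\<exists>M. \<forall>x\<in>cball 0 1. \<forall>m\<ge>M. \<forall>n\<ge>M. dist (Re (f m x)) (Re (f n x)) < e"
      by blast
  qed
  then obtain u where u: "uniform_limit (cball 0 1) (\<lambda>n z. Re (f n z)) u sequentially"
    using uniformly_convergent_eq_Cauchy unfolding uniformly_convergent_on_def
    by (metis Cauchy_uniformly_convergent uniformly_convergent_on_def)
  have contu: "continuous_on (cball 0 1) u"
    by (rule uniform_limit_theorem[OF always_eventually u]) (auto intro!: continuous_intros contf)
  have limu: "(\<lambda>n. Re (f n z)) \<longlonglongrightarrow> u z" if "z \<in> cball 0 1" for z
    using u that by (rule tendsto_uniform_limitI)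
  have "(\<lambda>n. Re (f n z)) \<longlonglongrightarrow> ln (b z)" if "z \<in> sphere 0 1" for z
  proof (rule LIMSEQ_I)
    fix e :: real assume "e > 0"
    then obtain N where N: "1 / Suc N < e"
      using nat_approx_posE by blast
    have "norm (Re (f n z) - ln (b z)) < e" if "n \<ge> N" for n
    proof -
      have "1 / Suc n \<le> 1 / Suc N"
        using that by (auto simp: frac_le)
      then show ?thesis
        using fb[OF \<open>z \<in> sphere 0 1\<close>, of n] N by auto
    qed
    then show "\<exists>N. \<forall>n\<ge>N. norm (Re (f n z) - ln (b z)) < e"
      by blast
  qed
  then have ub: "u z = ln (b z)" if "z \<in> sphere 0 1" for z
    using limu[of z] that LIMSEQ_unique by (metis mem_cball_0 mem_sphere_0 order_refl)
  have "compact (f 0 ` cball 0 1)"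
    using contf by (intro compact_continuous_image) auto
  then obtain C where C: "\<And>z. z \<in> cball 0 1 \<Longrightarrow> norm (f 0 z) \<le> C"
    by (meson bounded_iff compact_imp_bounded imageI)
  \<comment> \<open>The 2 bounds \<open>1 / Suc n + 1 / Suc 0\<close>, the distance in real part
    from the approximant \<open>f 0\<close>, which is itself bounded by \<open>C\<close>.\<close>
  have bd: "norm (exp (f n z)) \<le> exp (C + 2)" if "z \<in> cball 0 1" for n z
  proof -
    have "Re (f n z) \<le> Re (f 0 z) + 1 / Suc n + 1"
      using diff[OF that, of n 0] by simp
    also have "\<dots> \<le> C + 2"
      using C[OF that] complex_Re_le_cmod[of "f 0 z"] by (simp add: divide_le_eq)
        (smt (verit) divide_le_eq_1_pos of_nat_0_le_iff)
    finally show ?thesis by simp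
  qed
  let ?\<H> = "{h. h holomorphic_on ball 0 1 \<and> (\<forall>z\<in>ball 0 1. norm (h z) \<le> exp (C + 2))}"
  have "range (\<lambda>n z. exp (f n z)) \<subseteq> ?\<H>"
    using bd by (auto intro!: holomorphic_intros hol simp del: norm_exp_eq_Re)
  moreover have "\<exists>B. \<forall>h\<in>?\<H>. \<forall>z\<in>K. norm (h z) \<le> B" if "K \<subseteq> ball 0 1" for K
    using that by blast
  \<comment> \<open>The imaginary parts of the \<open>f n\<close> carry arbitrary additive constants
    and need not converge. Only the moduli of \<open>exp (f n)\<close> are controlled, so a
    holomorphic limit is extracted along a subsequence.\<close>
  ultimately obtain H r where H: "H holomorphic_on ball 0 1" "strict_mono (r :: nat \<Rightarrow> nat)"
    and limH: "\<And>z. z \<in> ball 0 1 \<Longrightarrow> (\<lambda>n. exp (f (r n) z)) \<longlonglongrightarrow> H z"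
    using Montel[of "ball 0 1" ?\<H> "\<lambda>n z. exp (f n z)"] by (smt (verit) mem_Collect_eq open_ball)
  have "norm (H z) = exp (u z)" if "z \<in> ball 0 1" for z
  proof (rule LIMSEQ_unique)
    show "(\<lambda>n. norm (exp (f (r n) z))) \<longlonglongrightarrow> norm (H z)"
      using limH[OF that] by (rule tendsto_norm)
    have "(\<lambda>n. Re (f (r n) z)) \<longlonglongrightarrow> u z"
      using limu[of z] that LIMSEQ_subseq_LIMSEQ[OF _ H(2)] by (force simp: o_def)
    then show "(\<lambda>n. norm (exp (f (r n) z))) \<longlonglongrightarrow> exp (u z)"
      by (auto intro: tendsto_exp)
  qed
  then show thesis
    using that[of "\<lambda>z. exp (u z)" H] contu ub pos H(1) by (auto intro!: continuous_intros)
qed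

section \<open>Cocycles on simply connected spaces\<close>

lemma locally_constant_on_connected:
  fixes f :: "'a::topological_space \<Rightarrow> 'b::topological_space"
  assumes "connected Q"
    and "\<And>q. q \<in> Q \<Longrightarrow> \<exists>N. open N \<and> q \<in> N \<and> (\<forall>q'\<in>N \<inter> Q. f q' = f q)"
    and "x \<in> Q" "y \<in> Q"
  shows "f x = f y"
proof (rule ccontr)
  assume ne: "f x \<noteq> f y"
  obtain N where N: "\<And>q. q \<in> Q \<Longrightarrow> open (N q) \<and> q \<in> N q \<and> (\<forall>q'\<in>N q \<inter> Q. f q' = f q)"
    using assms(2) by metis
  then have mem: "q \<in> N q" and "open (N q)" if "q \<in> Q" for q
    using that by blast+
  define A where "A = (\<Union>q\<in>{q\<in>Q. f q = f x}. N q)"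
  define B where "B = (\<Union>q\<in>{q\<in>Q. f q \<noteq> f x}. N q)"
  have op: "open A" "open B"
    using \<open>\<And>q. q \<in> Q \<Longrightarrow> open (N q)\<close> by (auto simp: A_def B_def)
  have A: "f q = f x" if q: "q \<in> A" "q \<in> Q" for q
  proof -
    obtain r where r: "r \<in> Q" "f r = f x" "q \<in> N r"
      using q unfolding A_def by blast
    then show ?thesis
      using N[OF r(1)] r q by (metis IntI)
  qed
  have B: "f q \<noteq> f x" if q: "q \<in> B" "q \<in> Q" for q
  proof -
    obtain r where r: "r \<in> Q" "f r \<noteq> f x" "q \<in> N r"
      using q unfolding B_def by blast
    then show ?thesis
      using N[OF r(1)] r q by (metis IntI)
  qed
  have "q \<in> A \<union> B" if "q \<in> Q" for q
    unfolding A_def B_def using mem that by blast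
  then have sub: "Q \<subseteq> A \<union> B"
    by (rule subsetI)
  have dis: "A \<inter> B \<inter> Q = {}"
    using A B by blast
  have "x \<in> A"
    unfolding A_def using mem assms(3) by (intro UN_I[of x]) simp_all
  moreover have "y \<in> B"
    unfolding B_def using mem assms(4) ne[symmetric] by (intro UN_I[of y]) simp_all
  ultimately show False
    using connectedD[OF \<open>connected Q\<close> op dis sub] assms(3,4) by blast
qed

text \<open>A Cech cocycle with values in the unit circle. The transition factors depend on the
  point and are only locally constant, since an overlap \<open>U i \<inter> U j\<close> may be
  disconnected.\<close>

locale unimodular_cocycle =
  fixes S :: "'a::real_normed_vector set" and I :: "'i set" and U :: "'i \<Rightarrow> 'a set"
    and c :: "'i \<Rightarrow> 'i \<Rightarrow> 'a \<Rightarrow> complex"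
  assumes openin_U: "i \<in> I \<Longrightarrow> openin (top_of_set S) (U i)"
    and cover: "z \<in> S \<Longrightarrow> \<exists>i\<in>I. z \<in> U i"
    and norm_c: "\<lbrakk>i \<in> I; j \<in> I; z \<in> U i; z \<in> U j\<rbrakk> \<Longrightarrow> norm (c i j z) = 1"
    and cocycle: "\<lbrakk>i \<in> I; j \<in> I; k \<in> I; z \<in> U i; z \<in> U j; z \<in> U k\<rbrakk> \<Longrightarrow> c i j z * c j k z = c i k z"
    and locally_constant: "\<lbrakk>i \<in> I; j \<in> I; z \<in> U i; z \<in> U j\<rbrakk> \<Longrightarrow>
      \<exists>N. openin (top_of_set S) N \<and> z \<in> N \<and> N \<subseteq> U i \<inter> U j \<and> (\<forall>w\<in>N. c i j w = c i j z)"
begin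

text \<open>Trivialisations of the pullback of the cocycle along a map \<open>h\<close> from \<open>Q\<close> to \<open>S\<close>.\<close>

definition section_on :: "'q::topological_space set \<Rightarrow> ('q \<Rightarrow> 'a) \<Rightarrow> ('i \<Rightarrow> 'q \<Rightarrow> complex) \<Rightarrow> bool" where
  "section_on Q h s \<longleftrightarrow> continuous_on Q h \<and> h ` Q \<subseteq> S \<and>
     (\<forall>i\<in>I. \<forall>q\<in>Q. h q \<in> U i \<longrightarrow> norm (s i q) = 1 \<and>
        (\<exists>N. open N \<and> q \<in> N \<and> (\<forall>q'\<in>N \<inter> Q. h q' \<in> U i \<and> s i q' = s i q))) \<and>
     (\<forall>i\<in>I. \<forall>j\<in>I. \<forall>q\<in>Q. h q \<in> U i \<longrightarrow> h q \<in> U j \<longrightarrow> s i q = c i j (h q) * s j q)"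

lemma U_subset:
  assumes "i \<in> I"
  shows "U i \<subseteq> S"
  using openin_imp_subset[OF openin_U[OF assms]] .

lemma pullback_openin:
  assumes "continuous_on Q h" "h ` Q \<subseteq> S" "openin (top_of_set S) N" "q \<in> Q" "h q \<in> N"
  shows "\<exists>M. open M \<and> q \<in> M \<and> (\<forall>q'\<in>M \<inter> Q. h q' \<in> N)"
proof -
  have "openin (top_of_set Q) (Q \<inter> h -` N)"
    using assms by (intro continuous_openin_preimage[of Q h S]) auto
  then obtain M where "open M" "Q \<inter> h -` N = Q \<inter> M"
    unfolding openin_open by blast
  then show ?thesis
    using assms(4,5) by (intro exI[of _ M]) auto
qed

lemma section_onD:
  assumes "section_on Q h s"
  shows "continuous_on Q h" "h ` Q \<subseteq> S"
    and "\<And>i q. \<lbrakk>i \<in> I; q \<in> Q; h q \<in> U i\<rbrakk> \<Longrightarrow> norm (s i q) = 1"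
    and "\<And>i q. \<lbrakk>i \<in> I; q \<in> Q; h q \<in> U i\<rbrakk> \<Longrightarrow>
      \<exists>N. open N \<and> q \<in> N \<and> (\<forall>q'\<in>N \<inter> Q. h q' \<in> U i \<and> s i q' = s i q)"
    and "\<And>i j q. \<lbrakk>i \<in> I; j \<in> I; q \<in> Q; h q \<in> U i; h q \<in> U j\<rbrakk> \<Longrightarrow> s i q = c i j (h q) * s j q"
proof -
  note D = assms[unfolded section_on_def]
  from D show "continuous_on Q h" "h ` Q \<subseteq> S"
    by (rule conjunct1, rule conjunct1[OF conjunct2])
  fix i j q assume i: "i \<in> I" "q \<in> Q" "h q \<in> U i"
  from D have "\<forall>i\<in>I. \<forall>q\<in>Q. h q \<in> U i \<longrightarrow> norm (s i q) = 1 \<and>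
      (\<exists>N. open N \<and> q \<in> N \<and> (\<forall>q'\<in>N \<inter> Q. h q' \<in> U i \<and> s i q' = s i q))"
    by (elim conjE)
  from this[rule_format, OF i] show "norm (s i q) = 1"
    "\<exists>N. open N \<and> q \<in> N \<and> (\<forall>q'\<in>N \<inter> Q. h q' \<in> U i \<and> s i q' = s i q)"
    by (rule conjunct1, rule conjunct2)
  from D have "\<forall>i\<in>I. \<forall>j\<in>I. \<forall>q\<in>Q. h q \<in> U i \<longrightarrow> h q \<in> U j \<longrightarrow> s i q = c i j (h q) * s j q"
    by (elim conjE)
  from this[rule_format, OF i(1) _ i(2) i(3)] show "s i q = c i j (h q) * s j q" if "j \<in> I" "h q \<in> U j"
    using that .
qed

lemma section_on_compose:
  assumes s: "section_on Q h s" and k: "continuous_on P k" "k ` P \<subseteq> Q"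
  shows "section_on P (h \<circ> k) (\<lambda>i p. s i (k p))"
  unfolding section_on_def o_def
proof (intro conjI ballI impI)
  have kQ: "k p \<in> Q" if "p \<in> P" for p
    using k(2) that by blast
  show "continuous_on P (\<lambda>p. h (k p))"
    using continuous_on_compose2[OF section_onD(1)[OF s] k] .
  show "(\<lambda>p. h (k p)) ` P \<subseteq> S"
    using kQ section_onD(2)[OF s] by blast
  fix i p assume *: "i \<in> I" "p \<in> P" "h (k p) \<in> U i"
  show "norm (s i (k p)) = 1"
    using section_onD(3)[OF s *(1) kQ[OF *(2)] *(3)] .
  obtain N where N: "open N" "k p \<in> N" "\<forall>q\<in>N \<inter> Q. h q \<in> U i \<and> s i q = s i (k p)"
    using section_onD(4)[OF s *(1) kQ[OF *(2)] *(3)] by blast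
  have "openin (top_of_set P) (P \<inter> k -` N)"
    using k(1) N(1) by (rule continuous_openin_preimage_gen)
  then obtain M where M: "open M" "P \<inter> k -` N = P \<inter> M"
    unfolding openin_open by blast
  have "p \<in> M"
    using M(2) N(2) *(2) by blast
  moreover have "h (k q') \<in> U i \<and> s i (k q') = s i (k p)" if "q' \<in> M \<inter> P" for q'
  proof -
    have "k q' \<in> N \<inter> Q"
      using M(2) kQ that by blast
    then show ?thesis
      using N(3) by blast
  qed
  ultimately show "\<exists>N. open N \<and> p \<in> N \<and> (\<forall>q'\<in>N \<inter> P. h (k q') \<in> U i \<and> s i (k q') = s i (k p))"
    using M(1) by blast
next
  fix i j p assume *: "i \<in> I" "j \<in> I" "p \<in> P" "h (k p) \<in> U i" "h (k p) \<in> U j"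
  have "k p \<in> Q"
    using k(2) *(3) by blast
  then show "s i (k p) = c i j (h (k p)) * s j (k p)"
    using section_onD(5)[OF s *(1,2) _ *(4,5)] by blast
qed

lemma section_on_cong:
  assumes s: "section_on Q h s" and eq: "\<And>q. q \<in> Q \<Longrightarrow> h q = h' q"
  shows "section_on Q h' s"
  unfolding section_on_def
proof (intro conjI ballI impI)
  show "continuous_on Q h'"
    using section_onD(1)[OF s] eq continuous_on_cong by metis
  show "h' ` Q \<subseteq> S"
    using section_onD(2)[OF s] eq by auto
next
  fix i q assume *: "i \<in> I" "q \<in> Q" "h' q \<in> U i"
  then show "norm (s i q) = 1"
    using section_onD(3)[OF s] eq by simp
  obtain N where "open N" "q \<in> N" "\<forall>q'\<in>N \<inter> Q. h q' \<in> U i \<and> s i q' = s i q"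
    using section_onD(4)[OF s] eq * by metis
  then show "\<exists>N. open N \<and> q \<in> N \<and> (\<forall>q'\<in>N \<inter> Q. h' q' \<in> U i \<and> s i q' = s i q)"
    using eq by (intro exI[of _ N]) auto
next
  fix i j q assume "i \<in> I" "j \<in> I" "q \<in> Q" "h' q \<in> U i" "h' q \<in> U j"
  then show "s i q = c i j (h' q) * s j q"
    using section_onD(5)[OF s] eq by metis
qed

lemma section_on_scale:
  assumes s: "section_on Q h s" and "norm a = 1"
  shows "section_on Q h (\<lambda>i q. a * s i q)"
  unfolding section_on_def
proof (intro conjI ballI impI)
  fix i q assume *: "i \<in> I" "q \<in> Q" "h q \<in> U i"
  then show "norm (a * s i q) = 1"
    using section_onD(3)[OF s] assms(2) by (simp add: norm_mult)
  show "\<exists>N. open N \<and> q \<in> N \<and> (\<forall>q'\<in>N \<inter> Q. h q' \<in> U i \<and> a * s i q' = a * s i q)"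
    using section_onD(4)[OF s *] by metis
next
  fix i j q assume "i \<in> I" "j \<in> I" "q \<in> Q" "h q \<in> U i" "h q \<in> U j"
  then show "a * s i q = c i j (h q) * (a * s j q)"
    using section_onD(5)[OF s] by (metis mult.left_commute)
qed (rule section_onD(1,2)[OF s])+

text \<open>In the quotient of two sections the transition factors cancel, so it is independent of
  the index; being locally constant, it is constant on a connected set.\<close>

lemma section_on_unique:
  assumes s: "section_on Q h s" and t: "section_on Q h t" and "connected Q"
  obtains a where "norm a = 1" "\<And>i q. \<lbrakk>i \<in> I; q \<in> Q; h q \<in> U i\<rbrakk> \<Longrightarrow> t i q = a * s i q"
proof (cases "Q = {}")
  case True
  show thesis
    by (rule that[of 1]) (simp_all add: True)
next
  case False
  define ind where "ind q = (SOME i. i \<in> I \<and> h q \<in> U i)" for q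
  have ind: "ind q \<in> I" "h q \<in> U (ind q)" if "q \<in> Q" for q
  proof -
    have "\<exists>i. i \<in> I \<and> h q \<in> U i"
      using section_onD(2)[OF s] that cover by blast
    then show "ind q \<in> I" "h q \<in> U (ind q)"
      using someI_ex[of "\<lambda>i. i \<in> I \<and> h q \<in> U i"] by (auto simp: ind_def)
  qed
  have nz: "s i q \<noteq> 0" "norm (s i q) = 1" "norm (t i q) = 1" if "i \<in> I" "q \<in> Q" "h q \<in> U i" for i q
  proof -
    show "norm (s i q) = 1" "norm (t i q) = 1"
      using section_onD(3)[OF s that] section_onD(3)[OF t that] .
    then show "s i q \<noteq> 0" by auto
  qed
  define r where "r q = t (ind q) q / s (ind q) q" for q
  have r: "r q = t i q / s i q" if "i \<in> I" "q \<in> Q" "h q \<in> U i" for i q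
  proof -
    have "t i q = c i (ind q) (h q) * t (ind q) q" "s i q = c i (ind q) (h q) * s (ind q) q"
      using section_onD(5)[OF s] section_onD(5)[OF t] that ind[OF that(2)] by blast+
    moreover have "c i (ind q) (h q) \<noteq> 0"
      using norm_c[OF that(1) ind(1)[OF that(2)] that(3) ind(2)[OF that(2)]] by auto
    ultimately show ?thesis
      by (simp add: r_def)
  qed
  have const: "r x = r y" if "x \<in> Q" "y \<in> Q" for x y
  proof (rule locally_constant_on_connected[OF \<open>connected Q\<close> _ that])
    fix q assume q: "q \<in> Q"
    note i = ind[OF q]
    obtain N1 where N1: "open N1" "q \<in> N1" "\<forall>q'\<in>N1 \<inter> Q. h q' \<in> U (ind q) \<and> s (ind q) q' = s (ind q) q"
      using section_onD(4)[OF s i(1) q i(2)] by blast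
    obtain N2 where N2: "open N2" "q \<in> N2" "\<forall>q'\<in>N2 \<inter> Q. h q' \<in> U (ind q) \<and> t (ind q) q' = t (ind q) q"
      using section_onD(4)[OF t i(1) q i(2)] by blast
    show "\<exists>N. open N \<and> q \<in> N \<and> (\<forall>q'\<in>N \<inter> Q. r q' = r q)"
    proof (intro exI[of _ "N1 \<inter> N2"] conjI ballI)
      fix q' assume q': "q' \<in> N1 \<inter> N2 \<inter> Q"
      then have "r q' = t (ind q) q' / s (ind q) q'"
        using N1(3) i(1) by (intro r) auto
      then show "r q' = r q"
        using N1(3) N2(3) q' by (simp add: r_def)
    qed (use N1 N2 in auto)
  qed
  obtain q0 where q0: "q0 \<in> Q"
    using False by blast
  show thesis
  proof (rule that[of "r q0"])
    show "norm (r q0) = 1"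
      using nz[of "ind q0" q0] ind[OF q0] q0 by (simp add: r_def norm_divide)
    show "t i q = r q0 * s i q" if "i \<in> I" "q \<in> Q" "h q \<in> U i" for i q
      using r[OF that] nz[OF that] const[OF q0 that(2)] by (simp add: field_simps)
  qed
qed

text \<open>On the connected intersection the two sections differ by a single unimodular factor;
  absorbing it into one of them makes them agree there.\<close>

lemma section_on_Un:
  assumes s: "section_on A h s" and t: "section_on B h t"
    and "closed A" "closed B" "connected (A \<inter> B)"
  shows "\<exists>s. section_on (A \<union> B) h s"
proof -
  have "section_on (A \<inter> B) h s" "section_on (A \<inter> B) h t"
    using section_on_compose[OF s, of "A \<inter> B" id] section_on_compose[OF t, of "A \<inter> B" id] by simp_all
  then obtain a where a: "norm a = 1"
    "\<And>i q. \<lbrakk>i \<in> I; q \<in> A \<inter> B; h q \<in> U i\<rbrakk> \<Longrightarrow> t i q = a * s i q"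
    using section_on_unique[OF _ _ assms(5)] by metis
  define s' where "s' = (\<lambda>i q. a * s i q)"
  have s': "section_on A h s'"
    unfolding s'_def using s a(1) by (rule section_on_scale)
  define v where "v i q = (if q \<in> A then s' i q else t i q)" for i q
  have vB: "v i q = t i q" if "i \<in> I" "q \<in> B" "h q \<in> U i" for i q
    using a(2) that by (simp add: v_def s'_def)
  have vA: "v i q = s' i q" if "q \<in> A" for i q
    using that by (simp add: v_def)
  have "section_on (A \<union> B) h v"
    unfolding section_on_def
  proof (intro conjI ballI impI)
    show "continuous_on (A \<union> B) h"
      using section_onD(1)[OF s] section_onD(1)[OF t] assms(3,4) by (intro continuous_on_closed_Un)
    show "h ` (A \<union> B) \<subseteq> S"
      using section_onD(2)[OF s] section_onD(2)[OF t] by blast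
  next
    fix i q assume *: "i \<in> I" "q \<in> A \<union> B" "h q \<in> U i"
    show "norm (v i q) = 1"
      using * section_onD(3)[OF s'] section_onD(3)[OF t] by (auto simp: v_def)
    \<comment> \<open>A neighbourhood is found for each closed piece separately and the two are
      intersected. For a piece that does not contain \<open>q\<close>, its complement is such a
      neighbourhood.\<close>
    have "\<exists>N. open N \<and> q \<in> N \<and> (\<forall>q'\<in>N \<inter> A. h q' \<in> U i \<and> v i q' = v i q)"
    proof (cases "q \<in> A")
      case True
      then obtain N where N: "open N" "q \<in> N" "\<forall>q'\<in>N \<inter> A. h q' \<in> U i \<and> s' i q' = s' i q"
        using section_onD(4)[OF s' *(1) _ *(3)] by blast
      have "h q' \<in> U i \<and> v i q' = v i q" if "q' \<in> N \<inter> A" for q'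
        using bspec[OF N(3) that] True vA that by auto
      then show ?thesis
        using N(1,2) by blast
    next
      case False
      then show ?thesis
        using \<open>closed A\<close> by (intro exI[of _ "- A"]) auto
    qed
    moreover have "\<exists>N. open N \<and> q \<in> N \<and> (\<forall>q'\<in>N \<inter> B. h q' \<in> U i \<and> v i q' = v i q)"
    proof (cases "q \<in> B")
      case True
      then obtain N where N: "open N" "q \<in> N" "\<forall>q'\<in>N \<inter> B. h q' \<in> U i \<and> t i q' = t i q"
        using section_onD(4)[OF t *(1) _ *(3)] by blast
      have "h q' \<in> U i \<and> v i q' = v i q" if "q' \<in> N \<inter> B" for q'
        using bspec[OF N(3) that] True vB[OF *(1)] that *(3) by auto
      then show ?thesis
        using N(1,2) by blast
    next
      case False
      then show ?thesis
        using \<open>closed B\<close> by (intro exI[of _ "- B"]) auto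
    qed
    ultimately obtain N1 N2 where "open N1" "q \<in> N1" "\<forall>q'\<in>N1 \<inter> A. h q' \<in> U i \<and> v i q' = v i q"
      "open N2" "q \<in> N2" "\<forall>q'\<in>N2 \<inter> B. h q' \<in> U i \<and> v i q' = v i q"
      by blast
    then show "\<exists>N. open N \<and> q \<in> N \<and> (\<forall>q'\<in>N \<inter> (A \<union> B). h q' \<in> U i \<and> v i q' = v i q)"
      by (intro exI[of _ "N1 \<inter> N2"]) (blast intro: open_Int)
  next
    fix i j q assume *: "i \<in> I" "j \<in> I" "q \<in> A \<union> B" "h q \<in> U i" "h q \<in> U j"
    show "v i q = c i j (h q) * v j q"
    proof (cases "q \<in> A")
      case True
      then show ?thesis
        using section_onD(5)[OF s' *(1,2) True *(4,5)] by (simp only: vA[OF True])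
    next
      case False
      then have "q \<in> B"
        using *(3) by blast
      then show ?thesis
        using section_onD(5)[OF t *(1,2) _ *(4,5)] False by (simp only: v_def if_False)
    qed
  qed
  then show ?thesis by blast
qed

text \<open>Within one member \<open>U k\<close> of the cover, the cocycle with second index
  \<open>k\<close> is itself a trivialisation.\<close>

lemma section_on_local:
  assumes "continuous_on Q h" "h ` Q \<subseteq> U k" "k \<in> I"
  shows "section_on Q h (\<lambda>i q. c i k (h q))"
  unfolding section_on_def
proof (intro conjI ballI impI)
  show hS: "h ` Q \<subseteq> S"
    using assms(2) U_subset[OF assms(3)] by (rule order_trans)
  show "continuous_on Q h"
    by (rule assms(1))
  fix i q assume *: "i \<in> I" "q \<in> Q" "h q \<in> U i"
  have k: "h q \<in> U k"
    using assms(2) *(2) by blast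
  show "norm (c i k (h q)) = 1"
    by (rule norm_c[OF *(1) assms(3) *(3) k])
  obtain N where N: "openin (top_of_set S) N" "h q \<in> N" "N \<subseteq> U i \<inter> U k" "\<forall>w\<in>N. c i k w = c i k (h q)"
    using locally_constant[OF *(1) assms(3) *(3) k] by blast
  obtain M where "open M" "q \<in> M" "\<forall>q'\<in>M \<inter> Q. h q' \<in> N"
    using pullback_openin[OF assms(1) hS N(1) *(2) N(2)] by blast
  then show "\<exists>N. open N \<and> q \<in> N \<and> (\<forall>q'\<in>N \<inter> Q. h q' \<in> U i \<and> c i k (h q') = c i k (h q))"
    using N(3,4) by blast
next
  fix i j q assume *: "i \<in> I" "j \<in> I" "q \<in> Q" "h q \<in> U i" "h q \<in> U j"
  have k: "h q \<in> U k"
    using assms(2) *(3) by blast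
  show "c i k (h q) = c i j (h q) * c j k (h q)"
    by (rule cocycle[OF *(1,2) assms(3) *(4,5) k, symmetric])
qed

text \<open>Small rectangles map into one \<open>U k\<close>, and adjacent rectangles meet in a
  segment, which is connected, so their sections glue. Bisection by \<open>Bolzano\<close> plays the
  part of a Lebesgue number: first it builds a thin vertical strip, then it joins the
  strips.\<close>

lemma section_on_square:
  fixes h :: "real \<times> real \<Rightarrow> 'a"
  assumes cont: "continuous_on ({0..1} \<times> {0..1}) h" and sub: "h ` ({0..1} \<times> {0..1}) \<subseteq> S"
  shows "\<exists>s. section_on ({0..1} \<times> {0..1}) h s"
proof -
  \<comment> \<open>\<open>Bolzano\<close> quantifies over all short intervals around a point,
    including those that leave the unit interval; the intersection with the square makes
    \<open>R\<close> meaningful for them.\<close>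
  define R where "R a b a' b' \<longleftrightarrow> (\<exists>s. section_on (({a..b} \<times> {a'..b'}) \<inter> ({0..1} \<times> {0..1})) h s)"
    for a b a' b' :: real
  let ?Q = "{0..1::real} \<times> {0..1::real}"
  have glue: "R a b a' b'" if "R a b1 a' b2" "R a2 b a3 b'"
    "({a..b} \<times> {a'..b'}) = ({a..b1} \<times> {a'..b2}) \<union> ({a2..b} \<times> {a3..b'})" for a b a' b' b1 b2 a2 a3
  proof -
    obtain s t where st: "section_on (({a..b1} \<times> {a'..b2}) \<inter> ?Q) h s" "section_on (({a2..b} \<times> {a3..b'}) \<inter> ?Q) h t"
      using \<open>R a b1 a' b2\<close> \<open>R a2 b a3 b'\<close> unfolding R_def by blast
    have "\<exists>s. section_on ((({a..b1} \<times> {a'..b2}) \<inter> ?Q) \<union> (({a2..b} \<times> {a3..b'}) \<inter> ?Q)) h s"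
      by (rule section_on_Un[OF st])
        (auto intro!: closed_Int closed_Times convex_connected convex_Int convex_Times)
    then show ?thesis
      unfolding R_def that(3) Int_Un_distrib2 .
  qed
  have local: "\<exists>d>0. \<forall>a b a' b'. a \<le> x \<and> x \<le> b \<and> a' \<le> y \<and> y \<le> b' \<and> b - a < d \<and> b' - a' < d \<longrightarrow> R a b a' b'"
    if xy: "x \<in> {0..1}" "y \<in> {0..1}" for x y
  proof -
    have "h (x, y) \<in> S"
      using sub xy by auto
    then obtain k where k: "k \<in> I" "h (x, y) \<in> U k"
      using cover by blast
    then obtain M where M: "open M" "(x, y) \<in> M" "\<forall>q\<in>M \<inter> ?Q. h q \<in> U k"
      using pullback_openin[OF cont sub openin_U[OF k(1)], of "(x, y)"] xy by auto
    then obtain e where e: "e > 0" "ball (x, y) e \<subseteq> M"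
      by (meson open_contains_ball)
    have "R a b a' b'" if ab: "a \<le> x" "x \<le> b" "a' \<le> y" "y \<le> b'" "b - a < e / 2" "b' - a' < e / 2" for a b a' b'
    proof -
      have "dist (x, y) (u, v) < e" if "u \<in> {a..b}" "v \<in> {a'..b'}" for u v
      proof -
        have "dist (x, y) (u, v) \<le> dist x u + dist y v"
          by (simp add: dist_Pair_Pair sqrt_sum_squares_le_sum)
        also have "\<dots> < e"
          using that ab by (auto simp: dist_real_def)
        finally show ?thesis .
      qed
      then have "{a..b} \<times> {a'..b'} \<subseteq> ball (x, y) e"
        by auto
      then have "h ` (({a..b} \<times> {a'..b'}) \<inter> ?Q) \<subseteq> U k"
        using e M by blast
      then show ?thesis
        unfolding R_def using section_on_local[OF continuous_on_subset[OF cont] _ k(1)] by blast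
    qed
    then show ?thesis
      using e(1) by (intro exI[of _ "e/2"]) auto
  qed
  have strip: "\<exists>d>0. \<forall>a b. a \<le> x \<and> x \<le> b \<and> b - a < d \<longrightarrow> R a b 0 1" if x: "x \<in> {0..1}" for x
  proof -
    \<comment> \<open>The admissible strip width is hidden inside \<open>P\<close>: stacking two
      rectangles replaces it by a minimum, which only finitely many steps of a bisection could
      tolerate explicitly.\<close>
    define P where "P a' b' \<longleftrightarrow> (\<exists>d>0. \<forall>a b. a \<le> x \<and> x \<le> b \<and> b - a < d \<longrightarrow> R a b a' b')" for a' b' :: real
    have "P 0 1"
    proof (rule Bolzano[of 0 1])
      fix a b c :: real assume "P a b" "P b c" "a \<le> b" "b \<le> c"
      then obtain d1 d2 where d: "d1 > 0" "d2 > 0"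
        "\<And>u v. u \<le> x \<and> x \<le> v \<and> v - u < d1 \<longrightarrow> R u v a b"
        "\<And>u v. u \<le> x \<and> x \<le> v \<and> v - u < d2 \<longrightarrow> R u v b c"
        unfolding P_def by metis
      have "R u v a c" if "u \<le> x" "x \<le> v" "v - u < min d1 d2" for u v
        by (rule glue[of u v a b u v b c]) (use that d \<open>a \<le> b\<close> \<open>b \<le> c\<close> in auto)
      then show "P a c"
            unfolding P_def using d(1,2) by (intro exI[of _ "min d1 d2"]) auto
    next
      fix y :: real assume "0 \<le> y" "y \<le> 1"
      then obtain d where d: "d > 0"
        "\<And>a b a' b'. a \<le> x \<and> x \<le> b \<and> a' \<le> y \<and> y \<le> b' \<and> b - a < d \<and> b' - a' < d \<longrightarrow> R a b a' b'"
        using local[of x y] x by auto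
      then show "\<exists>d>0. \<forall>a b. a \<le> y \<and> y \<le> b \<and> b - a < d \<longrightarrow> P a b"
        unfolding P_def by meson
    qed simp
    then show ?thesis
      unfolding P_def .
  qed
  have "R 0 1 0 1"
  proof (rule Bolzano[of 0 1 "\<lambda>a b. R a b 0 1"])
    fix a b c :: real assume "R a b 0 1" "R b c 0 1" "a \<le> b" "b \<le> c"
    then show "R a c 0 1"
      by (intro glue[of a b 0 1 b c 0 1]) auto
  next
    fix x :: real assume "0 \<le> x" "x \<le> 1"
    then show "\<exists>d>0. \<forall>a b. a \<le> x \<and> x \<le> b \<and> b - a < d \<longrightarrow> R a b 0 1"
      using strip[of x] by auto
  qed simp
  then show ?thesis
    by (simp add: R_def)
qed

text \<open>A path is a map on the square that ignores its second variable; restricting a section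
  over the square to an edge gives one over the path.\<close>

lemma section_on_path:
  assumes "path g" "path_image g \<subseteq> S"
  shows "\<exists>s. section_on {0..1} g s"
proof -
  have img: "(fst :: real \<times> real \<Rightarrow> real) ` ({0..1} \<times> {0..1}) \<subseteq> {0..1}"
    by force
  have "continuous_on ({0..1} \<times> {0..1}) (fst :: real \<times> real \<Rightarrow> real)"
    by (rule continuous_on_fst[OF continuous_on_id])
  then have "continuous_on ({0..1} \<times> {0..1}) (\<lambda>x::real\<times>real. g (fst x))"
    using continuous_on_compose2[OF assms(1)[unfolded path_def] _ img] by simp
  moreover have "(\<lambda>x::real\<times>real. g (fst x)) ` ({0..1} \<times> {0..1}) \<subseteq> S"
    using assms(2) by (auto simp: path_image_def)
  ultimately have "\<exists>s. section_on ({0..1} \<times> {0..1}) (\<lambda>x::real\<times>real. g (fst x)) s"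
    by (rule section_on_square)
  then obtain s where s: "section_on ({0..1} \<times> {0..1}) (\<lambda>x::real\<times>real. g (fst x)) s" ..
  have "section_on {0..1} ((\<lambda>x::real\<times>real. g (fst x)) \<circ> (\<lambda>t. (t, 0))) (\<lambda>i t. s i (t, 0))"
    by (rule section_on_compose[OF s]) (auto intro!: continuous_intros)
  then show ?thesis
    by (auto simp: o_def)
qed

text \<open>The monodromy argument. A section over the whole homotopy restricts to multiples of
  \<open>s\<close> and \<open>s'\<close> on the edges that carry the two paths. On the other two
  edges the homotopy stands still, so the section is constant there; the edge of common starting
  points identifies the two multiples, and the other one compares the end values.\<close>

lemma section_on_homotopic_paths:
  assumes hom: "homotopic_paths S g g'"
    and s: "section_on {0..1} g s" and s': "section_on {0..1} g' s'"
    and i: "i \<in> I" "pathstart g \<in> U i" and j: "j \<in> I" "pathfinish g \<in> U j"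
    and eq: "s i 0 = s' i 0"
  shows "s j 1 = s' j 1"
proof -
  from hom[unfolded homotopic_paths] obtain h :: "real \<times> real \<Rightarrow> 'a" where
    h': "continuous_on ({0..1} \<times> {0..1}) h \<and> h \<in> ({0..1} \<times> {0..1}) \<rightarrow> S \<and>
      (\<forall>x\<in>{0..1}. h (0, x) = g x) \<and> (\<forall>x\<in>{0..1}. h (1, x) = g' x) \<and>
      (\<forall>t\<in>{0..1}. pathstart (h \<circ> Pair t) = pathstart g \<and> pathfinish (h \<circ> Pair t) = pathfinish g)" ..
  have h: "continuous_on ({0..1} \<times> {0..1}) h" "h ` ({0..1} \<times> {0..1}) \<subseteq> S"
    using conjunct1[OF h'] conjunct1[OF conjunct2[OF h']] by (simp_all only: image_subset_iff_funcset)
  note h'' = conjunct2[OF conjunct2[OF h']]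
  have h0: "h (0, x) = g x" and h1: "h (1, x) = g' x" if "x \<in> {0..1}" for x
    using bspec[OF conjunct1[OF h''] that] bspec[OF conjunct1[OF conjunct2[OF h'']] that] .
  have l: "h (t, 0) = g 0" and r: "h (t, 1) = g 1" if "t \<in> {0..1}" for t
    using bspec[OF conjunct2[OF conjunct2[OF h'']] that] by (simp_all add: pathstart_def pathfinish_def)
  obtain v where v: "section_on ({0..1} \<times> {0..1}) h v"
    using section_on_square[OF h(1,2)] by blast
  have edge: "section_on {0..1} (h \<circ> k) (\<lambda>i t. v i (k t))"
    if "continuous_on {0..1} k" "k ` {0..1} \<subseteq> {0..1} \<times> {0..1}" for k :: "real \<Rightarrow> real \<times> real"
    by (rule section_on_compose[OF v that])
  have const: "v l (0, y) = v l (1, y)" if "l \<in> I" "y \<in> {0, 1}" "g y \<in> U l" for l y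
  proof -
    have sec: "section_on {0..1} (h \<circ> (\<lambda>t. (t, y))) (\<lambda>i t. v i (t, y))"
      using that by (intro edge) (auto intro!: continuous_intros)
    have eqy: "h (t, y) = g y" if "t \<in> {0..1}" for t
      using that l r \<open>y \<in> {0, 1}\<close> by auto
    show ?thesis
    proof (rule locally_constant_on_connected[of "{0..1::real}" "\<lambda>t. v l (t, y)" 0 1])
      fix q :: real assume "q \<in> {0..1}"
      then show "\<exists>N. open N \<and> q \<in> N \<and> (\<forall>q'\<in>N \<inter> {0..1}. v l (q', y) = v l (q, y))"
        using section_onD(4)[OF sec that(1)] that(3) eqy by (metis comp_apply)
    qed auto
  qed
  have "section_on {0..1} g (\<lambda>i t. v i (0, t))"
    by (rule section_on_cong[OF edge[of "\<lambda>t. (0, t)"]]) (auto intro!: continuous_intros simp: h0 h1)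
  then obtain a where a: "\<And>l q. \<lbrakk>l \<in> I; q \<in> {0..1}; g q \<in> U l\<rbrakk> \<Longrightarrow> v l (0, q) = a * s l q"
    using section_on_unique[OF s] connected_Icc by metis
  have "section_on {0..1} g' (\<lambda>i t. v i (1, t))"
    by (rule section_on_cong[OF edge[of "\<lambda>t. (1, t)"]]) (auto intro!: continuous_intros simp: h0 h1)
  then obtain b where b: "norm b = 1" "\<And>l q. \<lbrakk>l \<in> I; q \<in> {0..1}; g' q \<in> U l\<rbrakk> \<Longrightarrow> v l (1, q) = b * s' l q"
    using section_on_unique[OF s'] connected_Icc by metis
  have ends: "g' 0 = g 0" "g' 1 = g 1"
    using h1[of 0] h1[of 1] l[of 1] r[of 1] by auto
  have "norm (s i 0) = 1"
    using section_onD(3)[OF s i(1)] i(2) by (simp add: pathstart_def)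
  moreover have "a * s i 0 = b * s' i 0"
    using a[of i 0] b(2)[of i 0] const[of i 0] i ends by (simp add: pathstart_def)
  ultimately have "a = b"
    using eq by force
  moreover have "a * s j 1 = b * s' j 1"
    using a[of j 1] b(2)[of j 1] const[of j 1] j ends by (simp add: pathfinish_def)
  ultimately show ?thesis
    using b(1) by force
qed

text \<open>\<open>d i z\<close> is the value obtained by transport from a base point to
  \<open>z\<close>, which does not depend on the path because \<open>S\<close> is simply connected.
  Local path connectedness gives local constancy: a nearby point is reached by prolonging a path to
  \<open>z\<close> within \<open>U i\<close>.\<close>

theorem coboundary:
  assumes sc: "simply_connected S"
    and lpc: "\<And>z N. z \<in> S \<Longrightarrow> openin (top_of_set S) N \<Longrightarrow> z \<in> N \<Longrightarrow>
      \<exists>V. openin (top_of_set S) V \<and> z \<in> V \<and> V \<subseteq> N \<and> path_connected V"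
  obtains d where "\<And>i z. \<lbrakk>i \<in> I; z \<in> U i\<rbrakk> \<Longrightarrow> norm (d i z) = 1"
    "\<And>i j z. \<lbrakk>i \<in> I; j \<in> I; z \<in> U i; z \<in> U j\<rbrakk> \<Longrightarrow> d i z = c i j z * d j z"
    "\<And>i z. \<lbrakk>i \<in> I; z \<in> U i\<rbrakk> \<Longrightarrow>
      \<exists>N. openin (top_of_set S) N \<and> z \<in> N \<and> N \<subseteq> U i \<and> (\<forall>w\<in>N. d i w = d i z)"
proof (cases "S = {}")
  case True
  then have "U i = {}" if "i \<in> I" for i
    using U_subset[OF that] by blast
  then show thesis
    using that[of "\<lambda>_ _. 1"] by simp
next
  case False
  then obtain z0 i0 where z0: "z0 \<in> S" "i0 \<in> I" "z0 \<in> U i0"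
    using cover by blast
  have pc: "path_connected S"
    using sc simply_connected_imp_path_connected by blast
  have "\<exists>g. path g \<and> path_image g \<subseteq> S \<and> pathstart g = z0 \<and> pathfinish g = z" if "z \<in> S" for z
    using pc z0 that unfolding path_connected_def by blast
  then obtain g where g: "\<And>z. z \<in> S \<Longrightarrow> path (g z) \<and> path_image (g z) \<subseteq> S \<and> pathstart (g z) = z0 \<and> pathfinish (g z) = z"
    by metis
  have norml: "\<exists>s. section_on {0..1} p s \<and> s i0 0 = 1" if p: "path p" "path_image p \<subseteq> S" "pathstart p = z0" for p
  proof -
    obtain s where s: "section_on {0..1} p s"
      using section_on_path[OF p(1,2)] by blast
    then have "norm (s i0 0) = 1"
      using section_onD(3)[OF s z0(2)] z0(3) p(3) by (simp add: pathstart_def)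
    then have "s i0 0 \<noteq> 0" "norm (inverse (s i0 0)) = 1"
      by (auto simp: norm_inverse)
    then have "section_on {0..1} p (\<lambda>i q. inverse (s i0 0) * s i q)" "inverse (s i0 0) * s i0 0 = 1"
      using section_on_scale[OF s] by simp_all
    then show ?thesis
      by (intro exI[of _ "\<lambda>i q. inverse (s i0 0) * s i q"]) simp
  qed
  then have "\<exists>s. section_on {0..1} (g z) s \<and> s i0 0 = 1" if "z \<in> S" for z
    using g that by blast
  then obtain \<sigma> where \<sigma>: "\<And>z. z \<in> S \<Longrightarrow> section_on {0..1} (g z) (\<sigma> z) \<and> \<sigma> z i0 0 = 1"
    by metis
  define d where "d i z = \<sigma> z i 1" for i z
  have gz: "g z 0 = z0" "g z 1 = z" if "z \<in> S" for z
    using g[OF that] by (auto simp: pathstart_def pathfinish_def)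
  have d_path: "s i 1 = d i z"
    if "path p" "path_image p \<subseteq> S" "pathstart p = z0" "pathfinish p = z" "section_on {0..1} p s" "s i0 0 = 1"
      "i \<in> I" "z \<in> U i" for p s i z
  proof -
    have zS: "z \<in> S"
      using that U_subset by blast
    have "homotopic_paths S p (g z)"
      using sc g[OF zS] that(1-4) unfolding simply_connected_eq_homotopic_paths by metis
    then show ?thesis
      unfolding d_def
      by (rule section_on_homotopic_paths[of _ _ _ _ i0]) (use that z0 \<sigma>[OF zS] in auto)
  qed
  show thesis
  proof (rule that)
    fix i z assume i: "i \<in> I" "z \<in> U i"
    then have zS: "z \<in> S" using U_subset by blast
    then show "norm (d i z) = 1"
      using section_onD(3)[of "{0..1}" "g z" "\<sigma> z" i 1] \<sigma>[OF zS] gz[OF zS] i by (simp add: d_def)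
    obtain V where V: "openin (top_of_set S) V" "z \<in> V" "V \<subseteq> U i" "path_connected V"
      using lpc[OF zS openin_U[OF i(1)] i(2)] by blast
    have "d i w = d i z" if w: "w \<in> V" for w
    proof -
      have VS: "V \<subseteq> S"
        using V(3) U_subset[OF i(1)] by blast
      obtain k where k: "path k" "path_image k \<subseteq> V" "pathstart k = z" "pathfinish k = w"
        using V(4)[unfolded path_connected_def] V(2) w by blast
      define p where "p = g z +++ k"
      have p: "path p" "path_image p \<subseteq> S" "pathstart p = z0" "pathfinish p = w"
        using k g[OF zS] VS by (auto simp: p_def path_image_join)
      obtain s where s: "section_on {0..1} p s" "s i0 0 = 1"
        using norml p by blast
      \<comment> \<open>The first half of \<open>p\<close> is \<open>g z\<close>, so the value of
        \<open>s\<close> at \<open>1 / 2\<close> is \<open>d i z\<close>. On the second half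
        \<open>p\<close> remains in \<open>V\<close>, hence in \<open>U i\<close>, where a single
        index describes the section and its value cannot change.\<close>
      have "section_on {0..1} (p \<circ> (\<lambda>t. t / 2)) (\<lambda>i t. s i (t / 2))"
        by (rule section_on_compose[OF s(1)]) (auto intro!: continuous_intros)
      then have "section_on {0..1} (g z) (\<lambda>i t. s i (t / 2))"
        by (rule section_on_cong) (auto simp: p_def joinpaths_def)
      then have "s i (1 / 2) = d i z"
        using d_path[of "g z" z "\<lambda>i t. s i (t / 2)" i] g[OF zS] i s(2) by simp
      moreover have "s i (1 / 2) = s i 1"
      proof (rule locally_constant_on_connected[of "{1/2..1::real}" "s i"])
        fix q :: real assume q: "q \<in> {1/2..1}"
        have "p q \<in> V"
        proof (cases "q = 1 / 2")
          case True
          then show ?thesis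
            using gz[OF zS] V(2) unfolding True by (simp add: p_def joinpaths_def)
        next
          case False
          then have "p q = k (2 * q - 1)" "2 * q - 1 \<in> {0..1}"
            using q by (auto simp: p_def joinpaths_def)
          then show ?thesis
            using k(2) by (auto simp: path_image_def)
        qed
        then obtain N where "open N" "q \<in> N" "\<forall>q'\<in>N \<inter> {0..1}. s i q' = s i q"
          using section_onD(4)[OF s(1) i(1), of q] V(3) q by auto
        then show "\<exists>N. open N \<and> q \<in> N \<and> (\<forall>q'\<in>N \<inter> {1/2..1}. s i q' = s i q)"
          by (intro exI[of _ N]) fastforce
      qed auto
      moreover have "s i 1 = d i w"
        using d_path[OF p s] i(1) V(3) w by blast
      ultimately show ?thesis by simp
    qed
    then show "\<exists>N. openin (top_of_set S) N \<and> z \<in> N \<and> N \<subseteq> U i \<and> (\<forall>w\<in>N. d i w = d i z)"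
      using V by blast
  next
    fix i j z assume i: "i \<in> I" "j \<in> I" "z \<in> U i" "z \<in> U j"
    then have zS: "z \<in> S" using U_subset by blast
    then show "d i z = c i j z * d j z"
      unfolding d_def using section_onD(5)[of "{0..1}" "g z" "\<sigma> z" i j 1] \<sigma>[OF zS] gz[OF zS] i
      by (metis atLeastAtMost_iff order_refl zero_le_one)
  qed
qed

end

section \<open>Perron's method on Riemann surfaces\<close>

lemma continuous_on_openin_locally:
  fixes f :: "'a::t2_space \<Rightarrow> 'b::topological_space"
  assumes loc: "\<And>x. x \<in> S \<Longrightarrow> \<exists>N. openin (top_of_set S) N \<and> x \<in> N \<and> continuous_on N f"
  shows "continuous_on S f"
  unfolding continuous_on_eq_continuous_within
proof
  fix x assume "x \<in> S"
  then obtain N where N: "openin (top_of_set S) N" "x \<in> N" "continuous_on N f"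
    using loc by blast
  then obtain T where T: "open T" "N = S \<inter> T"
    unfolding openin_open by blast
  have "at x within N = at x within S"
    by (rule at_within_nhd[of x T]) (use T N(2) in auto)
  then show "continuous (at x within S) f"
    using N(2,3) unfolding continuous_on_eq_continuous_within by metis
qed

lemma holomorphic_on_locally:
  assumes loc: "\<And>x. x \<in> A \<Longrightarrow> \<exists>U. open U \<and> x \<in> U \<and> f holomorphic_on U"
  shows "f holomorphic_on A"
  unfolding holomorphic_on_def
proof
  fix x assume "x \<in> A"
  then obtain U where "open U" "x \<in> U" "f holomorphic_on U"
    using loc by blast
  then show "f field_differentiable at x within A"
    using holomorphic_on_imp_differentiable_at field_differentiable_at_within by blast
qed

text \<open>Inverse charts are defined on \<open>ball 0 2\<close>, which makes the image of \<open>cball 0 1\<close> a compact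
  coordinate disc.\<close>

locale riemann_surface =
  fixes S :: "'a::real_normed_vector set" and atlas :: "(complex \<Rightarrow> 'a) set"
  assumes connected_S: "connected S"
    and chart_homeomorphism:
      "\<phi> \<in> atlas \<Longrightarrow> homeomorphism (ball 0 2) (\<phi> ` ball 0 2) \<phi> (inv_into (ball 0 2) \<phi>)"
    and chart_openin: "\<phi> \<in> atlas \<Longrightarrow> openin (top_of_set S) (\<phi> ` ball 0 2)"
    and chart_transition: "\<lbrakk>\<phi> \<in> atlas; \<psi> \<in> atlas\<rbrakk> \<Longrightarrow>
      (inv_into (ball 0 2) \<phi> \<circ> \<psi>) holomorphic_on (ball 0 2 \<inter> \<psi> -` (\<phi> ` ball 0 2))"
    and chart_exists: "\<lbrakk>openin (top_of_set S) N; z \<in> N\<rbrakk> \<Longrightarrow>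
      \<exists>\<phi>\<in>atlas. \<phi> 0 = z \<and> \<phi> ` ball 0 2 \<subseteq> N"
begin

abbreviation coord :: "(complex \<Rightarrow> 'a) \<Rightarrow> 'a \<Rightarrow> complex" where
  "coord \<phi> \<equiv> inv_into (ball 0 2) \<phi>"

context
  fixes \<phi> assumes \<phi>: "\<phi> \<in> atlas"
begin

lemma coord_chart: "t \<in> ball 0 2 \<Longrightarrow> coord \<phi> (\<phi> t) = t"
  using homeomorphism_apply1[OF chart_homeomorphism[OF \<phi>]] .

lemma chart_coord: "z \<in> \<phi> ` ball 0 2 \<Longrightarrow> \<phi> (coord \<phi> z) = z"
  using homeomorphism_apply2[OF chart_homeomorphism[OF \<phi>]] .

lemma chart_continuous: "continuous_on (ball 0 2) \<phi>"
  using homeomorphism_cont1[OF chart_homeomorphism[OF \<phi>]] .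

lemma coord_continuous: "continuous_on (\<phi> ` ball 0 2) (coord \<phi>)"
  using homeomorphism_cont2[OF chart_homeomorphism[OF \<phi>]] .

lemma chart_subset: "\<phi> ` ball 0 2 \<subseteq> S"
  using openin_imp_subset[OF chart_openin[OF \<phi>]] .

lemma chart_in_S: "norm t < 2 \<Longrightarrow> \<phi> t \<in> S"
  using chart_subset by auto

lemma chart_eq_iff: "\<lbrakk>norm t < 2; norm s < 2\<rbrakk> \<Longrightarrow> \<phi> t = \<phi> s \<longleftrightarrow> t = s"
  using coord_chart by (metis mem_ball_0)

lemma chart_image_openin:
  assumes "open A" "A \<subseteq> ball 0 2"
  shows "openin (top_of_set S) (\<phi> ` A)"
proof -
  have "openin (top_of_set (ball 0 2)) A"
    using assms by (simp add: openin_open_eq)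
  then have "openin (top_of_set (\<phi> ` ball 0 2)) (\<phi> ` A)"
    using homeomorphism_imp_open_map[OF chart_homeomorphism[OF \<phi>]] by blast
  then show ?thesis
    using chart_openin[OF \<phi>] openin_trans by blast
qed

lemma chart_ball_openin:
  assumes "r \<le> 2"
  shows "openin (top_of_set S) (\<phi> ` ball 0 r)"
  using assms by (intro chart_image_openin subset_ball) auto

lemma chart_inj: "inj_on \<phi> (ball 0 2)"
  using coord_chart by (rule inj_on_inverseI)

lemma chart_preimage_open:
  assumes "openin (top_of_set S) N"
  shows "open (ball 0 2 \<inter> \<phi> -` N)"
proof -
  have "openin (top_of_set (ball 0 2)) (ball 0 2 \<inter> \<phi> -` N)"
    by (rule continuous_openin_preimage[OF chart_continuous _ assms])
      (use chart_subset in auto)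
  then show ?thesis
    using open_ball openin_open_eq by blast
qed

lemma chart_cball_compact: "compact (\<phi> ` cball 0 1)"
proof -
  have "continuous_on (cball 0 1) \<phi>"
    by (rule continuous_on_subset[OF chart_continuous]) auto
  then show ?thesis
    by (rule compact_continuous_image) simp
qed

end

section \<open>Holomorphic and log-subharmonic functions on the surface\<close>

definition hol :: "('a \<Rightarrow> complex) \<Rightarrow> bool" where
  "hol f \<longleftrightarrow> (\<forall>\<phi>\<in>atlas. (f \<circ> \<phi>) holomorphic_on ball 0 2)"

lemma holomorphic_change_chart:
  assumes \<phi>: "\<phi> \<in> atlas" and \<psi>: "\<psi> \<in> atlas" and A: "open A" "A \<subseteq> ball 0 2"
    and f: "(f \<circ> \<psi>) holomorphic_on A"
  shows "(f \<circ> \<phi>) holomorphic_on (ball 0 2 \<inter> \<phi> -` (\<psi> ` A))"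
proof -
  have sub: "ball 0 2 \<inter> \<phi> -` (\<psi> ` A) \<subseteq> ball 0 2 \<inter> \<phi> -` (\<psi> ` ball 0 2)"
    using A by blast
  have hol1: "(coord \<psi> \<circ> \<phi>) holomorphic_on (ball 0 2 \<inter> \<phi> -` (\<psi> ` A))"
    using chart_transition[OF \<psi> \<phi>] sub by (rule holomorphic_on_subset)
  have img: "coord \<psi> (\<phi> t) \<in> A \<and> \<psi> (coord \<psi> (\<phi> t)) = \<phi> t" if t: "t \<in> ball 0 2 \<inter> \<phi> -` (\<psi> ` A)" for t
  proof -
    obtain s where "s \<in> A" "\<phi> t = \<psi> s"
      using t by blast
    then show ?thesis
      using coord_chart[OF \<psi>, of s] A(2) by auto
  qed
  have "(coord \<psi> \<circ> \<phi>) ` (ball 0 2 \<inter> \<phi> -` (\<psi> ` A)) \<subseteq> A"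
    using img by (intro image_subsetI) (simp only: comp_apply)
  then have "((f \<circ> \<psi>) \<circ> (coord \<psi> \<circ> \<phi>)) holomorphic_on (ball 0 2 \<inter> \<phi> -` (\<psi> ` A))"
    using holomorphic_on_compose_gen[OF hol1 f] by simp
  then show ?thesis
    by (rule holomorphic_transform) (simp only: comp_apply img)
qed

lemma hol_localI:
  assumes loc: "\<And>z. z \<in> S \<Longrightarrow> \<exists>\<psi>\<in>atlas. \<exists>A. open A \<and> A \<subseteq> ball 0 2 \<and> z \<in> \<psi> ` A \<and> (f \<circ> \<psi>) holomorphic_on A"
  shows "hol f"
  unfolding hol_def
proof (intro ballI holomorphic_on_locally)
  fix \<phi> t assume \<phi>: "\<phi> \<in> atlas" and t: "t \<in> ball (0::complex) 2"
  then have "\<phi> t \<in> S"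
    using chart_in_S by simp
  then obtain \<psi> A where \<psi>: "\<psi> \<in> atlas" and A: "open A" "A \<subseteq> ball 0 2" "\<phi> t \<in> \<psi> ` A" "(f \<circ> \<psi>) holomorphic_on A"
    using loc by blast
  show "\<exists>U. open U \<and> t \<in> U \<and> (f \<circ> \<phi>) holomorphic_on U"
    using holomorphic_change_chart[OF \<phi> \<psi> A(1,2,4)] chart_preimage_open[OF \<phi> chart_image_openin[OF \<psi> A(1,2)]]
      t A(3) by blast
qed

lemma hol_continuous:
  assumes "hol f"
  shows "continuous_on S f"
proof (rule continuous_on_openin_locally)
  fix z assume "z \<in> S"
  then obtain \<phi> where \<phi>: "\<phi> \<in> atlas" "\<phi> 0 = z"
    using chart_exists[of S z] by auto
  have "continuous_on (ball 0 2) (f \<circ> \<phi>)"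
    using assms \<phi>(1) holomorphic_on_imp_continuous_on unfolding hol_def by blast
  then have "continuous_on (\<phi> ` ball 0 2) ((f \<circ> \<phi>) \<circ> coord \<phi>)"
    using homeomorphism_image2[OF chart_homeomorphism[OF \<phi>(1)]]
    by (intro continuous_on_compose[OF coord_continuous[OF \<phi>(1)]]) simp
  then have "continuous_on (\<phi> ` ball 0 2) f"
    using chart_coord[OF \<phi>(1)] by (simp cong: continuous_on_cong)
  moreover have "z \<in> \<phi> ` ball 0 2"
    using \<phi>(2) by force
  ultimately show "\<exists>N. openin (top_of_set S) N \<and> z \<in> N \<and> continuous_on N f"
    using chart_openin[OF \<phi>(1)] by blast
qed

text \<open>Log-subharmonic functions with a zero at \<open>p\<close>, defined by comparison with moduli of holomorphic
  functions on coordinate discs. Only discs centred at \<open>p\<close> or avoiding \<open>p\<close> are used, and on the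
  former the factor \<open>zero_at\<close> provides the zero at \<open>p\<close>.\<close>

definition admissible :: "'a \<Rightarrow> (complex \<Rightarrow> 'a) \<Rightarrow> bool" where
  "admissible p \<phi> \<longleftrightarrow> \<phi> \<in> atlas \<and> (\<phi> 0 = p \<or> p \<notin> \<phi> ` cball 0 1)"

definition zero_at :: "'a \<Rightarrow> (complex \<Rightarrow> 'a) \<Rightarrow> complex \<Rightarrow> complex" where
  "zero_at p \<phi> t = (if \<phi> 0 = p then t else 1)"

definition log_subharmonic :: "'a \<Rightarrow> ('a \<Rightarrow> real) \<Rightarrow> bool" where
  "log_subharmonic p w \<longleftrightarrow> (\<forall>\<phi> F k. admissible p \<phi> \<longrightarrow> F holomorphic_on ball 0 1 \<longrightarrow>
     continuous_on (cball 0 1) k \<longrightarrow> (\<forall>t\<in>cball 0 1. 0 < k t) \<longrightarrow>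
     (\<forall>t\<in>ball 0 1. norm (F t) = k t) \<longrightarrow> (\<forall>t\<in>sphere 0 1. w (\<phi> t) \<le> k t) \<longrightarrow>
     (\<forall>t\<in>ball 0 1. w (\<phi> t) \<le> k t * norm (zero_at p \<phi> t)))"

text \<open>For \<open>p\<close> in \<open>S\<close> the definition forces \<open>w p = 0\<close>:
  comparison with \<open>k = 1\<close> on a disc centred at \<open>p\<close> gives
  \<open>w p \<le> 0\<close>. The upper bound 1 corresponds to Green's function being
  nonnegative.\<close>

definition perron :: "'a \<Rightarrow> ('a \<Rightarrow> real) set" where
  "perron p = {w. continuous_on S w \<and> (\<forall>z\<in>S. 0 \<le> w z \<and> w z \<le> 1) \<and> log_subharmonic p w}"

lemma norm_zero_at_sphere: "t \<in> sphere 0 1 \<Longrightarrow> norm (zero_at p \<phi> t) = 1"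
  by (simp add: zero_at_def)

lemma norm_zero_at_le: "norm t \<le> 1 \<Longrightarrow> norm (zero_at p \<phi> t) \<le> 1"
  by (simp add: zero_at_def)

lemma zero_at_holomorphic: "zero_at p \<phi> holomorphic_on A"
  unfolding zero_at_def by (cases "\<phi> 0 = p") (simp_all add: holomorphic_on_ident)

lemma admissible_atlas: "admissible p \<phi> \<Longrightarrow> \<phi> \<in> atlas"
  by (simp add: admissible_def)

lemma admissible_zero_at:
  assumes "admissible p \<phi>" "norm t \<le> 1"
  shows "\<phi> t = p \<longleftrightarrow> zero_at p \<phi> t = 0"
  using assms chart_eq_iff[of \<phi> t 0] unfolding admissible_def zero_at_def
  by (auto simp: image_iff)

lemma admissible_exists:
  assumes "z \<in> N" "openin (top_of_set S) N"
  obtains \<phi> where "admissible p \<phi>" "\<phi> 0 = z" "\<phi> ` ball 0 2 \<subseteq> N"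
proof (cases "z = p")
  case True
  then show thesis
    using chart_exists[OF assms(2,1)] that unfolding admissible_def by blast
next
  case False
  have "openin (top_of_set S) (N - {p})"
    using assms(2) by (metis closed_singleton Diff_eq openin_Int_open open_Compl)
  then obtain \<phi> where "\<phi> \<in> atlas" "\<phi> 0 = z" "\<phi> ` ball 0 2 \<subseteq> N - {p}"
    using chart_exists[of "N - {p}" z] assms(1) False by blast
  moreover have "\<phi> ` cball 0 1 \<subseteq> \<phi> ` ball 0 2"
    by (rule image_mono) auto
  ultimately show thesis
    using that[of \<phi>] unfolding admissible_def by blast
qed

lemma log_subharmonicD:
  assumes "log_subharmonic p w" "admissible p \<phi>" "F holomorphic_on ball 0 1" "continuous_on (cball 0 1) k"
    and "\<And>t. t \<in> cball 0 1 \<Longrightarrow> 0 < k t" "\<And>t. t \<in> ball 0 1 \<Longrightarrow> norm (F t) = k t"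
    and "\<And>t. t \<in> sphere 0 1 \<Longrightarrow> w (\<phi> t) \<le> k t" and "t \<in> ball 0 1"
  shows "w (\<phi> t) \<le> k t * norm (zero_at p \<phi> t)"
  using assms(1)[unfolded log_subharmonic_def] assms(2-8) by blast

text \<open>Dividing by \<open>zero_at p \<phi>\<close>, which has modulus 1 on the circle, leaves a
  holomorphic \<open>T\<close> with the same boundary bound. The maximum principle for
  \<open>T / F\<close> gives \<open>norm (T t) \<le> k t\<close>, and multiplying back restores the
  factor.\<close>

lemma log_subharmonic_norm_hol:
  assumes h: "hol h" "h p = 0"
  shows "log_subharmonic p (\<lambda>z. norm (h z))"
  unfolding log_subharmonic_def
proof (intro allI impI ballI)
  fix \<phi> F k t
  assume \<phi>: "admissible p \<phi>" and F: "F holomorphic_on ball 0 1" and k: "continuous_on (cball 0 1) k"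
    "\<forall>t\<in>cball 0 1. 0 < k t" "\<forall>t\<in>ball 0 1. norm (F t) = k t"
    and le: "\<forall>t\<in>sphere 0 1. norm (h (\<phi> t)) \<le> k t" and t: "t \<in> ball (0::complex) 1"
  have hol: "(h \<circ> \<phi>) holomorphic_on ball 0 2"
    using h \<phi> by (simp add: hol_def admissible_def)
  obtain T where T: "T holomorphic_on ball 0 2" "\<And>t. t \<in> ball 0 2 \<Longrightarrow> h (\<phi> t) = zero_at p \<phi> t * T t"
  proof (cases "\<phi> 0 = p")
    case True
    obtain T where "T holomorphic_on ball 0 2" "\<And>t. t \<in> ball 0 2 \<Longrightarrow> (h \<circ> \<phi>) t = t * T t"
      by (rule holomorphic_on_divide_zero[OF hol]) (use True h(2) in auto)
    then show thesis
      using that True by (simp add: zero_at_def)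
  next
    case False
    then show thesis
      using that[OF hol] by (simp add: zero_at_def)
  qed
  have sub2: "cball 0 1 \<subseteq> ball (0::complex) 2"
    by auto
  have nz: "F s \<noteq> 0" if "s \<in> ball 0 1" for s
  proof -
    have "0 < norm (F s)"
      using that k(2,3) by simp
    then show ?thesis by simp
  qed
  have "norm (T t) / k t \<le> 1"
  proof (rule norm_maximum_principle[of "ball 0 1" "\<lambda>t. norm (T t) / k t"])
    have "continuous_on (cball 0 1) T"
      using continuous_on_subset[OF holomorphic_on_imp_continuous_on[OF T(1)] sub2] .
    then show "continuous_on (closure (ball 0 1)) (\<lambda>t. norm (T t) / k t)"
      using k(1,2) by (auto intro!: continuous_intros)
  next
    fix s :: complex assume s: "s \<in> ball 0 1"
    have "(\<lambda>t. T t / F t) holomorphic_on ball 0 1"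
      using nz by (intro holomorphic_intros F holomorphic_on_subset[OF T(1)]) auto
    moreover have "\<forall>t\<in>ball 0 1. norm (T t / F t) = norm (T t) / k t"
      using k(3) by (simp add: norm_divide)
    ultimately show "\<exists>U Q. open U \<and> s \<in> U \<and> Q holomorphic_on U \<and> (\<forall>w\<in>U. norm (Q w) = norm (T w) / k w)"
      using s open_ball by blast
  next
    fix s :: complex assume "s \<in> frontier (ball 0 1)"
    then have s: "s \<in> sphere 0 1" by simp
    then have "norm (h (\<phi> s)) = norm (T s)"
      using T(2)[of s] norm_zero_at_sphere[OF s] by (simp add: norm_mult)
    moreover have "norm (h (\<phi> s)) \<le> k s" "0 < k s"
      using le k(2) s by simp_all
    ultimately show "norm (T s) / k s \<le> 1"
      by (simp add: divide_le_eq)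
  qed (use t in auto)
  moreover have "0 < k t"
    using k(2) t by simp
  ultimately have "norm (T t) \<le> k t"
    by (simp add: divide_le_eq)
  then show "norm (h (\<phi> t)) \<le> k t * norm (zero_at p \<phi> t)"
    using T(2)[of t] t by (simp add: norm_mult mult.commute mult_right_mono)
qed

lemma log_subharmonic_max:
  assumes "log_subharmonic p u" "log_subharmonic p v"
  shows "log_subharmonic p (\<lambda>z. max (u z) (v z))"
  unfolding log_subharmonic_def
proof (intro allI impI ballI)
  fix \<phi> F k t
  assume *: "admissible p \<phi>" "F holomorphic_on ball 0 1" "continuous_on (cball 0 1) k"
    "\<forall>t\<in>cball 0 1. 0 < k t" "\<forall>t\<in>ball 0 1. norm (F t) = k t"
    "\<forall>t\<in>sphere 0 1. max (u (\<phi> t)) (v (\<phi> t)) \<le> k t" "t \<in> ball (0::complex) 1"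
  have "u (\<phi> t) \<le> k t * norm (zero_at p \<phi> t)"
    by (rule log_subharmonicD[OF assms(1) *(1-3)]) (use * in auto)
  moreover have "v (\<phi> t) \<le> k t * norm (zero_at p \<phi> t)"
    by (rule log_subharmonicD[OF assms(2) *(1-3)]) (use * in auto)
  ultimately show "max (u (\<phi> t)) (v (\<phi> t)) \<le> k t * norm (zero_at p \<phi> t)"
    by simp
qed

lemma perron_max:
  assumes "u \<in> perron p" "v \<in> perron p"
  shows "(\<lambda>z. max (u z) (v z)) \<in> perron p"
  using assms unfolding perron_def by (auto intro!: log_subharmonic_max continuous_on_max simp: le_max_iff_disj)

lemma perron_norm_hol:
  assumes "hol h" "h p = 0" "\<And>z. z \<in> S \<Longrightarrow> norm (h z) \<le> 1"
  shows "(\<lambda>z. norm (h z)) \<in> perron p"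
  using assms log_subharmonic_norm_hol hol_continuous unfolding perron_def by (auto intro!: continuous_on_norm)

text \<open>\<open>w'\<close> is \<open>w\<close> with its values on a coordinate disc replaced by the solution of the Dirichlet
  problem.\<close>

lemma perron_modification:
  assumes w: "w \<in> perron p" and \<phi>: "admissible p \<phi>" and pos: "\<And>t. t \<in> sphere 0 1 \<Longrightarrow> 0 < w (\<phi> t)"
  obtains w' H where "w' \<in> perron p" "\<And>z. z \<in> S \<Longrightarrow> w z \<le> w' z" "H holomorphic_on ball 0 1"
    "\<And>t. t \<in> ball 0 1 \<Longrightarrow> H t \<noteq> 0 \<and> norm (H t) \<le> 1 \<and> w' (\<phi> t) = norm (H t) * norm (zero_at p \<phi> t)"
proof -
  note \<phi>A = admissible_atlas[OF \<phi>]
  have wc: "continuous_on S w" and w01: "\<And>z. z \<in> S \<Longrightarrow> 0 \<le> w z \<and> w z \<le> 1" and ws: "log_subharmonic p w"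
    using w by (auto simp: perron_def)
  have sub2: "cball 0 1 \<subseteq> ball (0::complex) 2" "sphere 0 1 \<subseteq> ball (0::complex) 2" "ball 0 1 \<subseteq> ball (0::complex) 2"
    by auto
  have "continuous_on (sphere 0 1) (\<lambda>t. w (\<phi> t))"
    by (rule continuous_on_compose2[OF wc continuous_on_subset[OF chart_continuous[OF \<phi>A] sub2(2)]])
      (use chart_in_S[OF \<phi>A] in auto)
  then obtain k H where k: "continuous_on (cball 0 1) k" "\<And>t. t \<in> cball 0 1 \<Longrightarrow> k t > 0"
    "\<And>t. t \<in> sphere 0 1 \<Longrightarrow> k t = w (\<phi> t)"
    and H: "H holomorphic_on ball 0 1" "\<And>t. t \<in> ball 0 1 \<Longrightarrow> norm (H t) = k t"
    by (rule disc_Dirichlet[of "\<lambda>t. w (\<phi> t)"]) (erule pos, (assumption | blast))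
  have wk: "w (\<phi> t) \<le> k t * norm (zero_at p \<phi> t)" if "t \<in> cball 0 1" for t
  proof (cases "t \<in> ball 0 1")
    case True
    then show ?thesis
      by (intro log_subharmonicD[OF ws \<phi> H(1) k(1,2) H(2)]) (use k(3) in auto)
  next
    case False
    then have "t \<in> sphere 0 1"
      using that by auto
    then show ?thesis
      using k(3) norm_zero_at_sphere by simp
  qed
  have k1: "k t \<le> 1" if "t \<in> ball 0 1" for t
  proof (rule norm_maximum_principle[of "ball 0 1" k])
    show "\<exists>U Q. open U \<and> z \<in> U \<and> Q holomorphic_on U \<and> (\<forall>w\<in>U. norm (Q w) = k w)" if "z \<in> ball 0 1" for z
      using that H open_ball by blast
    show "k z \<le> 1" if "z \<in> frontier (ball 0 1)" for z
    proof -
      have "z \<in> sphere 0 1"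
        using that by simp
      then show ?thesis
        using k(3) w01[of "\<phi> z"] chart_in_S[OF \<phi>A, of z] by simp
    qed
  qed (use that k(1) in auto)
  have k1': "k t \<le> 1" if "t \<in> cball 0 1" for t
  proof (cases "t \<in> ball 0 1")
    case False
    then have "t \<in> sphere 0 1"
      using that by auto
    then show ?thesis
      using k(3) w01[of "\<phi> t"] chart_in_S[OF \<phi>A, of t] by simp
  qed (rule k1)
  define C where "C = \<phi> ` cball 0 1"
  define B where "B = \<phi> ` ball 0 1"
  have CS: "C \<subseteq> S"
    using chart_subset[OF \<phi>A] sub2(1) unfolding C_def by blast
  have BC: "B \<subseteq> C"
    unfolding B_def C_def by (rule image_mono) auto
  have C2: "C \<subseteq> \<phi> ` ball 0 2"
    unfolding C_def using sub2(1) by (rule image_mono)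
  have closedC: "closed C"
    unfolding C_def using chart_cball_compact[OF \<phi>A] by (rule compact_imp_closed)
  have openB: "openin (top_of_set S) B"
    unfolding B_def by (rule chart_ball_openin[OF \<phi>A]) simp
  have coordC: "coord \<phi> z \<in> cball 0 1" "\<phi> (coord \<phi> z) = z" if z: "z \<in> C" for z
  proof -
    obtain t where "t \<in> cball 0 1" "z = \<phi> t"
      using z unfolding C_def by blast
    then show "coord \<phi> z \<in> cball 0 1" "\<phi> (coord \<phi> z) = z"
      using coord_chart[OF \<phi>A] sub2(1) by auto
  qed
  have coordB: "coord \<phi> z \<in> ball 0 1 \<longleftrightarrow> z \<in> B" if "z \<in> C" for z
  proof
    assume "coord \<phi> z \<in> ball 0 1"
    then show "z \<in> B"
      using coordC(2)[OF that] unfolding B_def by (metis imageI)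
  next
    assume "z \<in> B"
    then show "coord \<phi> z \<in> ball 0 1"
      using coord_chart[OF \<phi>A] sub2(3) unfolding B_def by auto
  qed
  define v where "v t = k t * norm (zero_at p \<phi> t)" for t
  have v_sphere: "v t = w (\<phi> t)" if "t \<in> sphere 0 1" for t
    using k(3)[OF that] norm_zero_at_sphere[OF that] by (simp add: v_def)
  have v_edge: "v (coord \<phi> z) = w z" if "z \<in> C" "z \<notin> B" for z
  proof -
    have "coord \<phi> z \<in> sphere 0 1"
      using coordC(1)[OF that(1)] coordB[OF that(1)] that(2) by auto
    then show ?thesis
      using v_sphere coordC(2)[OF that(1)] by simp
  qed
  define w' where "w' z = (if z \<in> C then v (coord \<phi> z) else w z)" for z
  have w'_notB: "w' z = w z" if "z \<notin> B" for z
    using v_edge that by (simp add: w'_def)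
  have ge: "w z \<le> w' z" if "z \<in> S" for z
  proof (cases "z \<in> C")
    case True
    then show ?thesis
      using wk[OF coordC(1)[OF True]] coordC(2)[OF True] by (simp add: w'_def v_def)
  qed (simp add: w'_def)
  have contv: "continuous_on (cball 0 1) v"
    unfolding v_def using k(1) zero_at_holomorphic[THEN holomorphic_on_imp_continuous_on]
    by (intro continuous_intros)
  have cont_coord: "continuous_on C (coord \<phi>)"
    using coord_continuous[OF \<phi>A] C2 by (rule continuous_on_subset)
  have cont: "continuous_on S w'"
  proof -
    have SE: "C \<union> (S - B) = S"
      using CS BC by blast
    have "continuous_on (C \<union> (S - B)) (\<lambda>z. if z \<in> C then v (coord \<phi> z) else w z)"
    proof (rule continuous_on_cases_local)
      show "closedin (top_of_set (C \<union> (S - B))) C"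
        unfolding SE using closedC CS by (simp add: closed_subset)
      show "closedin (top_of_set (C \<union> (S - B))) (S - B)"
        unfolding SE using openB by (metis closedin_diff closedin_topspace topspace_euclidean_subtopology)
      show "continuous_on C (\<lambda>z. v (coord \<phi> z))"
        by (rule continuous_on_compose2[OF contv cont_coord]) (use coordC(1) in blast)
      show "continuous_on (S - B) w"
        using wc by (rule continuous_on_subset) blast
      show "v (coord \<phi> x) = w x" if "x \<in> C \<and> x \<notin> C \<or> x \<in> S - B \<and> x \<in> C" for x
        using v_edge that by blast
    qed
    then show ?thesis
      unfolding SE w'_def .
  qed
  have v01: "0 \<le> v t \<and> v t \<le> 1" if "t \<in> cball 0 1" for t
  proof -
    have "0 < k t" "k t \<le> 1" "norm (zero_at p \<phi> t) \<le> 1"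
      using k(2)[OF that] k1'[OF that] norm_zero_at_le that by auto
    then show ?thesis
      unfolding v_def by (simp add: mult_le_one)
  qed
  have w'01: "0 \<le> w' z \<and> w' z \<le> 1" if "z \<in> S" for z
    using v01[OF coordC(1)] w01[OF that] by (simp add: w'_def)
  \<comment> \<open>A test disc \<open>\<psi>\<close> may cross the modified disc. Outside
    \<open>B\<close> the estimate for \<open>w\<close> suffices, since \<open>w \<le> w'\<close>
    passes the boundary condition on to \<open>w\<close>. Inside, the maximum principle is applied
    on the part \<open>V\<close> of the test disc lying over \<open>B\<close>: a frontier point of
    \<open>V\<close> is on the circle of \<open>\<psi>\<close> or over the edge of \<open>B\<close>,
    where \<open>w' = w\<close>.\<close>
  have "log_subharmonic p w'"
    unfolding log_subharmonic_def
  proof (intro allI impI ballI)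
    fix \<psi> F k' t
    assume \<psi>: "admissible p \<psi>" and F: "F holomorphic_on ball 0 1" and k': "continuous_on (cball 0 1) k'"
      "\<forall>t\<in>cball 0 1. 0 < k' t" "\<forall>t\<in>ball 0 1. norm (F t) = k' t"
      and le: "\<forall>t\<in>sphere 0 1. w' (\<psi> t) \<le> k' t" and t: "t \<in> ball (0::complex) 1"
    note \<psi>A = admissible_atlas[OF \<psi>]
    have wle: "w (\<psi> s) \<le> k' s * norm (zero_at p \<psi> s)" if "s \<in> ball 0 1" for s
    proof (rule log_subharmonicD[OF ws \<psi> F k'(1)])
      show "w (\<psi> s) \<le> k' s" if "s \<in> sphere 0 1" for s
        using ge[of "\<psi> s"] le that chart_in_S[OF \<psi>A, of s] by force
    qed (use k' that in auto)
    show "w' (\<psi> t) \<le> k' t * norm (zero_at p \<psi> t)"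
    proof (cases "\<psi> t \<in> B")
      case False
      then show ?thesis
        using wle[OF t] w'_notB by simp
    next
      case True
      define V where "V = ball 0 1 \<inter> \<psi> -` B"
      have "V = ball 0 1 \<inter> (ball 0 2 \<inter> \<psi> -` B)"
        using sub2(3) unfolding V_def by blast
      then have openV: "open V"
        using chart_preimage_open[OF \<psi>A openB] by (simp add: open_Int)
      have "continuous_on (cball 0 1) \<psi>"
        using chart_continuous[OF \<psi>A] sub2(1) by (rule continuous_on_subset)
      then have "closed (cball 0 1 \<inter> \<psi> -` C)"
        using closedC by (intro continuous_closed_preimage) auto
      moreover have "V \<subseteq> cball 0 1 \<inter> \<psi> -` C"
        using BC unfolding V_def by auto
      ultimately have clV: "closure V \<subseteq> cball 0 1 \<inter> \<psi> -` C"
        using closure_minimal by blast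
      define \<tau> where "\<tau> = coord \<phi> \<circ> \<psi>"
      define D where "D = ball 0 2 \<inter> \<psi> -` (\<phi> ` ball 0 2)"
      have openD: "open D"
        unfolding D_def by (rule chart_preimage_open[OF \<psi>A chart_openin[OF \<phi>A]])
      have hol\<tau>: "\<tau> holomorphic_on D"
        unfolding \<tau>_def D_def by (rule chart_transition[OF \<phi>A \<psi>A])
      have clD: "closure V \<subseteq> D"
        using clV sub2(1) C2 unfolding D_def by blast
      have \<tau>C: "\<tau> s \<in> cball 0 1" "\<phi> (\<tau> s) = \<psi> s" if "s \<in> closure V" for s
        using coordC[of "\<psi> s"] clV that unfolding \<tau>_def by auto
      \<comment> \<open>The quotient of the two zero factors is holomorphic near
        \<open>closure V\<close>. If both discs are centred at \<open>p\<close>, the coordinate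
        change vanishes at 0. If only \<open>\<psi>\<close> is, then \<open>p \<notin> C\<close>
        keeps 0 away from \<open>closure V\<close>. If \<open>\<psi>\<close> is not, the factor in
        the denominator is 1.\<close>
      obtain D' T where D': "open D'" "closure V \<subseteq> D'" "D' \<subseteq> D" and T: "T holomorphic_on D'"
        "\<And>s. s \<in> D' \<Longrightarrow> zero_at p \<phi> (\<tau> s) = T s * zero_at p \<psi> s"
      proof (cases "\<psi> 0 = p")
        case \<psi>p: True
        show thesis
        proof (cases "\<phi> 0 = p")
          case \<phi>p: True
          have "\<tau> 0 = 0"
            using \<psi>p \<phi>p coord_chart[OF \<phi>A, of 0] by (simp add: \<tau>_def)
          then obtain T where "T holomorphic_on D" "\<And>z. z \<in> D \<Longrightarrow> \<tau> z = z * T z"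
            using holomorphic_on_divide_zero[OF hol\<tau> openD] by blast
          then show thesis
            using that[of D T] openD clD \<psi>p \<phi>p by (simp add: zero_at_def)
        next
          case \<phi>p: False
          then have "p \<notin> C"
            using \<phi> unfolding admissible_def C_def by blast
          then have "0 \<notin> closure V"
            using clV \<psi>p by auto
          then show thesis
            using that[of "D - {0}" "\<lambda>z. 1 / z"] openD clD \<psi>p \<phi>p
            by (force simp: zero_at_def intro!: holomorphic_intros)
        qed
      next
        case \<psi>p: False
        then show thesis
          using that[of D "\<lambda>z. zero_at p \<phi> (\<tau> z)"] openD clD hol\<tau>
          by (cases "\<phi> 0 = p") (simp_all add: zero_at_def)
      qed
      have nzF: "F s \<noteq> 0" if "s \<in> ball 0 1" for s
      proof -
        have "0 < norm (F s)"
          using that k'(2,3) by simp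
        then show ?thesis by simp
      qed
      have \<tau>B: "\<tau> s \<in> ball 0 1" if "s \<in> V" for s
        using coordB[of "\<psi> s"] BC that unfolding V_def \<tau>_def by auto
      have w'\<psi>: "w' (\<psi> s) = k (\<tau> s) * norm (T s) * norm (zero_at p \<psi> s)" if "s \<in> closure V" for s
      proof -
        have "\<psi> s \<in> C" "s \<in> D'"
          using clV D'(2) that by auto
        then show ?thesis
          using T(2) by (simp add: w'_def v_def \<tau>_def norm_mult)
      qed
      have tV: "t \<in> V"
        using t True unfolding V_def by blast
      \<comment> \<open>With \<open>zero_at p \<psi>\<close> divided out of both sides, the
        expression is the modulus of \<open>H (\<tau> s) * T s / F s\<close>, holomorphic because
        \<open>F\<close> has no zeros.\<close>
      have "k (\<tau> t) * norm (T t) / k' t \<le> 1"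
      proof (rule norm_maximum_principle[OF openV _ _ _ _ tV, of "\<lambda>t. k (\<tau> t) * norm (T t) / k' t"])
        show "bounded V"
          unfolding V_def by (meson bounded_Int bounded_ball)
        have c1: "continuous_on (closure V) \<tau>"
          using holomorphic_on_imp_continuous_on[OF hol\<tau>] clD by (rule continuous_on_subset)
        have c2: "continuous_on (closure V) (\<lambda>s. k (\<tau> s))"
          by (rule continuous_on_compose2[OF k(1) c1]) (use \<tau>C(1) in blast)
        have c3: "continuous_on (closure V) T"
          using holomorphic_on_imp_continuous_on[OF T(1)] D'(2) by (rule continuous_on_subset)
        have c4: "continuous_on (closure V) k'"
          using k'(1) clV by (rule continuous_on_subset[OF _ order_trans]) blast
        have "k' s \<noteq> 0" if "s \<in> closure V" for s
          using k'(2) clV that by (metis IntD1 less_irrefl subsetD)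
        then show "continuous_on (closure V) (\<lambda>t. k (\<tau> t) * norm (T t) / k' t)"
          by (intro continuous_intros c2 c3 c4) blast
      next
        fix s assume s: "s \<in> V"
        have VD: "V \<subseteq> D'" "V \<subseteq> D" "V \<subseteq> ball 0 1"
          using D' clD closure_subset[of V] unfolding V_def by blast+
        have "(H \<circ> \<tau>) holomorphic_on V"
          by (rule holomorphic_on_compose_gen[OF holomorphic_on_subset[OF hol\<tau> VD(2)] H(1)]) (use \<tau>B in blast)
        then have "(\<lambda>s. H (\<tau> s)) holomorphic_on V"
          by (simp add: o_def)
        then have "(\<lambda>s. H (\<tau> s) * T s / F s) holomorphic_on V"
          using nzF VD by (intro holomorphic_intros holomorphic_on_subset[OF T(1)] holomorphic_on_subset[OF F]) auto
        moreover have "norm (H (\<tau> \<eta>) * T \<eta> / F \<eta>) = k (\<tau> \<eta>) * norm (T \<eta>) / k' \<eta>" if "\<eta> \<in> V" for \<eta>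
          using H(2)[OF \<tau>B[OF that]] k'(3) VD(3) that by (auto simp: norm_mult norm_divide)
        ultimately show "\<exists>U Q. open U \<and> s \<in> U \<and> Q holomorphic_on U \<and>
            (\<forall>w\<in>U. norm (Q w) = k (\<tau> w) * norm (T w) / k' w)"
          using openV s by blast
      next
        fix s assume "s \<in> frontier V"
        then have s: "s \<in> closure V" "s \<notin> V"
          using openV by (auto simp: frontier_def interior_open)
        then have s1: "s \<in> cball 0 1" "\<psi> s \<in> C"
          using clV by auto
        then have k'pos: "0 < k' s"
          using k'(2) by blast
        have "k (\<tau> s) * norm (T s) \<le> k' s"
        proof (cases "s \<in> ball 0 1")
          case False
          then have "s \<in> sphere 0 1"
            using s1 by auto
          then show ?thesis
            using le w'\<psi>[OF s(1)] norm_zero_at_sphere[of s] by (metis mult.right_neutral)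
        next
          case sb: True
          then have nB: "\<psi> s \<notin> B"
            using s(2) unfolding V_def by blast
          then have sph: "\<tau> s \<in> sphere 0 1"
            using coordB[OF s1(2)] coordC(1)[OF s1(2)] unfolding \<tau>_def by auto
          \<comment> \<open>Over the edge of \<open>B\<close> the zero factor of
            \<open>\<phi>\<close> has modulus 1, so that of \<open>\<psi>\<close> cannot vanish at
            \<open>s\<close> and may be cancelled from the estimate for \<open>w\<close>.\<close>
          have "1 = norm (T s) * norm (zero_at p \<psi> s)"
            using T(2)[of s] D'(2) s(1) norm_zero_at_sphere[OF sph] by (metis norm_mult subsetD)
          moreover have "k (\<tau> s) * (norm (T s) * norm (zero_at p \<psi> s)) \<le> k' s * norm (zero_at p \<psi> s)"
            using wle[OF sb] w'_notB[OF nB] w'\<psi>[OF s(1)] by (simp add: mult.assoc)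
          ultimately have "(k (\<tau> s) * norm (T s)) * norm (zero_at p \<psi> s) \<le> k' s * norm (zero_at p \<psi> s)"
            "0 < norm (zero_at p \<psi> s)"
            by (simp_all add: mult.assoc) (metis mult_zero_right norm_zero zero_neq_one)
          then show ?thesis
            by (simp only: mult_le_cancel_right_pos)
        qed
        then show "k (\<tau> s) * norm (T s) / k' s \<le> 1"
          using k'pos by (simp add: divide_le_eq)
      qed
      moreover have "0 < k' t"
        using k'(2) t by simp
      ultimately have "k (\<tau> t) * norm (T t) \<le> k' t"
        by (simp add: divide_le_eq)
      then show ?thesis
        using w'\<psi>[of t] tV closure_subset[of V] by (simp add: mult_right_mono subset_iff)
    qed
  qed
  then have "w' \<in> perron p"
    using cont w'01 unfolding perron_def by blast
  moreover have "H t \<noteq> 0 \<and> norm (H t) \<le> 1 \<and> w' (\<phi> t) = norm (H t) * norm (zero_at p \<phi> t)"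
    if t: "t \<in> ball 0 1" for t
  proof -
    have "t \<in> cball 0 1" "t \<in> ball 0 2"
      using t by auto
    moreover have "\<phi> t \<in> C"
      unfolding C_def using \<open>t \<in> cball 0 1\<close> by (rule imageI)
    ultimately show ?thesis
      using H(2)[OF t] k(2)[of t] k1[OF t] coord_chart[OF \<phi>A, of t] by (auto simp: w'_def v_def)
  qed
  ultimately show thesis
    using that[of w' H] ge H(1) by blast
qed

end

section \<open>Green's function\<close>

text \<open>The bound \<open>1 / 2\<close> keeps the differences \<open>x z - x p\<close> and
  \<open>y z - y p\<close> in the closed unit disc, so that their moduli belong to
  \<open>perron p\<close>.\<close>

locale hyperbolic_surface = riemann_surface +
  fixes x y :: "'a \<Rightarrow> complex"
  assumes simply_connected_S: "simply_connected S"
    and hol_xy: "hol x" "hol y"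
    and norm_xy: "z \<in> S \<Longrightarrow> norm (x z) \<le> 1 / 2" "z \<in> S \<Longrightarrow> norm (y z) \<le> 1 / 2"
    and separating: "\<lbrakk>z \<in> S; z' \<in> S; x z = x z'; y z = y z'\<rbrakk> \<Longrightarrow> z = z'"
begin

text \<open>In terms of Green's function \<open>g\<close> with pole \<open>p\<close> this is \<open>exp (- g)\<close>.\<close>

definition green :: "'a \<Rightarrow> 'a \<Rightarrow> real" where
  "green p z = (SUP w\<in>perron p. w z)"

text \<open>A competitor positive away from \<open>p\<close> gives positive Dirichlet data for
  \<open>perron_modification\<close>, and it makes Green's function finite away from its
  pole.\<close>

lemma perron_positive:
  assumes "p \<in> S"
  obtains w where "w \<in> perron p" "\<And>z. z \<in> S \<Longrightarrow> z \<noteq> p \<Longrightarrow> 0 < w z"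
proof -
  have *: "(\<lambda>z. norm (f z - f p)) \<in> perron p" if f: "hol f" "\<And>z. z \<in> S \<Longrightarrow> norm (f z) \<le> 1 / 2" for f
  proof (rule perron_norm_hol)
    have "(\<lambda>t. (f \<circ> \<phi>) t - f p) holomorphic_on ball 0 2" if "\<phi> \<in> atlas" for \<phi>
      using f(1) that unfolding hol_def by (intro holomorphic_intros) blast
    then show "hol (\<lambda>z. f z - f p)"
      by (simp add: hol_def o_def)
    show "norm (f z - f p) \<le> 1" if "z \<in> S" for z
      using norm_triangle_ineq4[of "f z" "f p"] f(2)[OF that] f(2)[OF assms] by simp
  qed simp
  have "(\<lambda>z. max (norm (x z - x p)) (norm (y z - y p))) \<in> perron p"
    by (rule perron_max[OF *[OF hol_xy(1) norm_xy(1)] *[OF hol_xy(2) norm_xy(2)]])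
  moreover have "0 < max (norm (x z - x p)) (norm (y z - y p))" if "z \<in> S" "z \<noteq> p" for z
    using separating[OF that(1) assms] that(2) by (auto simp: less_max_iff_disj)
  ultimately show thesis
    by (rule that)
qed

lemma green_upper:
  assumes "w \<in> perron p" "z \<in> S"
  shows "w z \<le> green p z"
  unfolding green_def using assms
  by (intro cSUP_upper bdd_aboveI[of _ 1]) (auto simp: perron_def)

lemma green_approx:
  assumes "p \<in> S" "c < green p z"
  obtains w where "w \<in> perron p" "c < w z"
proof -
  have "perron p \<noteq> {}"
    using perron_positive[OF assms(1)] by (metis empty_iff)
  then show thesis
    using less_cSupD[of "(\<lambda>w. w z) ` perron p" c] assms(2) that unfolding green_def by auto
qed

lemma green_le_1:
  assumes "p \<in> S" "z \<in> S"
  shows "green p z \<le> 1"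
proof (rule ccontr)
  assume "\<not> green p z \<le> 1"
  then obtain w where "w \<in> perron p" "1 < w z"
    using green_approx[OF assms(1), of 1 z] by auto
  then show False
    using assms(2) unfolding perron_def by force
qed

lemma green_pos:
  assumes "p \<in> S" "z \<in> S" "z \<noteq> p"
  shows "0 < green p z"
proof -
  obtain w where "w \<in> perron p" "0 < w z"
    using perron_positive[OF assms(1)] assms(2,3) by metis
  then show ?thesis
    using green_upper assms(2) by fastforce
qed

text \<open>Closure under maxima lets one competitor be nearly optimal at finitely many points at
  once; dominating \<open>w0\<close> preserves positivity.\<close>

lemma green_finite_approx:
  fixes n :: nat
  assumes p: "p \<in> S" and "e > 0" and d: "\<And>i. d i \<in> S" and w0: "w0 \<in> perron p"
  shows "\<exists>w\<in>perron p. (\<forall>z. w0 z \<le> w z) \<and> (\<forall>i<n. green p (d i) - e < w (d i))"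
proof (induction n)
  case 0
  then show ?case
    using w0 by auto
next
  case (Suc n)
  then obtain w where w: "w \<in> perron p" "\<forall>z. w0 z \<le> w z" "\<forall>i<n. green p (d i) - e < w (d i)"
    by blast
  obtain v where v: "v \<in> perron p" "green p (d n) - e < v (d n)"
    by (rule green_approx[OF p, of "green p (d n) - e" "d n"]) (use \<open>e > 0\<close> in auto)
  have "(\<lambda>z. max (w z) (v z)) \<in> perron p"
    using w(1) v(1) by (rule perron_max)
  then show ?case
    using w v by (intro bexI[of _ "\<lambda>z. max (w z) (v z)"]) (auto simp: less_Suc_eq le_max_iff_disj less_max_iff_disj)
qed

text \<open>A limit of modified functions attains the supremum on a dense sequence. No monotonicity is
  needed, since the supremum of continuous functions is lower semicontinuous.\<close>

lemma green_local:
  assumes p: "p \<in> S" and \<phi>: "admissible p \<phi>"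
  obtains H where "H holomorphic_on ball 0 1"
    "\<And>t. t \<in> ball 0 1 \<Longrightarrow> H t \<noteq> 0"
    "\<And>t. t \<in> ball 0 1 \<Longrightarrow> green p (\<phi> t) = norm (H t) * norm (zero_at p \<phi> t)"
proof -
  note \<phi>A = admissible_atlas[OF \<phi>]
  have inS: "\<phi> t \<in> S" if "norm t < 2" for t
    using chart_in_S[OF \<phi>A that] .
  obtain D where D: "countable D" "D \<subseteq> ball (0::complex) 1" "ball 0 1 \<subseteq> closure D"
    using separable by blast
  have "D \<noteq> {}"
    using D(3) by auto
  define d where "d = from_nat_into D"
  have dD: "d i \<in> D" for i
    unfolding d_def using \<open>D \<noteq> {}\<close> by (rule from_nat_into)
  have d1: "norm (d i) < 1" for i
    using dD[of i] D(2) by auto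
  have d_surj: "\<exists>i. d i = t" if "t \<in> D" for t
    unfolding d_def using from_nat_into_surj[OF D(1) that] .
  obtain w0 where w0: "w0 \<in> perron p" "\<And>z. z \<in> S \<Longrightarrow> z \<noteq> p \<Longrightarrow> 0 < w0 z"
    using perron_positive[OF p] by metis
  \<comment> \<open>The \<open>n\<close>-th competitor takes care of the first \<open>n\<close>
    points of the dense sequence with error \<open>1 / Suc n\<close>, so each fixed point is handled
    from some index on, also along any subsequence.\<close>
  have "\<exists>w. w \<in> perron p \<and> (\<forall>z. w0 z \<le> w z) \<and> (\<forall>i<n. green p (\<phi> (d i)) - 1 / Suc n < w (\<phi> (d i)))" for n
  proof -
    have "\<phi> (d i) \<in> S" for i
      using inS d1[of i] by simp
    then show ?thesis
      using green_finite_approx[OF p, of "1 / Suc n" "\<lambda>i. \<phi> (d i)" w0 n] w0(1) by auto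
  qed
  then obtain w where w: "\<And>n. w n \<in> perron p" "\<And>n z. w0 z \<le> w n z"
    "\<And>n i. i < n \<Longrightarrow> green p (\<phi> (d i)) - 1 / Suc n < w n (\<phi> (d i))"
    by metis
  have pos: "0 < w n (\<phi> t)" if "t \<in> sphere 0 1" for n t
  proof -
    have "zero_at p \<phi> t \<noteq> 0"
      using norm_zero_at_sphere[OF that, of p \<phi>] by auto
    then have "\<phi> t \<noteq> p"
      using admissible_zero_at[OF \<phi>, of t] that by simp
    then have "0 < w0 (\<phi> t)"
      using w0(2)[of "\<phi> t"] inS[of t] that by simp
    then show ?thesis
      using w(2)[of "\<phi> t" n] by simp
  qed
  have "\<exists>w' H. w' \<in> perron p \<and> (\<forall>z\<in>S. w n z \<le> w' z) \<and> H holomorphic_on ball 0 1 \<and>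
    (\<forall>t\<in>ball 0 1. H t \<noteq> 0 \<and> norm (H t) \<le> 1 \<and> w' (\<phi> t) = norm (H t) * norm (zero_at p \<phi> t))" for n
    by (rule perron_modification[OF w(1)[of n] \<phi> pos]) blast+
  then obtain w' H where w': "\<And>n. w' n \<in> perron p" "\<And>n z. z \<in> S \<Longrightarrow> w n z \<le> w' n z"
    and H: "\<And>n. H n holomorphic_on ball 0 1" "\<And>n t. t \<in> ball 0 1 \<Longrightarrow> H n t \<noteq> 0"
      "\<And>n t. t \<in> ball 0 1 \<Longrightarrow> norm (H n t) \<le> 1"
      "\<And>n t. t \<in> ball 0 1 \<Longrightarrow> w' n (\<phi> t) = norm (H n t) * norm (zero_at p \<phi> t)"
    by metis
  let ?\<H> = "{h. h holomorphic_on ball 0 1 \<and> (\<forall>z\<in>ball 0 1. norm (h z) \<le> 1)}"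
  have rng: "range H \<subseteq> ?\<H>"
    using H(1,3) by blast
  have bdd: "\<exists>B. \<forall>h\<in>?\<H>. \<forall>z\<in>K. norm (h z) \<le> B" if "K \<subseteq> ball 0 1" for K
    using that by blast
  obtain L r where L: "L holomorphic_on ball 0 1" and r: "strict_mono (r :: nat \<Rightarrow> nat)"
    and lim: "\<And>t. t \<in> ball 0 1 \<Longrightarrow> (\<lambda>n. H (r n) t) \<longlonglongrightarrow> L t"
    and ulim: "\<And>K. compact K \<Longrightarrow> K \<subseteq> ball 0 1 \<Longrightarrow> uniform_limit K (H \<circ> r) L sequentially"
    by (rule Montel[OF open_ball _ bdd rng]) blast+
  define l where "l t = norm (L t) * norm (zero_at p \<phi> t)" for t
  have liml: "(\<lambda>n. w' (r n) (\<phi> t)) \<longlonglongrightarrow> l t" if "t \<in> ball 0 1" for t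
    unfolding l_def H(4)[OF that] by (intro tendsto_mult tendsto_norm lim that tendsto_const)
  have l_le: "l t \<le> green p (\<phi> t)" if "t \<in> ball 0 1" for t
  proof (rule LIMSEQ_le_const2[OF liml[OF that]])
    show "\<exists>N. \<forall>n\<ge>N. w' (r n) (\<phi> t) \<le> green p (\<phi> t)"
      using green_upper[OF w'(1)] inS[of t] that by auto
  qed
  have dense: "green p (\<phi> (d i)) \<le> l (d i)" for i
  proof (rule field_le_epsilon)
    fix e :: real assume "e > 0"
    then obtain N where N: "1 / Suc N < e"
      using nat_approx_posE by blast
    have di: "d i \<in> ball 0 1" "\<phi> (d i) \<in> S"
      using d1[of i] inS[of "d i"] by auto
    have "green p (\<phi> (d i)) - e \<le> w' (r n) (\<phi> (d i))" if n: "n \<ge> max N (Suc i)" for n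
    proof -
      have "max N (Suc i) \<le> r n"
        using n seq_suble[OF r, of n] by linarith
      then have "i < r n" "1 / Suc (r n) \<le> 1 / Suc N"
        by (auto intro: frac_le)
      then show ?thesis
        using w(3)[of i "r n"] w'(2)[OF di(2), of "r n"] N by linarith
    qed
    then have "green p (\<phi> (d i)) - e \<le> l (d i)"
      by (intro LIMSEQ_le_const[OF liml[OF di(1)]]) blast
    then show "green p (\<phi> (d i)) \<le> l (d i) + e"
      by simp
  qed
  have l_ge: "green p (\<phi> t) \<le> l t" if t: "t \<in> ball 0 1" for t
  proof (rule ccontr)
    assume "\<not> green p (\<phi> t) \<le> l t"
    then obtain u where u: "u \<in> perron p" "l t < u (\<phi> t)"
      using green_approx[OF p, of "l t" "\<phi> t"] by auto
    have "continuous_on (ball 0 1) \<phi>"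
      by (rule continuous_on_subset[OF chart_continuous[OF \<phi>A]]) auto
    then have "continuous_on (ball 0 1) (\<lambda>t. u (\<phi> t))"
      by (rule continuous_on_compose2[of S u, rotated]) (use u(1) inS in \<open>auto simp: perron_def\<close>)
    moreover have "continuous_on (ball 0 1) l"
      unfolding l_def using holomorphic_on_imp_continuous_on[OF L]
        holomorphic_on_imp_continuous_on[OF zero_at_holomorphic[of p \<phi>]]
      by (intro continuous_intros)
    ultimately have "open {s \<in> ball 0 1. l s < u (\<phi> s)}"
      using continuous_open_preimage[OF continuous_on_diff, of "ball 0 1" "\<lambda>t. u (\<phi> t)" l "{0<..}"]
      by (simp add: Int_def vimage_def)
    moreover have "t \<in> closure D"
      using D(3) t by blast
    ultimately obtain s where "s \<in> D" "l s < u (\<phi> s)" "s \<in> ball 0 1"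
      using u(2) t open_Int_closure_eq_empty[of "{s \<in> ball 0 1. l s < u (\<phi> s)}" D] by blast
    moreover from this obtain i where "d i = s"
      using d_surj by blast
    ultimately show False
      using dense[of i] green_upper[OF u(1), of "\<phi> s"] inS[of s] by auto
  qed
  have eq: "green p (\<phi> t) = norm (L t) * norm (zero_at p \<phi> t)" if "t \<in> ball 0 1" for t
    using l_ge[OF that] l_le[OF that] unfolding l_def by simp
  \<comment> \<open>By Hurwitz a nonconstant limit of zero-free functions is zero-free. A constant
    limit is tested at \<open>1 / 2\<close>: this is neither the centre nor sent to
    \<open>p\<close>, so \<open>green p\<close> is positive there.\<close>
  have nz: "L t \<noteq> 0" if t: "t \<in> ball 0 1" for t
  proof (cases "L constant_on ball 0 1")
    case True
    have "zero_at p \<phi> (1/2) \<noteq> 0"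
      by (simp add: zero_at_def)
    then have "\<phi> (1/2) \<noteq> p"
      using admissible_zero_at[OF \<phi>, of "1/2"] by (simp add: norm_divide)
    then have "0 < green p (\<phi> (1/2))"
      using green_pos[OF p] inS[of "1/2"] by (simp add: norm_divide)
    then have "L (1/2) \<noteq> 0"
      using eq[of "1/2"] by (auto simp: norm_divide)
    moreover have "L t = L (1/2)"
      using True t unfolding constant_on_def by (force simp: norm_divide)
    ultimately show ?thesis by simp
  next
    case False
    show ?thesis
    proof (rule Hurwitz_no_zeros[of "ball 0 1" "H \<circ> r" L])
      show "uniform_limit K (H \<circ> r) L sequentially" if "compact K" "K \<subseteq> ball 0 1" for K
        using ulim that .
    qed (use H L False t in auto)
  qed
  show thesis
    using that[OF L nz eq] .
qed

lemma green_self: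
  assumes "p \<in> S"
  shows "green p p = 0"
proof -
  obtain \<phi> where \<phi>: "admissible p \<phi>" "\<phi> 0 = p"
    using admissible_exists[OF assms openin_subtopology_self, of p] by metis
  show ?thesis
    by (rule green_local[OF assms \<phi>(1)]) (use \<phi>(2) in \<open>force simp: zero_at_def\<close>)
qed

lemma path_connected_neighbourhood:
  assumes "openin (top_of_set S) N" "z \<in> N"
  shows "\<exists>V. openin (top_of_set S) V \<and> z \<in> V \<and> V \<subseteq> N \<and> path_connected V"
proof -
  obtain \<phi> where \<phi>: "\<phi> \<in> atlas" "\<phi> 0 = z" "\<phi> ` ball 0 2 \<subseteq> N"
    using chart_exists[OF assms] by blast
  have "path_connected (\<phi> ` ball 0 2)"
    using chart_continuous[OF \<phi>(1)] by (intro path_connected_continuous_image convex_imp_path_connected) auto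
  moreover have "z \<in> \<phi> ` ball 0 2"
    using \<phi>(2) by force
  ultimately show ?thesis
    using chart_openin[OF \<phi>(1)] \<phi>(3) by blast
qed

text \<open>\<open>green p\<close> is locally the modulus of a holomorphic function, unique up to a unimodular factor;
  simple connectivity removes the ambiguity.\<close>

theorem green_function:
  assumes p: "p \<in> S"
  obtains F where "hol F" "\<And>z. z \<in> S \<Longrightarrow> norm (F z) = green p z"
proof -
  define I where "I = {\<phi>. admissible p \<phi>}"
  define U where "U \<phi> = \<phi> ` ball 0 1" for \<phi> :: "complex \<Rightarrow> 'a"
  have "\<exists>L. L holomorphic_on ball 0 1 \<and> (\<forall>t\<in>ball 0 1. norm (L t) = green p (\<phi> t))"
    if \<phi>: "admissible p \<phi>" for \<phi>
  proof -
    obtain H where H: "H holomorphic_on ball 0 1"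
      "\<And>t. t \<in> ball 0 1 \<Longrightarrow> green p (\<phi> t) = norm (H t) * norm (zero_at p \<phi> t)"
      using green_local[OF p \<phi>] by metis
    have "(\<lambda>t. H t * zero_at p \<phi> t) holomorphic_on ball 0 1"
      using H(1) zero_at_holomorphic[of p \<phi>] by (intro holomorphic_intros)
    then show ?thesis
      using H(2) by (intro exI[of _ "\<lambda>t. H t * zero_at p \<phi> t"]) (simp add: norm_mult)
  qed
  then obtain L where L: "\<And>\<phi>. admissible p \<phi> \<Longrightarrow> L \<phi> holomorphic_on ball 0 1"
    "\<And>\<phi> t. admissible p \<phi> \<Longrightarrow> t \<in> ball 0 1 \<Longrightarrow> norm (L \<phi> t) = green p (\<phi> t)"
    by metis
  define f where "f \<phi> z = L \<phi> (coord \<phi> z)" for \<phi> z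
  have coordU: "coord \<phi> z \<in> ball 0 1" "\<phi> (coord \<phi> z) = z" if "\<phi> \<in> I" "z \<in> U \<phi>" for \<phi> z
    using that coord_chart[of \<phi>] unfolding I_def U_def admissible_def by auto
  have norm_f: "norm (f \<phi> z) = green p z" if "\<phi> \<in> I" "z \<in> U \<phi>" for \<phi> z
    using L(2)[of \<phi> "coord \<phi> z"] coordU[OF that] that(1) unfolding f_def I_def by simp
  have openU: "openin (top_of_set S) (U \<phi>)" if "\<phi> \<in> I" for \<phi>
    using that chart_ball_openin[of \<phi> 1] unfolding U_def I_def admissible_def by simp
  have f_chart: "(f \<phi> \<circ> k) holomorphic_on ball 0 2"
    if "\<phi> \<in> I" "k \<in> atlas" "k ` ball 0 2 \<subseteq> U \<phi>" for \<phi> k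
  proof -
    have \<phi>: "\<phi> \<in> atlas" "admissible p \<phi>"
      using that(1) admissible_atlas unfolding I_def by auto
    have "(f \<phi> \<circ> \<phi>) holomorphic_on ball 0 1"
      using L(1)[OF \<phi>(2)] by (rule holomorphic_transform) (simp add: f_def coord_chart[OF \<phi>(1)])
    then have "(f \<phi> \<circ> k) holomorphic_on (ball 0 2 \<inter> k -` (\<phi> ` ball 0 1))"
      by (intro holomorphic_change_chart[OF that(2) \<phi>(1)]) auto
    then show ?thesis
      by (rule holomorphic_on_subset) (use that(3) in \<open>auto simp: U_def\<close>)
  qed
  \<comment> \<open>The factor is attached to the germ at \<open>z\<close>, because different
    components of an overlap may require different factors.\<close>
  define R where "R \<phi> \<psi> z c \<longleftrightarrow> norm c = 1 \<and> (\<exists>N. openin (top_of_set S) N \<and> z \<in> N \<and> N \<subseteq> U \<phi> \<inter> U \<psi> \<and>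
    (\<forall>w\<in>N. f \<phi> w = c * f \<psi> w))" for \<phi> \<psi> z c
  define c where "c \<phi> \<psi> z = (SOME c. R \<phi> \<psi> z c)" for \<phi> \<psi> z
  have ex: "\<exists>c. R \<phi> \<psi> z c" if "\<phi> \<in> I" "\<psi> \<in> I" "z \<in> U \<phi>" "z \<in> U \<psi>" for \<phi> \<psi> z
  proof -
    have "openin (top_of_set S) (U \<phi> \<inter> U \<psi>)"
      using openU that by blast
    then obtain k where k: "k \<in> atlas" "k 0 = z" "k ` ball 0 2 \<subseteq> U \<phi> \<inter> U \<psi>"
      using chart_exists[of "U \<phi> \<inter> U \<psi>" z] \<open>z \<in> U \<phi>\<close> \<open>z \<in> U \<psi>\<close> by blast
    obtain a where a: "norm a = 1" "\<And>t. t \<in> ball 0 2 \<Longrightarrow> (f \<phi> \<circ> k) t = a * (f \<psi> \<circ> k) t"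
    proof (rule norm_eq_imp_unimodular_multiple[of "f \<phi> \<circ> k" "ball 0 2" "f \<psi> \<circ> k"])
      show "(f \<phi> \<circ> k) holomorphic_on ball 0 2" "(f \<psi> \<circ> k) holomorphic_on ball 0 2"
        using f_chart[OF \<open>\<phi> \<in> I\<close> k(1)] f_chart[OF \<open>\<psi> \<in> I\<close> k(1)] k(3) by blast+
      show "norm ((f \<phi> \<circ> k) t) = norm ((f \<psi> \<circ> k) t)" if "t \<in> ball 0 2" for t
      proof -
        have "k t \<in> U \<phi>" "k t \<in> U \<psi>"
          using k(3) that by blast+
        then show ?thesis
          using norm_f \<open>\<phi> \<in> I\<close> \<open>\<psi> \<in> I\<close> by simp
      qed
    qed auto
    have "\<forall>w\<in>k ` ball 0 2. f \<phi> w = a * f \<psi> w"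
      using a(2) by auto
    moreover have "z \<in> k ` ball 0 2"
      using k(2) by force
    ultimately show ?thesis
      unfolding R_def using a(1) k(3) chart_openin[OF k(1)] by blast
  qed
  have Rc: "R \<phi> \<psi> z (c \<phi> \<psi> z)" if "\<phi> \<in> I" "\<psi> \<in> I" "z \<in> U \<phi>" "z \<in> U \<psi>" for \<phi> \<psi> z
    unfolding c_def using ex[OF that] by (rule someI_ex)
  \<comment> \<open>A germ determines its factor although \<open>f \<psi>\<close> vanishes at
    \<open>p\<close>: every nonempty relatively open set contains the two distinct points
    \<open>k 0\<close> and \<open>k 1\<close> of a chart, and one of them differs from
    \<open>p\<close>.\<close>
  have unique: "a = b" if N: "openin (top_of_set S) N" "z \<in> N" "N \<subseteq> U \<psi>"
    and ab: "\<And>w. w \<in> N \<Longrightarrow> a * f \<psi> w = b * f \<psi> w" and \<psi>: "\<psi> \<in> I" for a b \<psi> N z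
  proof -
    obtain k where k: "k \<in> atlas" "k 0 = z" "k ` ball 0 2 \<subseteq> N"
      using chart_exists[OF N(1,2)] by blast
    have "k 0 \<noteq> k 1"
      using chart_eq_iff[OF k(1), of 0 1] by simp
    moreover have "k 0 \<in> N" "k 1 \<in> N"
      using k(3) by auto
    ultimately obtain w where w: "w \<in> N" "w \<noteq> p"
      by metis
    have "w \<in> S"
      using w(1) openin_imp_subset[OF N(1)] by blast
    then have "norm (f \<psi> w) \<noteq> 0"
      using norm_f[OF \<psi>, of w] green_pos[OF p _ w(2)] N(3) w(1) by auto
    then show ?thesis
      using ab[OF w(1)] by simp
  qed
  interpret unimodular_cocycle S I U c
  proof
    show "openin (top_of_set S) (U \<phi>)" if "\<phi> \<in> I" for \<phi>
      using openU that .
  next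
    fix z assume "z \<in> S"
    then obtain \<phi> where "admissible p \<phi>" "\<phi> 0 = z"
      using admissible_exists[of z S p] by auto
    then show "\<exists>\<phi>\<in>I. z \<in> U \<phi>"
      unfolding I_def U_def by force
  next
    show "norm (c \<phi> \<psi> z) = 1" if "\<phi> \<in> I" "\<psi> \<in> I" "z \<in> U \<phi>" "z \<in> U \<psi>" for \<phi> \<psi> z
      using Rc[OF that] unfolding R_def by blast
  next
    fix \<phi> \<psi> \<theta> z assume *: "\<phi> \<in> I" "\<psi> \<in> I" "\<theta> \<in> I" "z \<in> U \<phi>" "z \<in> U \<psi>" "z \<in> U \<theta>"
    obtain N1 where N1: "openin (top_of_set S) N1" "z \<in> N1" "N1 \<subseteq> U \<phi> \<inter> U \<psi>" "\<forall>w\<in>N1. f \<phi> w = c \<phi> \<psi> z * f \<psi> w"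
      using Rc[OF *(1,2,4,5)] unfolding R_def by blast
    obtain N2 where N2: "openin (top_of_set S) N2" "z \<in> N2" "N2 \<subseteq> U \<psi> \<inter> U \<theta>" "\<forall>w\<in>N2. f \<psi> w = c \<psi> \<theta> z * f \<theta> w"
      using Rc[OF *(2,3,5,6)] unfolding R_def by blast
    obtain N3 where N3: "openin (top_of_set S) N3" "z \<in> N3" "N3 \<subseteq> U \<phi> \<inter> U \<theta>" "\<forall>w\<in>N3. f \<phi> w = c \<phi> \<theta> z * f \<theta> w"
      using Rc[OF *(1,3,4,6)] unfolding R_def by blast
    show "c \<phi> \<psi> z * c \<psi> \<theta> z = c \<phi> \<theta> z"
    proof (rule unique[of "N1 \<inter> N2 \<inter> N3" z \<theta>])
      show "openin (top_of_set S) (N1 \<inter> N2 \<inter> N3)"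
        using N1(1) N2(1) N3(1) by blast
      show "c \<phi> \<psi> z * c \<psi> \<theta> z * f \<theta> w = c \<phi> \<theta> z * f \<theta> w" if "w \<in> N1 \<inter> N2 \<inter> N3" for w
        using N1(4) N2(4) N3(4) that by (metis IntD1 IntD2 mult.assoc)
    qed (use N1 N2 N3 * in blast)+
  next
    fix \<phi> \<psi> z assume *: "\<phi> \<in> I" "\<psi> \<in> I" "z \<in> U \<phi>" "z \<in> U \<psi>"
    obtain N where N: "openin (top_of_set S) N" "z \<in> N" "N \<subseteq> U \<phi> \<inter> U \<psi>" "\<forall>w\<in>N. f \<phi> w = c \<phi> \<psi> z * f \<psi> w"
      using Rc[OF *] unfolding R_def by blast
    have "c \<phi> \<psi> w = c \<phi> \<psi> z" if w: "w \<in> N" for w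
    proof -
      obtain N' where N': "openin (top_of_set S) N'" "w \<in> N'" "N' \<subseteq> U \<phi> \<inter> U \<psi>" "\<forall>v\<in>N'. f \<phi> v = c \<phi> \<psi> w * f \<psi> v"
        using Rc[OF *(1,2), of w] N(3) w unfolding R_def by blast
      show ?thesis
      proof (rule unique[of "N \<inter> N'" w \<psi>])
        show "openin (top_of_set S) (N \<inter> N')"
          using N(1) N'(1) by blast
        show "c \<phi> \<psi> w * f \<psi> v = c \<phi> \<psi> z * f \<psi> v" if "v \<in> N \<inter> N'" for v
          using N(4) N'(4) that by (metis IntD1 IntD2)
      qed (use N(3) N'(2) w *(2) in blast)+
    qed
    then show "\<exists>N. openin (top_of_set S) N \<and> z \<in> N \<and> N \<subseteq> U \<phi> \<inter> U \<psi> \<and> (\<forall>w\<in>N. c \<phi> \<psi> w = c \<phi> \<psi> z)"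
      using N(1-3) by blast
  qed
  obtain d where d: "\<And>\<phi> z. \<phi> \<in> I \<Longrightarrow> z \<in> U \<phi> \<Longrightarrow> norm (d \<phi> z) = 1"
    "\<And>\<phi> \<psi> z. \<phi> \<in> I \<Longrightarrow> \<psi> \<in> I \<Longrightarrow> z \<in> U \<phi> \<Longrightarrow> z \<in> U \<psi> \<Longrightarrow> d \<phi> z = c \<phi> \<psi> z * d \<psi> z"
    "\<And>\<phi> z. \<phi> \<in> I \<Longrightarrow> z \<in> U \<phi> \<Longrightarrow>
      \<exists>N. openin (top_of_set S) N \<and> z \<in> N \<and> N \<subseteq> U \<phi> \<and> (\<forall>w\<in>N. d \<phi> w = d \<phi> z)"
    by (rule coboundary[OF simply_connected_S path_connected_neighbourhood]) blast+
  \<comment> \<open>\<open>f\<close> and \<open>d\<close> change by the same factor \<open>c\<close>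
    when the index changes, so their quotient is globally defined; the index chosen by
    \<open>SOME\<close> is immaterial.\<close>
  define F where "F z = (let \<phi> = SOME \<phi>. \<phi> \<in> I \<and> z \<in> U \<phi> in f \<phi> z / d \<phi> z)" for z
  have F: "F z = f \<phi> z / d \<phi> z" if "\<phi> \<in> I" "z \<in> U \<phi>" for \<phi> z
  proof -
    define \<psi> where "\<psi> = (SOME \<phi>. \<phi> \<in> I \<and> z \<in> U \<phi>)"
    have \<psi>: "\<psi> \<in> I \<and> z \<in> U \<psi>"
      unfolding \<psi>_def by (rule someI[of _ \<phi>]) (use that in blast)
    have "f \<phi> z = c \<phi> \<psi> z * f \<psi> z"
      using Rc[of \<phi> \<psi> z] that \<psi> unfolding R_def by blast
    moreover have "d \<phi> z = c \<phi> \<psi> z * d \<psi> z"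
      using d(2) that \<psi> by blast
    moreover have "c \<phi> \<psi> z \<noteq> 0"
      using norm_c[of \<phi> \<psi> z] that \<psi> by auto
    ultimately show ?thesis
      unfolding F_def \<psi>_def[symmetric] Let_def by simp
  qed
  show thesis
  proof (rule that)
    show "norm (F z) = green p z" if z: "z \<in> S" for z
    proof -
      obtain \<phi> where \<phi>: "\<phi> \<in> I" "z \<in> U \<phi>"
        using cover[OF z] by blast
      then show ?thesis
        using F[OF \<phi>] d(1)[OF \<phi>] norm_f[OF \<phi>] by (simp add: norm_divide)
    qed
    show "hol F"
    proof (rule hol_localI)
      fix z assume "z \<in> S"
      then obtain \<phi> where \<phi>: "\<phi> \<in> I" "z \<in> U \<phi>"
        using cover by blast
      obtain N where N: "openin (top_of_set S) N" "z \<in> N" "N \<subseteq> U \<phi>" "\<forall>w\<in>N. d \<phi> w = d \<phi> z"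
        using d(3)[OF \<phi>] by blast
      obtain k where k: "k \<in> atlas" "k 0 = z" "k ` ball 0 2 \<subseteq> N"
        using chart_exists[OF N(1,2)] by blast
      have "d \<phi> z \<noteq> 0"
        using d(1)[OF \<phi>] by auto
      then have "(\<lambda>t. (f \<phi> \<circ> k) t / d \<phi> z) holomorphic_on ball 0 2"
        using f_chart[OF \<phi>(1) k(1)] k(3) N(3) by (intro holomorphic_intros) blast+
      then have "(F \<circ> k) holomorphic_on ball 0 2"
      proof (rule holomorphic_transform)
        fix t :: complex assume "t \<in> ball 0 2"
        then have "k t \<in> N"
          using k(3) by blast
        then show "(f \<phi> \<circ> k) t / d \<phi> z = (F \<circ> k) t"
          using F[OF \<phi>(1), of "k t"] N(3,4) by auto
      qed
      moreover have "z \<in> k ` ball 0 2"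
        using k(2) by force
      ultimately show "\<exists>\<psi>\<in>atlas. \<exists>A. open A \<and> A \<subseteq> ball 0 2 \<and> z \<in> \<psi> ` A \<and> (F \<circ> \<psi>) holomorphic_on A"
        using k(1) open_ball by blast
    qed
  qed
qed

end

section \<open>Uniformization\<close>

text \<open>The strong maximum principle for \<open>f / g\<close>. The denominator can vanish only
  at 0, the position of the pole of Green's function in a disc centred there; deleting that point
  leaves a connected set.\<close>

lemma norm_eq_of_norm_le:
  assumes f: "f holomorphic_on ball 0 1" and g: "g holomorphic_on ball 0 1"
    and le: "\<And>t. t \<in> ball 0 1 \<Longrightarrow> norm (f t) \<le> norm (g t)"
    and nz: "\<And>t. t \<in> ball 0 1 \<Longrightarrow> t \<noteq> 0 \<Longrightarrow> g t \<noteq> 0"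
    and a: "a \<in> ball 0 1" "g a \<noteq> 0" "norm (f a) = norm (g a)"
    and t: "t \<in> ball (0::complex) 1"
  shows "norm (f t) = norm (g t)"
proof (cases "g t = 0")
  case True
  then show ?thesis
    using le[OF t] by simp
next
  case False
  define W where "W = (if g 0 = 0 then ball 0 1 - {0} else ball (0::complex) 1)"
  have W: "open W" "connected W" "W \<subseteq> ball 0 1"
    unfolding W_def by (auto intro!: open_delete connected_open_delete)
  have gW: "g s \<noteq> 0" if "s \<in> W" for s
    using nz[of s] that unfolding W_def by (auto split: if_splits)
  have aW: "a \<in> W" and tW: "t \<in> W"
    using a False t unfolding W_def by auto
  have "(\<lambda>s. f s / g s) holomorphic_on W"
    using gW W(3) by (intro holomorphic_intros holomorphic_on_subset[OF f] holomorphic_on_subset[OF g])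
  moreover have na: "norm (f a / g a) = 1"
    using a by (simp add: norm_divide)
  moreover have "norm (f s / g s) \<le> 1" if "s \<in> W" for s
    using le[of s] gW[OF that] W(3) that by (auto simp: norm_divide divide_le_eq)
  ultimately have "(\<lambda>s. f s / g s) constant_on W"
    using maximum_modulus_principle[of "\<lambda>s. f s / g s" W W a] W(1,2) aW by simp
  then have "f t / g t = f a / g a"
    using aW tW unfolding constant_on_def by metis
  then have "norm (f t / g t) = 1"
    using na by simp
  then show ?thesis
    using False by (simp add: norm_divide)
qed

context riemann_surface
begin

text \<open>The set where the modulus equals 1 is closed, open by the maximum principle in charts,
  and does not contain \<open>p\<close>. The strict inequality is what makes the disc automorphism
  applicable to \<open>F\<close>.\<close>

lemma hol_norm_less_1:
  assumes F: "hol F" "\<And>z. z \<in> S \<Longrightarrow> norm (F z) \<le> 1" and p: "p \<in> S" "F p = 0" and "z \<in> S"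
  shows "norm (F z) < 1"
proof -
  define A where "A = {z \<in> S. norm (F z) = 1}"
  have "closedin (top_of_set S) A"
    unfolding A_def using hol_continuous[OF F(1)]
    by (intro continuous_closedin_preimage_constant continuous_intros)
  moreover have "openin (top_of_set S) A"
  proof (subst openin_subopen, intro ballI)
    fix q assume q: "q \<in> A"
    then obtain \<phi> where \<phi>: "\<phi> \<in> atlas" "\<phi> 0 = q"
      using chart_exists[of S q] unfolding A_def by auto
    have Fq: "norm ((F \<circ> \<phi>) 0) = 1"
      using q \<phi>(2) unfolding A_def by simp
    have "(F \<circ> \<phi>) constant_on ball 0 2"
    proof (rule maximum_modulus_principle[of _ _ "ball 0 2" 0])
      show "norm ((F \<circ> \<phi>) t) \<le> norm ((F \<circ> \<phi>) 0)" if "t \<in> ball 0 2" for t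
        using F(2)[OF chart_in_S[OF \<phi>(1), of t]] that unfolding Fq by simp
    qed (use F(1) \<phi>(1) in \<open>auto simp: hol_def\<close>)
    then obtain b where b: "\<And>t. t \<in> ball 0 2 \<Longrightarrow> F (\<phi> t) = b"
      unfolding constant_on_def by auto
    have "norm b = 1"
      using b[of 0] Fq by simp
    then have "\<phi> ` ball 0 2 \<subseteq> A"
      using b chart_in_S[OF \<phi>(1)] unfolding A_def by auto
    moreover have "q \<in> \<phi> ` ball 0 2"
      using \<phi>(2) by force
    ultimately show "\<exists>T. openin (top_of_set S) T \<and> q \<in> T \<and> T \<subseteq> A"
      using chart_openin[OF \<phi>(1)] by blast
  qed
  ultimately have "A = {} \<or> A = S"
    using connected_S unfolding connected_clopen by blast
  moreover have "p \<notin> A"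
    using p(2) by (simp add: A_def)
  ultimately have "z \<notin> A"
    using p(1) by blast
  then show ?thesis
    using F(2)[OF \<open>z \<in> S\<close>] \<open>z \<in> S\<close> by (simp add: A_def)
qed

lemma hol_injective_open_map:
  assumes F: "hol F" "inj_on F S" and N: "openin (top_of_set S) N"
  shows "open (F ` N)"
proof (subst open_subopen, intro ballI)
  fix v assume "v \<in> F ` N"
  then obtain z where z: "z \<in> N" "v = F z"
    by blast
  obtain \<phi> where \<phi>: "\<phi> \<in> atlas" "\<phi> 0 = z" "\<phi> ` ball 0 2 \<subseteq> N"
    using chart_exists[OF N z(1)] by blast
  have "inj_on (F \<circ> \<phi>) (ball 0 2)"
    using comp_inj_on[OF chart_inj[OF \<phi>(1)] inj_on_subset[OF F(2) chart_subset[OF \<phi>(1)]]] .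
  then have "open ((F \<circ> \<phi>) ` ball 0 2)"
    using F(1) \<phi>(1) by (intro open_mapping_thm3) (auto simp: hol_def)
  moreover have "v \<in> (F \<circ> \<phi>) ` ball 0 2"
    using z(2) \<phi>(2) by force
  moreover have "(F \<circ> \<phi>) ` ball 0 2 \<subseteq> F ` N"
    using \<phi>(3) by (auto simp: image_comp[symmetric])
  ultimately show "\<exists>T. open T \<and> v \<in> T \<and> T \<subseteq> F ` N"
    by blast
qed

lemma hol_inverse_holomorphic:
  assumes F: "hol F" "inj_on F S" and h: "hol h"
  shows "(h \<circ> inv_into S F) holomorphic_on F ` S"
proof (rule holomorphic_on_locally)
  fix v assume "v \<in> F ` S"
  then obtain z where z: "z \<in> S" "v = F z"
    by blast
  obtain \<phi> where \<phi>: "\<phi> \<in> atlas" "\<phi> 0 = z"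
    using chart_exists[of S z] z(1) by auto
  have "inj_on (F \<circ> \<phi>) (ball 0 2)"
    using comp_inj_on[OF chart_inj[OF \<phi>(1)] inj_on_subset[OF F(2) chart_subset[OF \<phi>(1)]]] .
  moreover have "(F \<circ> \<phi>) holomorphic_on ball 0 2"
    using F(1) \<phi>(1) by (simp add: hol_def)
  ultimately obtain g where g: "g holomorphic_on (F \<circ> \<phi>) ` ball 0 2"
    "\<And>t. t \<in> ball 0 2 \<Longrightarrow> g ((F \<circ> \<phi>) t) = t" and "open ((F \<circ> \<phi>) ` ball 0 2)"
    using holomorphic_has_inverse[of "F \<circ> \<phi>" "ball 0 2"] open_mapping_thm3[of "F \<circ> \<phi>" "ball 0 2"]
    by (metis open_ball)
  have "((h \<circ> \<phi>) \<circ> g) holomorphic_on (F \<circ> \<phi>) ` ball 0 2"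
    by (rule holomorphic_on_compose_gen[OF g(1)]) (use h \<phi>(1) g(2) in \<open>auto simp: hol_def\<close>)
  then have "(h \<circ> inv_into S F) holomorphic_on (F \<circ> \<phi>) ` ball 0 2"
  proof (rule holomorphic_transform)
    fix u assume "u \<in> (F \<circ> \<phi>) ` ball 0 2"
    then obtain t where t: "t \<in> ball 0 2" "u = F (\<phi> t)"
      by auto
    then show "((h \<circ> \<phi>) \<circ> g) u = (h \<circ> inv_into S F) u"
      using g(2)[OF t(1)] inv_into_f_f[OF F(2), of "\<phi> t"] chart_in_S[OF \<phi>(1), of t] by simp
  qed
  moreover have "v \<in> (F \<circ> \<phi>) ` ball 0 2"
    using z(2) \<phi>(2) by force
  ultimately show "\<exists>U. open U \<and> v \<in> U \<and> (h \<circ> inv_into S F) holomorphic_on U"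
    using \<open>open ((F \<circ> \<phi>) ` ball 0 2)\<close> by blast
qed

end

section \<open>Symmetry of Green's function and injectivity of its holomorphic counterpart\<close>

context hyperbolic_surface
begin

lemma hol_le_green:
  assumes "hol h" "\<And>z. z \<in> S \<Longrightarrow> norm (h z) \<le> 1" "h p = 0" "z \<in> S"
  shows "norm (h z) \<le> green p z"
  using green_upper[OF perron_norm_hol[OF assms(1,3,2)] assms(4)] by simp

text \<open>Since \<open>F p = 0\<close>, the automorphism sends it to a point of modulus
  \<open>norm (F q)\<close>, which is \<open>green p q\<close>. Vanishing is recorded on the whole
  fibre of \<open>F\<close> through \<open>q\<close>, because this clause decides
  injectivity.\<close>

lemma green_function_moebius:
  assumes p: "p \<in> S" and F: "hol F" "\<And>z. z \<in> S \<Longrightarrow> norm (F z) = green p z" and q: "q \<in> S"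
  defines "h \<equiv> \<lambda>z. Moebius_function 0 (F q) (F z)"
  shows "hol h" "\<And>z. z \<in> S \<Longrightarrow> norm (h z) \<le> green q z" "norm (h p) = green p q"
    "\<And>z. F z = F q \<Longrightarrow> h z = 0"
proof -
  have Fp: "F p = 0"
    using F(2)[OF p] green_self[OF p] by simp
  have F1: "norm (F z) < 1" if "z \<in> S" for z
    by (rule hol_norm_less_1[OF F(1) _ p Fp that]) (use F(2) green_le_1[OF p] in simp)
  have "Moebius_function 0 (F q) \<circ> (F \<circ> \<phi>) holomorphic_on ball 0 2" if "\<phi> \<in> atlas" for \<phi>
  proof (rule holomorphic_on_compose_gen)
    show "(F \<circ> \<phi>) holomorphic_on ball 0 2"
      using F(1) that by (simp add: hol_def)
    show "Moebius_function 0 (F q) holomorphic_on ball 0 1"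
      by (rule Moebius_function_holomorphic[OF F1[OF q]])
    show "(F \<circ> \<phi>) ` ball 0 2 \<subseteq> ball 0 1"
      using F1 chart_in_S[OF that] by auto
  qed
  then show h: "hol h"
    by (simp add: hol_def h_def o_def)
  show z0: "h z = 0" if "F z = F q" for z
    using that by (simp add: h_def Moebius_function_eq_zero)
  show "norm (h z) \<le> green q z" if "z \<in> S" for z
  proof (rule hol_le_green[OF h _ z0 that])
    show "norm (h z) \<le> 1" if "z \<in> S" for z
      using Moebius_function_norm_lt_1[OF F1[OF q] F1[OF that], of 0] by (simp add: h_def)
  qed simp
  show "norm (h p) = green p q"
    using Fp F(2)[OF q] by (simp add: h_def Moebius_function_def)
qed

lemma green_symmetric:
  assumes "p \<in> S" "q \<in> S"
  shows "green p q = green q p"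
proof -
  have le: "green p q \<le> green q p" if pq: "p \<in> S" "q \<in> S" for p q
  proof -
    obtain F where "hol F" "\<And>z. z \<in> S \<Longrightarrow> norm (F z) = green p z"
      using green_function[OF pq(1)] by metis
    from green_function_moebius(2,3)[OF pq(1) this pq(2)] show ?thesis
      using pq(1) by metis
  qed
  show ?thesis
    using le[OF assms] le[OF assms(2,1)] by simp
qed

lemma green_function_inj:
  assumes p: "p \<in> S" and F: "hol F" "\<And>z. z \<in> S \<Longrightarrow> norm (F z) = green p z"
  shows "inj_on F S"
proof (rule inj_onI)
  fix z q assume z: "z \<in> S" and q: "q \<in> S" and eq: "F z = F q"
  show "z = q"
  proof (cases "q = p")
    case True
    then have "green p z = 0"
      using F(2)[OF z] F(2)[OF q] green_self[OF p] eq by simp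
    then show ?thesis
      using green_pos[OF p z] True by fastforce
  next
    case False
    \<comment> \<open>By symmetry \<open>norm (h z)\<close> attains its upper bound \<open>green q z\<close> at \<open>p\<close>, hence everywhere.\<close>
    define h where "h z = Moebius_function 0 (F q) (F z)" for z
    have h: "hol h" "\<And>z. z \<in> S \<Longrightarrow> norm (h z) \<le> green q z" "norm (h p) = green p q"
      "\<And>z. F z = F q \<Longrightarrow> h z = 0"
      using green_function_moebius[OF p F(1) _ q] F(2) unfolding h_def by blast+
    obtain Fq where Fq: "hol Fq" "\<And>z. z \<in> S \<Longrightarrow> norm (Fq z) = green q z"
      using green_function[OF q] by metis
    \<comment> \<open>In a disc admissible for \<open>q\<close>, \<open>Fq\<close> can vanish only
      at the centre, as \<open>norm_eq_of_norm_le\<close> requires. Equality at one point other than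
      \<open>q\<close> then fills the disc.\<close>
    have disc: "norm (h (\<phi> t)) = green q (\<phi> t)"
      if \<phi>: "admissible q \<phi>" and a: "a \<in> ball 0 1" "\<phi> a \<noteq> q" "norm (h (\<phi> a)) = green q (\<phi> a)"
        and t: "t \<in> ball 0 1" for \<phi> a t
    proof -
      note \<phi>A = admissible_atlas[OF \<phi>]
      have inS: "\<phi> s \<in> S" if "s \<in> ball 0 1" for s
        using chart_in_S[OF \<phi>A, of s] that by simp
      have b12: "ball 0 1 \<subseteq> ball (0::complex) 2"
        by auto
      have "norm ((h \<circ> \<phi>) t) = norm ((Fq \<circ> \<phi>) t)"
      proof (rule norm_eq_of_norm_le[OF _ _ _ _ a(1) _ _ t])
        show "(h \<circ> \<phi>) holomorphic_on ball 0 1" "(Fq \<circ> \<phi>) holomorphic_on ball 0 1"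
          using h(1) Fq(1) \<phi>A b12 unfolding hol_def by (blast intro: holomorphic_on_subset)+
        show "norm ((h \<circ> \<phi>) s) \<le> norm ((Fq \<circ> \<phi>) s)" if "s \<in> ball 0 1" for s
          using h(2) Fq(2) inS[OF that] by simp
        have nz: "Fq (\<phi> s) \<noteq> 0" if "s \<in> ball 0 1" "\<phi> s \<noteq> q" for s
          using Fq(2)[OF inS[OF that(1)]] green_pos[OF q inS[OF that(1)] that(2)] by auto
        show "(Fq \<circ> \<phi>) s \<noteq> 0" if "s \<in> ball 0 1" "s \<noteq> 0" for s
        proof -
          have "zero_at q \<phi> s \<noteq> 0"
            using that(2) by (simp add: zero_at_def)
          then have "\<phi> s \<noteq> q"
            using admissible_zero_at[OF \<phi>, of s] that(1) by simp
          then show ?thesis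
            using nz[OF that(1)] by simp
        qed
        show "(Fq \<circ> \<phi>) a \<noteq> 0"
          using nz[OF a(1,2)] by simp
        show "norm ((h \<circ> \<phi>) a) = norm ((Fq \<circ> \<phi>) a)"
          using a(3) Fq(2)[OF inS[OF a(1)]] by simp
      qed
      then show ?thesis
        using Fq(2)[OF inS[OF t]] by simp
    qed
    define A where "A = {z \<in> S. \<exists>N. openin (top_of_set S) N \<and> z \<in> N \<and> (\<forall>w\<in>N. norm (h w) = green q w)}"
    have AI: "v \<in> A"
      if \<phi>: "admissible q \<phi>" "\<phi> 0 = v" and a: "a \<in> ball 0 1" "\<phi> a \<noteq> q" "norm (h (\<phi> a)) = green q (\<phi> a)" for v \<phi> a
    proof -
      note \<phi>A = admissible_atlas[OF \<phi>(1)]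
      have "openin (top_of_set S) (\<phi> ` ball 0 1)"
        by (rule chart_ball_openin[OF \<phi>A]) simp
      moreover have "v \<in> \<phi> ` ball 0 1"
        using \<phi>(2) by force
      moreover have "\<forall>w\<in>\<phi> ` ball 0 1. norm (h w) = green q w"
        using disc[OF \<phi>(1) a] by blast
      moreover have "v \<in> S"
        using chart_in_S[OF \<phi>A, of 0] \<phi>(2) by simp
      ultimately show ?thesis
        unfolding A_def by blast
    qed
    have "openin (top_of_set S) A"
    proof (subst openin_subopen, intro ballI)
      fix v assume "v \<in> A"
      then obtain N where N: "openin (top_of_set S) N" "v \<in> N" "\<forall>w\<in>N. norm (h w) = green q w"
        unfolding A_def by blast
      then have "N \<subseteq> A"
        using openin_imp_subset[OF N(1)] unfolding A_def by blast
      then show "\<exists>T. openin (top_of_set S) T \<and> v \<in> T \<and> T \<subseteq> A"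
        using N(1,2) by blast
    qed
    moreover have "openin (top_of_set S) (S - A)"
    proof (subst openin_subopen, intro ballI)
      fix v assume v: "v \<in> S - A"
      then obtain \<phi> where \<phi>: "admissible q \<phi>" "\<phi> 0 = v"
        using admissible_exists[of v S q] by auto
      note \<phi>A = admissible_atlas[OF \<phi>(1)]
      have op: "openin (top_of_set S) (\<phi> ` ball 0 1)"
        by (rule chart_ball_openin[OF \<phi>A]) simp
      \<comment> \<open>If the disc met \<open>A\<close>, equality would hold on an open subset of
        it and spread to \<open>v\<close>. The starting point must not be \<open>q\<close>, where
        both sides vanish and carry no information; a small chart \<open>\<omega>\<close> offers two
        points to choose from.\<close>
      have "w \<notin> A" if w: "w \<in> \<phi> ` ball 0 1" for w
      proof
        assume "w \<in> A"
        then obtain N where N: "openin (top_of_set S) N" "w \<in> N" "\<forall>w\<in>N. norm (h w) = green q w"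
          unfolding A_def by blast
        obtain \<omega> where \<omega>: "\<omega> \<in> atlas" "\<omega> ` ball 0 2 \<subseteq> N \<inter> \<phi> ` ball 0 1"
          using chart_exists[OF openin_Int[OF N(1) op], of w] N(2) w by blast
        have "\<omega> 0 \<noteq> \<omega> 1"
          using chart_eq_iff[OF \<omega>(1), of 0 1] by simp
        moreover have "\<omega> 0 \<in> N \<inter> \<phi> ` ball 0 1" "\<omega> 1 \<in> N \<inter> \<phi> ` ball 0 1"
          using \<omega>(2) by auto
        ultimately obtain u where "u \<in> N" "u \<in> \<phi> ` ball 0 1" "u \<noteq> q"
          by (metis IntD1 IntD2)
        then obtain a where "a \<in> ball 0 1" "\<phi> a \<noteq> q" "\<phi> a \<in> N"
          by blast
        then have "v \<in> A"
          using AI[OF \<phi>] N(3) by blast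
        then show False
          using v by blast
      qed
      then have "\<phi> ` ball 0 1 \<subseteq> S - A"
        using openin_imp_subset[OF op] by blast
      moreover have "v \<in> \<phi> ` ball 0 1"
        using \<phi>(2) by force
      ultimately show "\<exists>T. openin (top_of_set S) T \<and> v \<in> T \<and> T \<subseteq> S - A"
        using op by blast
    qed
    then have "closedin (top_of_set S) A"
      by (simp add: closedin_def A_def)
    moreover have "p \<in> A"
    proof -
      obtain \<phi> where \<phi>: "admissible q \<phi>" "\<phi> 0 = p"
        using admissible_exists[OF p openin_subtopology_self, of q] by metis
      have "norm (h p) = green q p"
        using h(3) green_symmetric[OF p q] by simp
      then show ?thesis
        using AI[OF \<phi>, of 0] \<phi>(2) False by simp
    qed
    ultimately have "A = S"
      using connected_S unfolding connected_clopen by blast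
    then have "norm (h z) = green q z"
      using z unfolding A_def by blast
    moreover have "h z = 0"
      using h(4)[OF eq] .
    ultimately have "green q z = 0"
      by simp
    then show ?thesis
      using green_pos[OF q z] by fastforce
  qed
qed

text \<open>The image of the injective \<open>F\<close> is open, simply connected and bounded, hence
  a candidate for the Riemann mapping theorem. \<open>S\<close> lies in a real normed space only, so
  holomorphy of \<open>g\<close> is expressed by composing it with the functions in
  \<open>hol\<close>.\<close>

theorem biholomorphic_to_disc:
  assumes "S \<noteq> {}"
  obtains F g where "hol F" "F ` S = ball 0 1" "continuous_on (ball 0 1) g"
    "\<And>z. z \<in> S \<Longrightarrow> g (F z) = z" "\<And>w. w \<in> ball 0 1 \<Longrightarrow> g w \<in> S \<and> F (g w) = w"
    "\<And>h. hol h \<Longrightarrow> (h \<circ> g) holomorphic_on ball 0 1"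
proof -
  obtain p where p: "p \<in> S"
    using assms by blast
  obtain F where F: "hol F" "\<And>z. z \<in> S \<Longrightarrow> norm (F z) = green p z"
    using green_function[OF p] by metis
  have inj: "inj_on F S"
    using green_function_inj[OF p F] by blast
  define G where "G = inv_into S F"
  have GF: "G (F z) = z" if "z \<in> S" for z
    unfolding G_def using inv_into_f_f[OF inj that] .
  have FG: "G v \<in> S" "F (G v) = v" if "v \<in> F ` S" for v
    unfolding G_def using inv_into_into[OF that] f_inv_into_f[OF that] .
  have opFS: "open (F ` S)"
    by (rule hol_injective_open_map[OF F(1) inj]) simp
  have contG: "continuous_on (F ` S) G"
  proof (rule continuous_on_inverse_open_map[OF hol_continuous[OF F(1)] HOL.refl GF])
    show "openin (top_of_set (F ` S)) (F ` N)" if "openin (top_of_set S) N" for N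
      using hol_injective_open_map[OF F(1) inj that] openin_imp_subset[OF that]
      by (auto intro!: open_subset)
  qed
  have "homeomorphism S (F ` S) F G"
    using hol_continuous[OF F(1)] contG GF FG by (auto simp: homeomorphism_def image_iff)
  then have "simply_connected (F ` S)"
    using simply_connected_S homeomorphic_simply_connected unfolding homeomorphic_def by blast
  moreover have "F ` S \<noteq> UNIV"
  proof
    assume "F ` S = UNIV"
    then obtain z where z: "z \<in> S" "F z = 2"
      by (metis UNIV_I imageE)
    have "norm (F z) \<le> 1"
      using F(2)[OF z(1)] green_le_1[OF p z(1)] by simp
    then show False
      using z(2) by simp
  qed
  ultimately obtain f k where f: "f holomorphic_on F ` S" and k: "k holomorphic_on ball 0 1"
    and fk: "\<And>v. v \<in> F ` S \<Longrightarrow> f v \<in> ball 0 1 \<and> k (f v) = v"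
    and kf: "\<And>w. w \<in> ball 0 1 \<Longrightarrow> k w \<in> F ` S \<and> f (k w) = w"
    using Riemann_mapping_theorem[of "F ` S"] opFS p by blast
  show thesis
  proof (rule that[of "f \<circ> F" "G \<circ> k"])
    have "(f \<circ> (F \<circ> \<phi>)) holomorphic_on ball 0 2" if "\<phi> \<in> atlas" for \<phi>
      by (rule holomorphic_on_compose_gen[OF _ f])
        (use F(1) that chart_in_S[OF that] in \<open>auto simp: hol_def\<close>)
    then show "hol (f \<circ> F)"
      by (simp add: hol_def o_assoc)
    show "(f \<circ> F) ` S = ball 0 1"
    proof
      show "(f \<circ> F) ` S \<subseteq> ball 0 1"
        using fk by auto
      show "ball 0 1 \<subseteq> (f \<circ> F) ` S"
      proof
        fix w :: complex assume "w \<in> ball 0 1"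
        from kf[OF this] show "w \<in> (f \<circ> F) ` S"
          by (metis image_comp imageI)
      qed
    qed
    show "continuous_on (ball 0 1) (G \<circ> k)"
      by (intro continuous_on_compose holomorphic_on_imp_continuous_on[OF k] continuous_on_subset[OF contG])
        (use kf in blast)
    show "(G \<circ> k) ((f \<circ> F) z) = z" if "z \<in> S" for z
      using fk[of "F z"] GF[OF that] that by simp
    show "(G \<circ> k) w \<in> S \<and> (f \<circ> F) ((G \<circ> k) w) = w" if "w \<in> ball 0 1" for w
      using kf[OF that] FG[of "k w"] by simp
    show "(h \<circ> (G \<circ> k)) holomorphic_on ball 0 1" if "hol h" for h
    proof -
      have "((h \<circ> G) \<circ> k) holomorphic_on ball 0 1"
        by (rule holomorphic_on_compose_gen[OF k hol_inverse_holomorphic[OF F(1) inj that, folded G_def]])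
          (use kf in blast)
      then show ?thesis
        by (simp add: o_assoc)
    qed
  qed
qed

end

section \<open>Complex differentiability in complex normed spaces\<close>

lemma scaleC_zero_right [simp]: "c *\<^sub>C (0::'e::complex_normed_space) = 0"
  using scaleC_add_right[of c 0 "0::'e"] by simp

lemma scaleC_zero_left [simp]: "0 *\<^sub>C (x::'e::complex_normed_space) = 0"
  using norm_scaleC[of 0 x] by simp

lemma scaleC_vec_nth [simp]: "(c *\<^sub>C v) $ i = c * v $ i" for v :: "complex ^ 'n::finite"
  by (simp add: scaleC_vec_def scaleC_complex_def)

lemma bounded_linear_scaleC_left: "bounded_linear (\<lambda>c. c *\<^sub>C (v::'e::complex_normed_space))"
proof (rule bounded_linear_intro)
  show "(r *\<^sub>R c) *\<^sub>C v = r *\<^sub>R (c *\<^sub>C v)" for r c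
    by (simp add: scaleC_of_real[symmetric] scaleC_scaleC scaleC_complex_def scaleR_conv_of_real)
  show "norm (c *\<^sub>C v) \<le> norm c * norm v" for c
    by (simp add: norm_scaleC)
qed (rule scaleC_add_left)

lemma complex_differentiable_at_compose:
  assumes "complex_differentiable_at f x" "complex_differentiable_at g (f x)"
  shows "complex_differentiable_at (g \<circ> f) x"
proof -
  obtain D E where "(f has_derivative D) (at x)" "\<And>c v. D (c *\<^sub>C v) = c *\<^sub>C D v"
    "(g has_derivative E) (at (f x))" "\<And>c v. E (c *\<^sub>C v) = c *\<^sub>C E v"
    using assms unfolding complex_differentiable_at_def by blast
  then show ?thesis
    unfolding complex_differentiable_at_def
    by (intro exI[of _ "E \<circ> D"]) (auto intro: diff_chain_at)
qed

lemma complex_differentiable_at_transform: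
  assumes "complex_differentiable_at f x" "open U" "x \<in> U" "\<And>y. y \<in> U \<Longrightarrow> f y = g y"
  shows "complex_differentiable_at g x"
proof -
  obtain D where D: "(f has_derivative D) (at x)" "\<forall>c v. D (c *\<^sub>C v) = c *\<^sub>C D v"
    using assms(1) unfolding complex_differentiable_at_def by blast
  have "(g has_derivative D) (at x)"
    by (rule has_derivative_transform_within_open[OF D(1) assms(2-4)])
  then show ?thesis
    using D(2) unfolding complex_differentiable_at_def by blast
qed

lemma complex_differentiable_at_continuous:
  assumes "complex_differentiable_at f x"
  shows "continuous (at x) f"
  using assms has_derivative_continuous unfolding complex_differentiable_at_def by blast

lemma complex_differentiable_at_iff:
  "complex_differentiable_at f x \<longleftrightarrow> f field_differentiable at x" for f :: "complex \<Rightarrow> complex"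
proof
  assume "complex_differentiable_at f x"
  then obtain D where D: "(f has_derivative D) (at x)" "\<And>c v. D (c *\<^sub>C v) = c *\<^sub>C D v"
    unfolding complex_differentiable_at_def by blast
  have "D c = D 1 * c" for c
  proof -
    have "D (c * 1) = c * D 1"
      using D(2)[of c 1] unfolding scaleC_complex_def .
    then show ?thesis
      by (simp only: mult_1_right mult.commute[of c])
  qed
  then have "D = (*) (D 1)"
    by (rule ext)
  then show "f field_differentiable at x"
    using D(1) unfolding field_differentiable_def has_field_derivative_def by metis
next
  assume "f field_differentiable at x"
  then show "complex_differentiable_at f x"
    unfolding field_differentiable_def has_field_derivative_def complex_differentiable_at_def
    by (auto simp: scaleC_complex_def algebra_simps)
qed

lemma has_derivative_complex_line:
  "((\<lambda>t. p + t *\<^sub>C v) has_derivative (\<lambda>h. h *\<^sub>C v)) (at t)" for v :: "'e::complex_normed_space"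
  by (auto intro!: derivative_eq_intros bounded_linear.has_derivative[OF bounded_linear_scaleC_left])

lemma complex_differentiable_at_line:
  "complex_differentiable_at (\<lambda>t. p + t *\<^sub>C v) t" for v :: "'e::complex_normed_space"
  unfolding complex_differentiable_at_def using has_derivative_complex_line[of p v t]
  by (intro exI[of _ "\<lambda>h. h *\<^sub>C v"]) (auto simp: scaleC_scaleC scaleC_complex_def)

lemma complex_differentiable_at_vec_nth:
  "complex_differentiable_at (\<lambda>z. z $ i) (z :: complex ^ 'n::finite)"
  unfolding complex_differentiable_at_def
  by (intro exI[of _ "\<lambda>z. z $ i"])
    (auto simp: scaleC_complex_def intro: bounded_linear.has_derivative[OF bounded_linear_vec_nth])

lemma complex_differentiable_at_vec:
  fixes f :: "complex \<Rightarrow> complex ^ 'n::finite"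
  assumes "\<And>i. (\<lambda>t. f t $ i) field_differentiable at t"
  shows "complex_differentiable_at f t"
proof -
  have "\<exists>d. ((\<lambda>t. f t $ i) has_derivative (*) d) (at t)" for i
    using assms[of i] unfolding field_differentiable_def has_field_derivative_def .
  then obtain d where d: "\<And>i. ((\<lambda>t. f t $ i) has_derivative (*) (d i)) (at t)"
    by metis
  have "bounded_linear (\<lambda>c. axis i (c::complex) :: complex ^ 'n)" for i
    by (rule linear_conv_bounded_linear[THEN iffD1])
      (auto intro!: linearI simp: vec_eq_iff axis_def)
  then have "((\<lambda>t. \<Sum>i\<in>UNIV. axis i (f t $ i)) has_derivative (\<lambda>h. \<Sum>i\<in>UNIV. axis i (d i * h))) (at t)"
    by (intro has_derivative_sum bounded_linear.has_derivative[OF _ d])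
  moreover have "(\<Sum>i\<in>UNIV. axis i (f t $ i)) = f t" for t
    by (simp add: vec_eq_iff axis_def)
  moreover have "(\<Sum>i\<in>UNIV. axis i (d i * h)) = h *\<^sub>C (\<chi> i. d i)" for h
    by (simp add: vec_eq_iff axis_def mult.commute)
  ultimately have "(f has_derivative (\<lambda>h. h *\<^sub>C (\<chi> i. d i))) (at t)"
    by simp
  then show ?thesis
    unfolding complex_differentiable_at_def
    by (intro exI[of _ "\<lambda>h. h *\<^sub>C (\<chi> i. d i)"]) (auto simp: scaleC_scaleC scaleC_complex_def)
qed

lemma norm_vec_le_sum: "norm v \<le> (\<Sum>i\<in>UNIV. norm (v $ i))" for v :: "complex ^ 'n::finite"
  unfolding norm_vec_def by (rule L2_set_le_sum) simp

text \<open>Cauchy's estimate makes the derivative of \<open>f - D\<close> small near \<open>p\<close>; its continuity is not needed.\<close>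

lemma complex_strictly_differentiable:
  fixes f :: "'e::complex_normed_space \<Rightarrow> complex ^ 'm::finite"
  assumes U: "open U" "p \<in> U" and f: "\<And>z. z \<in> U \<Longrightarrow> complex_differentiable_at f z"
    and D: "(f has_derivative D) (at p)" "\<And>c v. D (c *\<^sub>C v) = c *\<^sub>C D v" and e: "e > 0"
  obtains \<delta> where "\<delta> > 0" "ball p \<delta> \<subseteq> U"
    "\<And>z z'. z \<in> ball p \<delta> \<Longrightarrow> z' \<in> ball p \<delta> \<Longrightarrow> norm (f z - f z' - D (z - z')) \<le> e * norm (z - z')"
proof -
  have "\<exists>E. (f has_derivative E) (at z) \<and> (\<forall>c v. E (c *\<^sub>C v) = c *\<^sub>C E v)" if "z \<in> U" for z
    using f[OF that] unfolding complex_differentiable_at_def .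
  then obtain E where E: "\<And>z. z \<in> U \<Longrightarrow> (f has_derivative E z) (at z)"
    "\<And>z c v. z \<in> U \<Longrightarrow> E z (c *\<^sub>C v) = c *\<^sub>C E z v"
    by metis
  have bD: "bounded_linear D"
    using D(1) has_derivative_bounded_linear by blast
  define h where "h z = f z - D z" for z
  have h_diff: "(h has_derivative (\<lambda>v. E z v - D v)) (at z)" if "z \<in> U" for z
    unfolding h_def using E(1)[OF that] bounded_linear_imp_has_derivative[OF bD] by (rule has_derivative_diff)
  \<comment> \<open>The 4 compensates the radius used in Cauchy's inequality, and
    \<open>CARD('m)\<close> the passage from single components to the norm of the vector.\<close>
  define \<epsilon> where "\<epsilon> = e / (4 * real CARD('m))"
  have \<epsilon>: "\<epsilon> > 0"
    using e by (simp add: \<epsilon>_def)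
  obtain d1 where d1: "d1 > 0" "\<And>z. norm (z - p) < d1 \<Longrightarrow> norm (f z - f p - D (z - p)) \<le> \<epsilon> * norm (z - p)"
    using D(1) \<epsilon> unfolding has_derivative_at_alt by blast
  obtain d2 where d2: "d2 > 0" "ball p d2 \<subseteq> U"
    using U open_contains_ball by metis
  define d where "d = min d1 d2"
  have d: "d > 0" "ball p d \<subseteq> U"
    using d1(1) d2 by (auto simp: d_def)
  have h_le: "norm (h z - h p) \<le> \<epsilon> * d" if "norm (z - p) < d" for z
  proof -
    have "norm (h z - h p) \<le> \<epsilon> * norm (z - p)"
      using d1(2)[of z] that by (simp add: h_def d_def bounded_linear.linear[OF bD, THEN linear_diff] algebra_simps)
    also have "\<dots> \<le> \<epsilon> * d"
      using that \<epsilon> by (intro mult_left_mono) auto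
    finally show ?thesis .
  qed
  have component: "norm ((E z v - D v) $ i) \<le> 4 * \<epsilon> * norm v" if z: "norm (z - p) < d / 2" for z v i
  proof (cases "v = 0")
    case True
    have "z \<in> U"
      using z d by (auto simp: dist_norm norm_minus_commute subset_iff)
    then have "E z v = 0" "D v = 0"
      using E(2)[of z 0 0] D(2)[of 0 0] True by (auto simp: vec_eq_iff)
    then show ?thesis
      using True by simp
  next
    case False
    \<comment> \<open>On the disc of this radius the complex line through \<open>z\<close> in
      direction \<open>v\<close> moves by at most \<open>d / 4\<close>, so it remains in
      \<open>ball p d\<close>. Cauchy's inequality then bounds the derivative by
      \<open>\<epsilon> * d / \<rho> = 4 * \<epsilon> * norm v\<close>.\<close>
    define \<rho> where "\<rho> = d / (4 * norm v)"
    have \<rho>: "\<rho> > 0"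
      using d(1) False by (simp add: \<rho>_def)
    have near: "norm (z + \<zeta> *\<^sub>C v - p) < d" if "\<zeta> \<in> cball 0 \<rho>" for \<zeta>
    proof -
      have "norm (\<zeta> *\<^sub>C v) \<le> \<rho> * norm v"
        using that by (simp add: norm_scaleC mult_right_mono)
      also have "\<dots> = d / 4"
        using False by (simp add: \<rho>_def)
      finally have "norm (z - p) + norm (\<zeta> *\<^sub>C v) < d"
        using z d(1) by simp
      moreover have "norm (z + \<zeta> *\<^sub>C v - p) \<le> norm (z - p) + norm (\<zeta> *\<^sub>C v)"
        using norm_triangle_ineq[of "z - p" "\<zeta> *\<^sub>C v"] by (simp add: algebra_simps)
      ultimately show ?thesis by simp
    qed
    define g where "g \<zeta> = (h (z + \<zeta> *\<^sub>C v) - h p) $ i" for \<zeta>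
    have g_deriv: "(g has_field_derivative (E (z + \<zeta> *\<^sub>C v) v - D v) $ i) (at \<zeta>)" if "\<zeta> \<in> cball 0 \<rho>" for \<zeta>
    proof -
      have inU: "z + \<zeta> *\<^sub>C v \<in> U"
        using near[OF that] d(2) by (auto simp: dist_norm norm_minus_commute subset_iff)
      from diff_chain_at[OF has_derivative_complex_line h_diff[OF inU]]
      have "((\<lambda>\<zeta>. h (z + \<zeta> *\<^sub>C v)) has_derivative (\<lambda>\<tau>. E (z + \<zeta> *\<^sub>C v) (\<tau> *\<^sub>C v) - D (\<tau> *\<^sub>C v))) (at \<zeta>)"
        by (simp add: o_def)
      then have "((\<lambda>\<zeta>. h (z + \<zeta> *\<^sub>C v) - h p) has_derivative (\<lambda>\<tau>. E (z + \<zeta> *\<^sub>C v) (\<tau> *\<^sub>C v) - D (\<tau> *\<^sub>C v))) (at \<zeta>)"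
        by (auto intro!: derivative_eq_intros)
      then have "(g has_derivative (\<lambda>\<tau>. (E (z + \<zeta> *\<^sub>C v) (\<tau> *\<^sub>C v) - D (\<tau> *\<^sub>C v)) $ i)) (at \<zeta>)"
        unfolding g_def by (rule bounded_linear.has_derivative[OF bounded_linear_vec_nth])
      moreover have "(\<lambda>\<tau>. (E (z + \<zeta> *\<^sub>C v) (\<tau> *\<^sub>C v) - D (\<tau> *\<^sub>C v)) $ i) = (*) ((E (z + \<zeta> *\<^sub>C v) v - D v) $ i)"
        using E(2)[OF inU] D(2) by (auto simp: fun_eq_iff algebra_simps)
      ultimately show ?thesis
        by (simp add: has_field_derivative_def)
    qed
    have "norm ((deriv ^^ 1) g 0) \<le> fact 1 * (\<epsilon> * d) / \<rho> ^ 1"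
    proof (rule Cauchy_inequality)
      show "g holomorphic_on ball 0 \<rho>"
        unfolding holomorphic_on_def field_differentiable_def
        using g_deriv has_field_derivative_at_within by (metis ball_subset_cball subsetD)
      show "continuous_on (cball 0 \<rho>) g"
        using g_deriv by (intro continuous_at_imp_continuous_on) (metis DERIV_isCont)
      show "norm (g \<zeta>) \<le> \<epsilon> * d" if "norm (0 - \<zeta>) = \<rho>" for \<zeta>
      proof -
        have "norm (g \<zeta>) \<le> norm (h (z + \<zeta> *\<^sub>C v) - h p)"
          unfolding g_def by (rule Finite_Cartesian_Product.norm_nth_le)
        also have "\<dots> \<le> \<epsilon> * d"
          using that by (intro h_le near) simp
        finally show ?thesis .
      qed
    qed (rule \<rho>)
    moreover have "deriv g 0 = (E z v - D v) $ i"
      using DERIV_imp_deriv[OF g_deriv[of 0]] \<rho> by simp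
    moreover have "\<epsilon> * d / \<rho> = 4 * \<epsilon> * norm v"
      using d(1) False by (simp add: \<rho>_def)
    ultimately show ?thesis
      by simp
  qed
  have onorm_le: "onorm (\<lambda>v. E z v - D v) \<le> e" if z: "norm (z - p) < d / 2" for z
  proof (rule onorm_bound)
    show "norm (E z v - D v) \<le> e * norm v" for v
    proof -
      have "norm (E z v - D v) \<le> (\<Sum>i\<in>(UNIV::'m set). 4 * \<epsilon> * norm v)"
        by (rule order_trans[OF norm_vec_le_sum sum_mono]) (rule component[OF z])
      also have "\<dots> = e * norm v"
        by (simp add: \<epsilon>_def)
      finally show ?thesis .
    qed
  qed (use e in simp)
  show thesis
  proof (rule that[of "d / 2"])
    show "ball p (d / 2) \<subseteq> U"
      using d by (auto simp: subset_iff)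
    fix z z' assume zz: "z \<in> ball p (d / 2)" "z' \<in> ball p (d / 2)"
    have "norm (h z - h z') \<le> e * norm (z - z')"
    proof (rule differentiable_bound[OF convex_ball _ _ zz])
      fix x assume "x \<in> ball p (d / 2)"
      then have x: "norm (x - p) < d / 2" "x \<in> U"
        using d by (auto simp: dist_norm norm_minus_commute subset_iff)
      show "(h has_derivative (\<lambda>v. E x v - D v)) (at x within ball p (d / 2))"
        using h_diff[OF x(2)] has_derivative_at_withinI by blast
      show "onorm (\<lambda>v. E x v - D v) \<le> e"
        using onorm_le[OF x(1)] .
    qed
    then show "norm (f z - f z' - D (z - z')) \<le> e * norm (z - z')"
      by (simp add: h_def bounded_linear.linear[OF bD, THEN linear_diff] algebra_simps)
  qed (use d in simp)
qed

section \<open>Complex curves in a normed space\<close>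

text \<open>The function \<open>\<kappa>\<close> makes the coordinate changes holomorphic.\<close>

definition disc_charts :: "'e::complex_normed_space set \<Rightarrow> (complex \<Rightarrow> 'e) set" where
  "disc_charts Z = {\<phi>. (\<forall>t\<in>ball 0 2. complex_differentiable_at \<phi> t) \<and>
     openin (top_of_set Z) (\<phi> ` ball 0 2) \<and>
     (\<exists>W \<kappa>. open W \<and> \<phi> ` ball 0 2 \<subseteq> W \<and> (\<forall>z\<in>W. complex_differentiable_at \<kappa> z) \<and>
        (\<forall>t\<in>ball 0 2. \<kappa> (\<phi> t) = t))}"

lemma disc_chartsD:
  assumes "\<phi> \<in> disc_charts Z"
  obtains W \<kappa> where "\<And>t. t \<in> ball 0 2 \<Longrightarrow> complex_differentiable_at \<phi> t"
    "openin (top_of_set Z) (\<phi> ` ball 0 2)" "open W" "\<phi> ` ball 0 2 \<subseteq> W"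
    "\<And>z. z \<in> W \<Longrightarrow> complex_differentiable_at \<kappa> z" "\<And>t. t \<in> ball 0 2 \<Longrightarrow> \<kappa> (\<phi> t) = t"
    "inj_on \<phi> (ball 0 2)" "\<And>z. z \<in> \<phi> ` ball 0 2 \<Longrightarrow> inv_into (ball 0 2) \<phi> z = \<kappa> z"
proof -
  obtain W \<kappa> where *: "\<And>t. t \<in> ball 0 2 \<Longrightarrow> complex_differentiable_at \<phi> t"
    "openin (top_of_set Z) (\<phi> ` ball 0 2)" "open W" "\<phi> ` ball 0 2 \<subseteq> W"
    "\<And>z. z \<in> W \<Longrightarrow> complex_differentiable_at \<kappa> z" "\<And>t. t \<in> ball 0 2 \<Longrightarrow> \<kappa> (\<phi> t) = t"
    using assms unfolding disc_charts_def by blast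
  have inj: "inj_on \<phi> (ball 0 2)"
    using *(6) by (rule inj_on_inverseI)
  have "inv_into (ball 0 2) \<phi> z = \<kappa> z" if "z \<in> \<phi> ` ball 0 2" for z
    using that inv_into_f_f[OF inj] *(6) by auto
  from that[OF * inj this] show thesis .
qed

lemma disc_charts_continuous:
  assumes "\<phi> \<in> disc_charts Z"
  shows "continuous_on (ball 0 2) \<phi>"
    "homeomorphism (ball 0 2) (\<phi> ` ball 0 2) \<phi> (inv_into (ball 0 2) \<phi>)"
proof -
  obtain W \<kappa> where *: "\<And>t. t \<in> ball 0 2 \<Longrightarrow> complex_differentiable_at \<phi> t" "\<phi> ` ball 0 2 \<subseteq> W"
    "\<And>z. z \<in> W \<Longrightarrow> complex_differentiable_at \<kappa> z"
    "inj_on \<phi> (ball 0 2)" "\<And>z. z \<in> \<phi> ` ball 0 2 \<Longrightarrow> inv_into (ball 0 2) \<phi> z = \<kappa> z"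
    using disc_chartsD[OF assms] by metis
  show c: "continuous_on (ball 0 2) \<phi>"
    using *(1) complex_differentiable_at_continuous by (blast intro: continuous_at_imp_continuous_on)
  have "continuous_on (\<phi> ` ball 0 2) \<kappa>"
    using *(2,3) complex_differentiable_at_continuous by (blast intro: continuous_at_imp_continuous_on)
  then have "continuous_on (\<phi> ` ball 0 2) (inv_into (ball 0 2) \<phi>)"
    using *(5) by (simp cong: continuous_on_cong)
  then show "homeomorphism (ball 0 2) (\<phi> ` ball 0 2) \<phi> (inv_into (ball 0 2) \<phi>)"
    using c *(4) by (auto simp: homeomorphism_def)
qed

text \<open>All charts share the domain \<open>ball 0 2\<close>; precomposition with multiplication
  by \<open>e / 2\<close> restores it for a parametrisation of radius \<open>e\<close>.\<close>

lemma disc_charts_rescale: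
  fixes \<phi> :: "complex \<Rightarrow> 'e::complex_normed_space"
  assumes e: "e > 0" and \<phi>: "\<And>t. t \<in> ball 0 e \<Longrightarrow> complex_differentiable_at \<phi> t"
    and op: "openin (top_of_set Z) (\<phi> ` ball 0 e)" and W: "open W" "\<phi> ` ball 0 e \<subseteq> W"
    and \<kappa>: "\<And>z. z \<in> W \<Longrightarrow> complex_differentiable_at \<kappa> z" "\<And>t. t \<in> ball 0 e \<Longrightarrow> \<kappa> (\<phi> t) = t"
  shows "\<exists>\<psi>\<in>disc_charts Z. \<psi> 0 = \<phi> 0 \<and> \<psi> ` ball 0 2 = \<phi> ` ball 0 e"
proof -
  define s where "s = complex_of_real (e / 2)"
  have s: "s \<noteq> 0" "norm s = e / 2"
    using e by (simp_all add: s_def)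
  define \<psi> where "\<psi> = (\<lambda>t. \<phi> (s * t))"
  have st: "s * t \<in> ball 0 e \<longleftrightarrow> t \<in> ball 0 2" for t
  proof -
    have "norm (s * t) < e \<longleftrightarrow> e * norm t < e * 2"
      unfolding norm_mult s(2) by linarith
    then show ?thesis
      using e by simp
  qed
  have "(*) s ` ball 0 2 = ball 0 e"
  proof
    show "(*) s ` ball 0 2 \<subseteq> ball 0 e"
      using st by blast
    show "ball 0 e \<subseteq> (*) s ` ball 0 2"
    proof
      fix u :: complex assume "u \<in> ball 0 e"
      then have "u / s \<in> ball 0 2" "u = s * (u / s)"
        using st[of "u / s"] s(1) by auto
      then show "u \<in> (*) s ` ball 0 2"
        by blast
    qed
  qed
  then have img: "\<psi> ` ball 0 2 = \<phi> ` ball 0 e"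
    unfolding \<psi>_def by (metis (no_types) image_image)
  have "\<psi> \<in> disc_charts Z"
    unfolding disc_charts_def
  proof (intro CollectI conjI ballI exI[of _ W] exI[of _ "\<lambda>z. \<kappa> z / s"] W(1))
    show "openin (top_of_set Z) (\<psi> ` ball 0 2)" "\<psi> ` ball 0 2 \<subseteq> W"
      unfolding img using op W(2) by blast+
    fix t :: complex assume t: "t \<in> ball 0 2"
    then have st2: "s * t \<in> ball 0 e"
      using st by blast
    have "complex_differentiable_at (\<lambda>t. s * t) t"
      by (simp add: complex_differentiable_at_iff field_differentiable_mult)
    from complex_differentiable_at_compose[OF this \<phi>[OF st2]]
    show "complex_differentiable_at \<psi> t"
      by (simp add: \<psi>_def o_def)
    show "\<kappa> (\<psi> t) / s = t"
      using \<kappa>(2)[OF st2] s(1) by (simp add: \<psi>_def)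
  next
    fix z assume z: "z \<in> W"
    have "complex_differentiable_at (\<lambda>u. u / s) (\<kappa> z)"
      using s(1) by (simp add: complex_differentiable_at_iff field_differentiable_divide)
    from complex_differentiable_at_compose[OF \<kappa>(1)[OF z] this]
    show "complex_differentiable_at (\<lambda>z. \<kappa> z / s) z"
      by (simp add: o_def)
  qed
  then show ?thesis
    using img by (intro bexI[of _ \<psi>]) (simp_all add: \<psi>_def)
qed

lemma disc_charts_shrink:
  assumes \<phi>: "\<phi> \<in> disc_charts Z" and N: "openin (top_of_set Z) N" "\<phi> 0 \<in> N"
  shows "\<exists>\<psi>\<in>disc_charts Z. \<psi> 0 = \<phi> 0 \<and> \<psi> ` ball 0 2 \<subseteq> N"
proof -
  obtain W \<kappa> where *: "\<And>t. t \<in> ball 0 2 \<Longrightarrow> complex_differentiable_at \<phi> t"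
    "openin (top_of_set Z) (\<phi> ` ball 0 2)" "open W" "\<phi> ` ball 0 2 \<subseteq> W"
    "\<And>z. z \<in> W \<Longrightarrow> complex_differentiable_at \<kappa> z" "\<And>t. t \<in> ball 0 2 \<Longrightarrow> \<kappa> (\<phi> t) = t"
    by (rule disc_chartsD[OF \<phi>]) blast
  have "openin (top_of_set (ball 0 2)) (ball 0 2 \<inter> \<phi> -` N)"
    by (rule continuous_openin_preimage[OF disc_charts_continuous(1)[OF \<phi>] _ N(1)])
      (use openin_imp_subset[OF *(2)] in blast)
  then have "open (ball 0 2 \<inter> \<phi> -` N)"
    using openin_open_eq open_ball by blast
  moreover have "0 \<in> ball 0 2 \<inter> \<phi> -` N"
    using N(2) by simp
  ultimately obtain e where e: "e > 0" "ball 0 e \<subseteq> ball 0 2 \<inter> \<phi> -` N"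
    using open_contains_ball by metis
  have "openin (top_of_set (ball 0 2)) (ball (0::complex) e)"
    using e(2) by (simp add: openin_open_eq)
  then have "openin (top_of_set (\<phi> ` ball 0 2)) (\<phi> ` ball 0 e)"
    using homeomorphism_imp_open_map[OF disc_charts_continuous(2)[OF \<phi>]] by blast
  then have op: "openin (top_of_set Z) (\<phi> ` ball 0 e)"
    using *(2) openin_trans by blast
  have e2: "t \<in> ball 0 2" if "t \<in> ball 0 e" for t :: complex
    using e(2) that by blast
  have "\<exists>\<psi>\<in>disc_charts Z. \<psi> 0 = \<phi> 0 \<and> \<psi> ` ball 0 2 = \<phi> ` ball 0 e"
  proof (rule disc_charts_rescale[OF e(1) _ op *(3) _ *(5)])
    show "\<phi> ` ball 0 e \<subseteq> W"
      using *(4) e2 by blast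
  qed (use *(1,6) e2 in blast)+
  moreover have "\<phi> ` ball 0 e \<subseteq> N"
    using e(2) by blast
  ultimately show ?thesis
    by metis
qed

lemma riemann_surface_disc_charts:
  assumes "connected Z" and charts: "\<And>p. p \<in> Z \<Longrightarrow> \<exists>\<phi>\<in>disc_charts Z. \<phi> 0 = p"
  shows "riemann_surface Z (disc_charts Z)"
proof
  show "connected Z"
    by fact
next
  fix \<phi> assume \<phi>: "\<phi> \<in> disc_charts Z"
  show "openin (top_of_set Z) (\<phi> ` ball 0 2)"
    using disc_chartsD[OF \<phi>] by metis
  show "homeomorphism (ball 0 2) (\<phi> ` ball 0 2) \<phi> (inv_into (ball 0 2) \<phi>)"
    using disc_charts_continuous(2)[OF \<phi>] .
next
  fix \<phi> \<psi> assume \<phi>: "\<phi> \<in> disc_charts Z" and \<psi>: "\<psi> \<in> disc_charts Z"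
  obtain W \<kappa> where \<kappa>: "openin (top_of_set Z) (\<phi> ` ball 0 2)" "open W" "\<phi> ` ball 0 2 \<subseteq> W"
    "\<And>z. z \<in> W \<Longrightarrow> complex_differentiable_at \<kappa> z"
    "\<And>z. z \<in> \<phi> ` ball 0 2 \<Longrightarrow> inv_into (ball 0 2) \<phi> z = \<kappa> z"
    by (rule disc_chartsD[OF \<phi>]) blast
  have d\<psi>: "complex_differentiable_at \<psi> t" if "t \<in> ball 0 2" for t
    using disc_chartsD[OF \<psi>] that by metis
  have "(\<kappa> \<circ> \<psi>) field_differentiable at t" if "t \<in> ball 0 2 \<inter> \<psi> -` \<phi> ` ball 0 2" for t
    using complex_differentiable_at_compose[OF d\<psi>[of t] \<kappa>(4)[of "\<psi> t"]] \<kappa>(3) that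
    by (auto simp: complex_differentiable_at_iff[symmetric])
  then have "(\<kappa> \<circ> \<psi>) holomorphic_on (ball 0 2 \<inter> \<psi> -` \<phi> ` ball 0 2)"
    unfolding holomorphic_on_def using field_differentiable_at_within by blast
  then show "(inv_into (ball 0 2) \<phi> \<circ> \<psi>) holomorphic_on (ball 0 2 \<inter> \<psi> -` \<phi> ` ball 0 2)"
    by (rule holomorphic_transform) (use \<kappa>(5) in auto)
next
  fix N z assume N: "openin (top_of_set Z) N" "z \<in> N"
  then have "z \<in> Z"
    using openin_imp_subset by blast
  then obtain \<phi> where "\<phi> \<in> disc_charts Z" "\<phi> 0 = z"
    using charts by blast
  then show "\<exists>\<phi>\<in>disc_charts Z. \<phi> 0 = z \<and> \<phi> ` ball 0 2 \<subseteq> N"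
    using disc_charts_shrink[of \<phi> Z N] N by metis
qed

section \<open>Holomorphic retracts\<close>

lemma holo_on_cong:
  assumes "\<And>x. x \<in> S \<Longrightarrow> f x = g x"
  shows "holo_on f S \<longleftrightarrow> holo_on g S"
  using assms unfolding holo_on_def by simp

lemma holo_on_open:
  assumes "holo_on f S" "open S" "x \<in> S"
  shows "complex_differentiable_at f x"
proof -
  obtain U F where F: "open U" "x \<in> U" "\<forall>y\<in>U. complex_differentiable_at F y" "\<forall>y\<in>U \<inter> S. F y = f y"
    using assms(1,3) unfolding holo_on_def by metis
  show ?thesis
    by (rule complex_differentiable_at_transform[of F x "U \<inter> S"]) (use F assms(2,3) in auto)
qed

lemma holo_on_openI:
  assumes "open S" "\<And>x. x \<in> S \<Longrightarrow> complex_differentiable_at f x"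
  shows "holo_on f S"
  using assms unfolding holo_on_def by blast

lemma topspace_embedded [simp]: "topspace (underlying (embedded A)) = A"
  by (simp add: embedded_def)

lemma holomorphic_map_embedded:
  "holomorphic_map (embedded A) (embedded B) f \<longleftrightarrow> continuous_on A f \<and> f ` A \<subseteq> B \<and> holo_on f A"
proof -
  have "holo_on (id \<circ> f \<circ> inv_into A id) {x \<in> A. f x \<in> B} \<longleftrightarrow> holo_on f A" if "f ` A \<subseteq> B"
  proof -
    have "{x \<in> A. f x \<in> B} = A"
      using that by blast
    moreover have "(id \<circ> f \<circ> inv_into A id) x = f x" if "x \<in> A" for x
      using that inv_into_f_f[of id A x] by simp
    ultimately show ?thesis
      using holo_on_cong[of A "id \<circ> f \<circ> inv_into A id" f] by simp
  qed
  then show ?thesis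
    unfolding holomorphic_map_def embedded_def by (auto simp: image_subset_iff_funcset)
qed

locale holomorphic_retraction =
  fixes \<Omega> :: "(complex ^ 'n::finite) set" and r :: "complex ^ 'n \<Rightarrow> complex ^ 'n"
  assumes open_\<Omega>: "open \<Omega>"
    and differentiable: "z \<in> \<Omega> \<Longrightarrow> complex_differentiable_at r z"
    and maps_to: "z \<in> \<Omega> \<Longrightarrow> r z \<in> \<Omega>"
    and idem: "z \<in> \<Omega> \<Longrightarrow> r (r z) = r z"
begin

lemma retract_subset: "r ` \<Omega> \<subseteq> \<Omega>"
  using maps_to by blast

lemma retract_fixed: "p \<in> r ` \<Omega> \<Longrightarrow> r p = p"
  using idem by blast

lemma derivative_projection:
  assumes p: "p \<in> r ` \<Omega>"
  obtains P where "(r has_derivative P) (at p)" "\<And>c v. P (c *\<^sub>C v) = c *\<^sub>C P v" "\<And>v. P (P v) = P v"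
proof -
  have p\<Omega>: "p \<in> \<Omega>" and rp: "r p = p"
    using p retract_subset retract_fixed by blast+
  obtain P where P: "(r has_derivative P) (at p)" "\<And>c v. P (c *\<^sub>C v) = c *\<^sub>C P v"
    using differentiable[OF p\<Omega>] unfolding complex_differentiable_at_def by blast
  have "((r \<circ> r) has_derivative (P \<circ> P)) (at p)"
    by (rule diff_chain_at[OF P(1)]) (simp add: rp P(1))
  then have "(r has_derivative (P \<circ> P)) (at p)"
    by (rule has_derivative_transform_within_open[OF _ open_\<Omega> p\<Omega>]) (simp add: idem)
  then have "P \<circ> P = P"
    using P(1) has_derivative_unique by blast
  then have "P (P v) = P v" for v
    by (metis comp_apply)
  with P show thesis
    by (rule that)
qed

text \<open>The constant \<open>1 / 2\<close> matters through being below 1: two fixed points of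
  \<open>r\<close> near \<open>p\<close> whose difference is killed by \<open>P\<close> have
  distance at most half of itself, so they coincide.\<close>

lemma strictly_differentiable:
  assumes p: "p \<in> r ` \<Omega>" and P: "(r has_derivative P) (at p)" "\<And>c v. P (c *\<^sub>C v) = c *\<^sub>C P v"
  obtains d where "d > 0" "ball p d \<subseteq> \<Omega>"
    "\<And>z z'. z \<in> ball p d \<Longrightarrow> z' \<in> ball p d \<Longrightarrow> norm (r z - r z' - P (z - z')) \<le> 1 / 2 * norm (z - z')"
proof -
  have "p \<in> \<Omega>"
    using p retract_subset by blast
  show thesis
    by (rule complex_strictly_differentiable[OF open_\<Omega> \<open>p \<in> \<Omega>\<close> differentiable P, of "1 / 2"])
      (use that in auto)
qed

text \<open>Near \<open>p\<close> the map \<open>r\<close> is a contraction that fixes every point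
  of the retract, and a contraction has at most one fixed point.\<close>

lemma rank_zero_isolated:
  assumes p: "p \<in> r ` \<Omega>" and P: "(r has_derivative (\<lambda>v. 0)) (at p)"
  shows "openin (top_of_set (r ` \<Omega>)) {p}"
proof -
  obtain d where d: "d > 0"
    "\<And>z z'. z \<in> ball p d \<Longrightarrow> z' \<in> ball p d \<Longrightarrow> norm (r z - r z' - 0) \<le> 1 / 2 * norm (z - z')"
    by (rule strictly_differentiable[OF p P]) (auto simp del: diff_0_right)
  have "z = p" if "z \<in> r ` \<Omega>" "z \<in> ball p d" for z
    using d(2)[of z p] that d(1) retract_fixed[OF that(1)] retract_fixed[OF p] by simp
  then have "{p} = r ` \<Omega> \<inter> ball p d"
    using p d(1) by auto
  then show ?thesis
    by (metis openin_open_Int open_ball)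
qed

text \<open>\<open>r\<close> is injective near \<open>p\<close> and takes the same value at
  \<open>z\<close> and at \<open>r z\<close>, so \<open>z = r z\<close>. Halving the radius keeps
  \<open>r z\<close> within reach, since \<open>r\<close> stretches distances to \<open>p\<close> by
  at most \<open>3 / 2\<close>.\<close>

lemma full_rank_interior:
  assumes p: "p \<in> r ` \<Omega>" and P: "(r has_derivative (\<lambda>v. v)) (at p)"
  obtains d where "d > 0" "ball p d \<subseteq> r ` \<Omega>"
proof -
  obtain d where d: "d > 0" "ball p d \<subseteq> \<Omega>"
    "\<And>z z'. z \<in> ball p d \<Longrightarrow> z' \<in> ball p d \<Longrightarrow> norm (r z - r z' - (z - z')) \<le> 1 / 2 * norm (z - z')"
    by (rule strictly_differentiable[OF p P]) auto
  have "z \<in> r ` \<Omega>" if z: "z \<in> ball p (d / 2)" for z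
  proof -
    have zd: "z \<in> ball p d" and pd: "p \<in> ball p d"
      using z d(1) by auto
    have "norm (r z - p) \<le> norm (r z - p - (z - p)) + norm (z - p)"
      using norm_triangle_ineq[of "r z - p - (z - p)" "z - p"] by simp
    also have "\<dots> \<le> 3 / 2 * norm (z - p)"
      using d(3)[OF zd pd] retract_fixed[OF p] by simp
    also have "\<dots> < d"
      using z d(1) by (simp add: dist_norm norm_minus_commute)
    finally have rz: "r z \<in> ball p d"
      by (simp add: dist_norm norm_minus_commute)
    have "z \<in> \<Omega>"
      using zd d(2) by blast
    then have "norm (r z - r z - (z - r z)) \<le> 1 / 2 * norm (z - r z)"
      using d(3)[OF zd rz] idem by simp
    then have "z = r z"
      by (simp add: norm_minus_commute)
    then show ?thesis
      using \<open>z \<in> \<Omega>\<close> by blast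
  qed
  then have "ball p (d / 2) \<subseteq> r ` \<Omega>"
    by (rule subsetI)
  then show thesis
    using that[of "d / 2"] d(1) by simp
qed

text \<open>The retract is parametrised by pushing the line \<open>p + t *\<^sub>C v\<close> into it
  with \<open>r\<close>. The affine function \<open>l\<close>, defined on the whole space, is
  injective on the retract near \<open>p\<close>, and \<open>l \<circ> \<phi>\<close> has derivative
  1 at 0; with \<open>b\<close> its local inverse, \<open>b \<circ> l\<close> is the ambient
  holomorphic function that \<open>disc_charts\<close> asks for.\<close>

lemma rank_one_chart:
  fixes v :: "complex ^ 'n"
  assumes p: "p \<in> r ` \<Omega>" and P: "(r has_derivative P) (at p)" "\<And>c v. P (c *\<^sub>C v) = c *\<^sub>C P v"
    and v: "P v = v" "v $ j = 1" and rank: "\<And>w. P w = (P w $ j) *\<^sub>C v"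
  shows "\<exists>\<phi>\<in>disc_charts (r ` \<Omega>). \<phi> 0 = p"
proof -
  have bP: "bounded_linear P"
    using P(1) by (rule has_derivative_bounded_linear)
  have linP: "P (a - b) = P a - P b" for a b
    using bP by (rule bounded_linear.linear[THEN linear_diff])
  have rp: "r p = p"
    using retract_fixed[OF p] .
  have v0: "v \<noteq> 0"
    using v(2) by auto
  obtain d where d: "d > 0" "ball p d \<subseteq> \<Omega>"
    "\<And>z z'. z \<in> ball p d \<Longrightarrow> z' \<in> ball p d \<Longrightarrow> norm (r z - r z' - P (z - z')) \<le> 1 / 2 * norm (z - z')"
    using strictly_differentiable[OF p P] by metis
  define \<tau> where "\<tau> = d / (2 * norm v)"
  \<comment> \<open>This radius keeps the displacement \<open>t *\<^sub>C v\<close> below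
    \<open>d / 2\<close>. As \<open>\<phi> t - p\<close> differs from it by at most half its norm,
    \<open>\<phi> t\<close> is again in \<open>ball p d\<close>.\<close>
  have \<tau>: "\<tau> > 0"
    using d(1) v0 by (simp add: \<tau>_def)
  define \<phi> where "\<phi> t = r (p + t *\<^sub>C v)" for t
  have \<phi>0: "\<phi> 0 = p"
    using rp by (simp add: \<phi>_def)
  have small: "norm (t *\<^sub>C v) < d / 2" if "t \<in> ball 0 \<tau>" for t
    using that v0 by (simp add: \<tau>_def norm_scaleC field_simps)
  have near: "p + t *\<^sub>C v \<in> ball p d" if "t \<in> ball 0 \<tau>" for t
    using small[OF that] d(1) by (simp add: dist_norm)
  have \<phi>d: "\<phi> t \<in> ball p d" if t: "t \<in> ball 0 \<tau>" for t
  proof -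
    have "p \<in> ball p d"
      using d(1) by simp
    from d(3)[OF near[OF t] this] have "norm (\<phi> t - p - t *\<^sub>C v) \<le> 1 / 2 * norm (t *\<^sub>C v)"
      using rp P(2) v(1) by (simp add: \<phi>_def)
    then have "norm (\<phi> t - p) < d"
      using norm_triangle_ineq[of "\<phi> t - p - t *\<^sub>C v" "t *\<^sub>C v"] small[OF t] d(1) by simp
    then show ?thesis
      by (simp add: dist_norm norm_minus_commute)
  qed
  have \<phi>_Z: "\<phi> t \<in> r ` \<Omega>" if "t \<in> ball 0 \<tau>" for t
    unfolding \<phi>_def using near[OF that] d(2) by blast
  have \<phi>_diff: "complex_differentiable_at \<phi> t" if "t \<in> ball 0 \<tau>" for t
  proof -
    have "p + t *\<^sub>C v \<in> \<Omega>"
      using near[OF that] d(2) by blast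
    then have "complex_differentiable_at (r \<circ> (\<lambda>t. p + t *\<^sub>C v)) t"
      using complex_differentiable_at_line[of p v t] differentiable
      by (intro complex_differentiable_at_compose) simp_all
    then show ?thesis
      by (simp add: o_def \<phi>_def[abs_def])
  qed
  define l where "l w = P (w - p) $ j" for w
  have l_deriv: "(l has_derivative (\<lambda>h. P h $ j)) (at w)" for w
    unfolding l_def
    by (auto intro!: derivative_eq_intros bounded_linear.has_derivative[OF bP]
        bounded_linear.has_derivative[OF bounded_linear_vec_nth])
  have l_diff: "complex_differentiable_at l w" for w
    unfolding complex_differentiable_at_def
    using l_deriv P(2) by (intro exI[of _ "\<lambda>h. P h $ j"]) (simp add: scaleC_complex_def)
  have l_inj: "z = z'" if z: "z \<in> r ` \<Omega>" "z \<in> ball p d" "z' \<in> r ` \<Omega>" "z' \<in> ball p d" "l z = l z'" for z z'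
  proof -
    have "P (z - z') $ j = 0"
      using z(5) by (simp add: l_def linP)
    then have "P (z - z') = 0"
      using rank[of "z - z'"] by simp
    then have "norm (z - z') \<le> 1 / 2 * norm (z - z')"
      using d(3)[OF z(2,4)] retract_fixed[OF z(1)] retract_fixed[OF z(3)] by simp
    then show ?thesis by simp
  qed
  have hol: "(l \<circ> \<phi>) holomorphic_on ball 0 \<tau>"
    unfolding holomorphic_on_def
    using complex_differentiable_at_compose[OF \<phi>_diff l_diff] complex_differentiable_at_iff
      field_differentiable_at_within by blast
  have "((l \<circ> \<phi>) has_field_derivative 1) (at 0)"
  proof -
    have "((r \<circ> (\<lambda>t. p + t *\<^sub>C v)) has_derivative (P \<circ> (\<lambda>h. h *\<^sub>C v))) (at 0)"
      using P(1) by (intro diff_chain_at has_derivative_complex_line) simp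
    then have "(\<phi> has_derivative (\<lambda>h. h *\<^sub>C v)) (at 0)"
      using P(2) v(1) by (simp add: o_def \<phi>_def[abs_def])
    from diff_chain_at[OF this l_deriv] show ?thesis
      using P(2) v by (simp add: has_field_derivative_def o_def mult_1[abs_def])
  qed
  then have dnz: "deriv (l \<circ> \<phi>) 0 \<noteq> 0"
    by (simp add: DERIV_imp_deriv)
  have z0: "0 \<in> ball (0::complex) \<tau>"
    using \<tau> by simp
  obtain \<eta> where \<eta>: "\<eta> > 0" "ball 0 \<eta> \<subseteq> ball (0::complex) \<tau>" "inj_on (l \<circ> \<phi>) (ball 0 \<eta>)"
    by (rule has_complex_derivative_locally_injective[OF hol z0 open_ball dnz]) blast
  have hol\<eta>: "(l \<circ> \<phi>) holomorphic_on ball 0 \<eta>"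
    using hol \<eta>(2) by (rule holomorphic_on_subset)
  define A where "A = (l \<circ> \<phi>) ` ball 0 \<eta>"
  have openA: "open A"
    unfolding A_def using open_mapping_thm3[OF hol\<eta> open_ball \<eta>(3)] .
  obtain b where b: "b holomorphic_on A" "\<And>t. t \<in> ball 0 \<eta> \<Longrightarrow> b ((l \<circ> \<phi>) t) = t"
    unfolding A_def using holomorphic_has_inverse[OF hol\<eta> open_ball \<eta>(3)] by metis
  define W where "W = ball p d \<inter> l -` A"
  have "continuous_on UNIV l"
    using l_diff complex_differentiable_at_continuous by (blast intro: continuous_at_imp_continuous_on)
  then have openW: "open W"
    unfolding W_def using openA by (intro open_Int open_vimage) auto
  have t\<tau>: "t \<in> ball 0 \<tau>" if "t \<in> ball 0 \<eta>" for t :: complex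
    using \<eta>(2) that by blast
  \<comment> \<open>A point of the retract in \<open>W\<close> has the same \<open>l\<close>-value
    as some \<open>\<phi> t\<close>, and \<open>l_inj\<close> identifies the two. Thus the image of
    the parametrisation is cut out of the retract by an open set, which is its relative
    openness.\<close>
  have img: "\<phi> ` ball 0 \<eta> = r ` \<Omega> \<inter> W"
  proof
    show "\<phi> ` ball 0 \<eta> \<subseteq> r ` \<Omega> \<inter> W"
      using \<phi>d[OF t\<tau>] \<phi>_Z[OF t\<tau>] unfolding W_def A_def by auto
    show "r ` \<Omega> \<inter> W \<subseteq> \<phi> ` ball 0 \<eta>"
    proof
      fix z assume z: "z \<in> r ` \<Omega> \<inter> W"
      then obtain t where t: "t \<in> ball 0 \<eta>" "l z = l (\<phi> t)"
        unfolding W_def A_def by auto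
      then have "z = \<phi> t"
        using z \<phi>d[OF t\<tau>[OF t(1)]] \<phi>_Z[OF t\<tau>[OF t(1)]] unfolding W_def by (intro l_inj) auto
      then show "z \<in> \<phi> ` ball 0 \<eta>"
        using t(1) by blast
    qed
  qed
  have "\<exists>\<psi>\<in>disc_charts (r ` \<Omega>). \<psi> 0 = \<phi> 0 \<and> \<psi> ` ball 0 2 = \<phi> ` ball 0 \<eta>"
  proof (rule disc_charts_rescale[OF \<eta>(1), of _ _ W "b \<circ> l"])
    show "complex_differentiable_at \<phi> t" if "t \<in> ball 0 \<eta>" for t
      using \<phi>_diff[OF t\<tau>[OF that]] .
    show "openin (top_of_set (r ` \<Omega>)) (\<phi> ` ball 0 \<eta>)"
      unfolding img using openW by (rule openin_open_Int)
    show "\<phi> ` ball 0 \<eta> \<subseteq> W"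
      unfolding img by blast
    show "complex_differentiable_at (b \<circ> l) z" if "z \<in> W" for z
    proof (rule complex_differentiable_at_compose[OF l_diff])
      have "l z \<in> A"
        using that unfolding W_def by blast
      then show "complex_differentiable_at b (l z)"
        using b(1) openA holomorphic_on_imp_differentiable_at complex_differentiable_at_iff by blast
    qed
    show "(b \<circ> l) (\<phi> t) = t" if "t \<in> ball 0 \<eta>" for t
      using b(2)[OF that] by simp
  qed (rule openW)
  then show ?thesis
    unfolding \<phi>0 by blast
qed

end

text \<open>A nonzero image vector is scaled so that its coordinate \<open>j\<close> becomes 1. If
  the image were larger, subtracting a multiple of \<open>v\<close> would leave a nonzero image
  vector \<open>t\<close> with \<open>t $ j = 0\<close>; in dimension 2 the vectors \<open>v\<close>
  and \<open>t\<close> span, and a projection fixing both is the identity.\<close>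

lemma projection_rank_one:
  fixes P :: "complex ^ 2 \<Rightarrow> complex ^ 2"
  assumes lin: "bounded_linear P" and P: "\<And>c v. P (c *\<^sub>C v) = c *\<^sub>C P v" "\<And>v. P (P v) = P v"
    and "P \<noteq> (\<lambda>v. 0)" "P \<noteq> (\<lambda>v. v)"
  obtains v :: "complex ^ 2" and j where "P v = v" "v $ j = 1" "\<And>w. P w = (P w $ j) *\<^sub>C v"
proof -
  have linP: "P (a - b) = P a - P b" "P (a + b) = P a + P b" for a b
    using bounded_linear.linear[OF lin] by (simp_all add: linear_diff linear_add)
  obtain w0 where "P w0 \<noteq> 0"
    using assms(4) by auto
  then obtain j where j: "P w0 $ j \<noteq> 0"
    by (auto simp: vec_eq_iff)
  define v where "v = (1 / P w0 $ j) *\<^sub>C P w0"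
  have v: "P v = v" "v $ j = 1"
    using P j by (simp_all add: v_def)
  have "P w = (P w $ j) *\<^sub>C v" for w
  proof (rule ccontr)
    assume ne: "P w \<noteq> (P w $ j) *\<^sub>C v"
    define t where "t = P w - (P w $ j) *\<^sub>C v"
    have t: "P t = t" "t $ j = 0" "t \<noteq> 0"
      using ne v P linP by (simp_all add: t_def)
    obtain k where k: "k \<noteq> j" "\<And>i. i = j \<or> i = k"
    proof (cases "j = 1")
      case True
      show thesis
        by (rule that[of 2]) (use True exhaust_2 in auto)
    next
      case False
      show thesis
        by (rule that[of 1]) (use False exhaust_2 in auto)
    qed
    have tk: "t $ k \<noteq> 0"
    proof
      assume "t $ k = 0"
      then have "t $ i = 0" for i
        using k(2)[of i] t(2) by blast
      then show False
        using t(3) by (simp add: vec_eq_iff)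
    qed
    have "P u = u" for u
    proof -
      define s where "s = (u - (u $ j) *\<^sub>C v) $ k / t $ k"
      have "(u - (u $ j) *\<^sub>C v) $ i = (s *\<^sub>C t) $ i" for i
        using k(2)[of i] t(2) v(2) tk by (auto simp: s_def)
      then have "u - (u $ j) *\<^sub>C v = s *\<^sub>C t"
        by (subst vec_eq_iff) blast
      then have u: "u = (u $ j) *\<^sub>C v + s *\<^sub>C t"
        by (metis add.commute diff_add_cancel)
      have "P ((u $ j) *\<^sub>C v + s *\<^sub>C t) = (u $ j) *\<^sub>C v + s *\<^sub>C t"
        using linP(2) P(1) v(1) t(1) by simp
      then show ?thesis
        using u by simp
    qed
    then show False
      using assms(5) by auto
  qed
  with v show thesis
    by (rule that)
qed

section \<open>The dimension of the base of a line bundle\<close>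

text \<open>The dimension count is purely topological, so a local trivialisation is reduced here to
  a pair of mutually inverse continuous maps.\<close>

lemma bundle_trivialization:
  assumes "holomorphic_fibre_bundle E (embedded Z) (embedded (UNIV :: complex set)) \<pi>" and "p \<in> Z"
  obtains U h k where "openin (top_of_set Z) U" "p \<in> U"
    "continuous_map (subtopology (underlying E) {x \<in> topspace (underlying E). \<pi> x \<in> U})
       (top_of_set (U \<times> (UNIV :: complex set))) h"
    "continuous_map (top_of_set (U \<times> UNIV))
       (subtopology (underlying E) {x \<in> topspace (underlying E). \<pi> x \<in> U}) k"
    "\<And>x. x \<in> topspace (underlying E) \<Longrightarrow> \<pi> x \<in> U \<Longrightarrow> k (h x) = x \<and> fst (h x) = \<pi> x"
    "\<And>y. y \<in> U \<times> UNIV \<Longrightarrow> h (k y) = y"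
    "continuous_map (underlying E) (top_of_set Z) \<pi>"
proof -
  have cont: "continuous_map (underlying E) (top_of_set Z) \<pi>"
    using assms(1) by (simp add: holomorphic_fibre_bundle_def holomorphic_map_def embedded_def)
  obtain U h where U: "openin (top_of_set Z) U" "p \<in> U"
    and bih: "biholomorphism (restrict_space_to E {x \<in> topspace (underlying E). \<pi> x \<in> U})
          (product_space (restrict_space_to (embedded Z) U) (embedded (UNIV :: complex set))) h"
    and fst: "\<And>x. x \<in> topspace (underlying E) \<Longrightarrow> \<pi> x \<in> U \<Longrightarrow> fst (h x) = \<pi> x"
    using assms unfolding holomorphic_fibre_bundle_def by (auto simp: embedded_def)
  define T where "T = underlying E"
  define Q where "Q = {x \<in> topspace T. \<pi> x \<in> U}"
  have "Z \<inter> U = U"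
    using openin_imp_subset[OF U(1)] by blast
  then have und: "underlying (product_space (restrict_space_to (embedded Z) U) (embedded (UNIV :: complex set)))
      = top_of_set (U \<times> UNIV)"
    by (simp add: product_space_def restrict_space_to_def embedded_def subtopology_subtopology
        flip: prod_topology_subtopology_eu)
  have undE: "underlying (restrict_space_to E Q) = subtopology T Q"
    by (simp add: restrict_space_to_def T_def)
  let ?P = "product_space (restrict_space_to (embedded Z) U) (embedded (UNIV :: complex set))"
  have bih': "biholomorphism (restrict_space_to E Q) ?P h"
    using bih by (simp only: Q_def T_def)
  then obtain k where k: "holomorphic_map ?P (restrict_space_to E Q) k"
    "\<And>x. x \<in> topspace (subtopology T Q) \<Longrightarrow> k (h x) = x"
    "\<And>y. y \<in> topspace (top_of_set (U \<times> (UNIV :: complex set))) \<Longrightarrow> h (k y) = y"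
    unfolding biholomorphism_def und undE by blast
  show thesis
  proof (rule that[OF U, folded T_def, folded Q_def])
    show "continuous_map (subtopology T Q) (top_of_set (U \<times> UNIV)) h"
      using bih' unfolding biholomorphism_def holomorphic_map_def und undE by blast
    show "continuous_map (top_of_set (U \<times> UNIV)) (subtopology T Q) k"
      using k(1) unfolding holomorphic_map_def und undE by blast
    show "k (h x) = x \<and> fst (h x) = \<pi> x" if "x \<in> topspace T" "\<pi> x \<in> U" for x
      using k(2)[of x] fst[of x] that by (simp add: Q_def T_def)
    show "h (k y) = y" if "y \<in> U \<times> UNIV" for y
      using k(3)[of y] that by simp
    show "continuous_map T (top_of_set Z) \<pi>"
      using cont by (simp add: T_def)
  qed
qed

lemma complex_manifold_chart:
  fixes X :: "('a, 'e::complex_normed_space) holspace"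
  assumes "complex_manifold X" "x \<in> topspace (underlying X)"
  obtains V and \<phi> :: "'a \<Rightarrow> 'e" where "x \<in> V" "openin (underlying X) V" "open (\<phi> ` V)"
    "homeomorphic_map (subtopology (underlying X) V) (top_of_set (\<phi> ` V)) \<phi>"
proof -
  have "\<Union> (fst ` charts X) = topspace (underlying X)"
    using assms(1) by (simp add: complex_manifold_def)
  then obtain c where c: "c \<in> charts X" "x \<in> fst c"
    using assms(2) by blast
  obtain V \<phi> where V\<phi>: "c = (V, \<phi>)"
    by (rule prod.exhaust)
  have "\<forall>(V, \<phi>)\<in>charts X. openin (underlying X) V \<and> open (\<phi> ` V) \<and>
      homeomorphic_map (subtopology (underlying X) V) (top_of_set (\<phi> ` V)) \<phi>"
    using assms(1) by (simp add: complex_manifold_def)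
  from bspec[OF this c(1)] show thesis
    using that[of V \<phi>] c(2) by (simp add: V\<phi>)
qed

text \<open>The fibre over an isolated point is open in \<open>E\<close>, hence contains a chart
  domain of real dimension 4. The first component of \<open>h\<close> is constant on it, so
  \<open>snd\<close> alone would inject an open subset of \<open>complex ^ 2\<close> continuously
  into the plane.\<close>

lemma bundle_base_not_isolated:
  fixes E :: "('b, complex ^ 2) holspace"
  assumes E: "complex_manifold E"
    and fib: "holomorphic_fibre_bundle E (embedded Z) (embedded (UNIV :: complex set)) \<pi>" and p: "p \<in> Z"
  shows "\<not> openin (top_of_set Z) {p}"
proof
  assume iso: "openin (top_of_set Z) {p}"
  define T where "T = underlying E"
  obtain U h k where U: "openin (top_of_set Z) U" "p \<in> U"
    and h: "continuous_map (subtopology T {x \<in> topspace T. \<pi> x \<in> U}) (top_of_set (U \<times> (UNIV :: complex set))) h"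
    and k: "continuous_map (top_of_set (U \<times> UNIV)) (subtopology T {x \<in> topspace T. \<pi> x \<in> U}) k"
    and kh: "\<And>x. x \<in> topspace T \<Longrightarrow> \<pi> x \<in> U \<Longrightarrow> k (h x) = x \<and> fst (h x) = \<pi> x"
    and hk: "\<And>y. y \<in> U \<times> UNIV \<Longrightarrow> h (k y) = y"
    and \<pi>: "continuous_map T (top_of_set Z) \<pi>"
    by (rule bundle_trivialization[OF fib p, folded T_def]) blast
  define x0 where "x0 = k (p, 0)"
  have x0: "x0 \<in> topspace T" "\<pi> x0 \<in> U"
    using continuous_map_funspace[OF k] U(2) unfolding x0_def by (auto simp: Pi_iff)
  have "\<pi> x0 = p"
    using kh[OF x0] hk[of "(p, 0)"] U(2) by (simp add: x0_def)
  obtain V and \<phi> :: "'b \<Rightarrow> complex ^ 2" where V: "x0 \<in> V"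
    and op: "openin T V" "open (\<phi> ` V)" "homeomorphic_map (subtopology T V) (top_of_set (\<phi> ` V)) \<phi>"
    by (rule complex_manifold_chart[OF E, folded T_def, OF x0(1)]) blast
  have VT: "V \<subseteq> topspace T"
    using op(1) by (rule openin_subset)
  define W where "W = {x \<in> topspace T. \<pi> x \<in> {p}} \<inter> V"
  have "openin T {x \<in> topspace T. \<pi> x \<in> {p}}"
    using openin_continuous_map_preimage[OF \<pi> iso] .
  then have opW: "openin (subtopology T V) W"
    unfolding W_def by (metis openin_subtopology_Int)
  obtain g where g: "homeomorphic_maps (subtopology T V) (top_of_set (\<phi> ` V)) \<phi> g"
    using op(3) homeomorphic_map_maps by blast
  have g\<phi>: "g (\<phi> x) = x" if "x \<in> V" for x
    using g that VT unfolding homeomorphic_maps_def by auto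
  have contg: "continuous_map (top_of_set (\<phi> ` V)) (subtopology T V) g"
    using g unfolding homeomorphic_maps_def by blast
  have "openin (top_of_set (\<phi> ` V)) (\<phi> ` W)"
    using homeomorphic_map_openness_eq[OF op(3)] opW by blast
  then have open_\<phi>W: "open (\<phi> ` W)"
    using op(2) openin_open_eq by blast
  have WU: "W \<subseteq> {x \<in> topspace T. \<pi> x \<in> U}"
    using U(2) unfolding W_def by auto
  have "continuous_map (top_of_set (\<phi> ` W)) T g"
    by (rule continuous_map_from_subtopology_mono[OF continuous_map_into_fulltopology[OF contg]])
      (auto simp: W_def)
  moreover have "g \<in> \<phi> ` W \<rightarrow> W"
    using g\<phi> unfolding W_def by auto
  ultimately have "continuous_map (top_of_set (\<phi> ` W)) (subtopology T {x \<in> topspace T. \<pi> x \<in> U}) g"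
    using WU by (auto simp: continuous_map_in_subtopology)
  from continuous_map_compose[OF this h]
  have "continuous_on (\<phi> ` W) (h \<circ> g)"
    by simp
  then have "continuous_on (\<phi> ` W) (snd \<circ> (h \<circ> g))"
    by (intro continuous_on_compose continuous_on_snd continuous_on_id)
  moreover have "inj_on (snd \<circ> (h \<circ> g)) (\<phi> ` W)"
  proof (rule inj_onI)
    fix a b assume ab: "a \<in> \<phi> ` W" "b \<in> \<phi> ` W" "(snd \<circ> (h \<circ> g)) a = (snd \<circ> (h \<circ> g)) b"
    then obtain x y where xy: "x \<in> W" "y \<in> W" "a = \<phi> x" "b = \<phi> y"
      by blast
    have gx: "g a = x" "g b = y"
      using xy g\<phi> unfolding W_def by auto
    have "fst (h x) = p" "k (h x) = x" "fst (h y) = p" "k (h y) = y"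
      using kh[of x] kh[of y] xy(1,2) U(2) unfolding W_def by auto
    then have "h x = h y"
      using ab(3) gx by (simp add: prod_eq_iff)
    then show "a = b"
      using \<open>k (h x) = x\<close> \<open>k (h y) = y\<close> xy(3,4) by metis
  qed
  moreover have "\<phi> ` W \<noteq> {}"
    using x0(1) V \<open>\<pi> x0 = p\<close> unfolding W_def by blast
  ultimately have "DIM(complex ^ 2) \<le> DIM(complex)"
    using invariance_of_dimension open_\<phi>W by blast
  then show False
    by simp
qed

text \<open>Over an interior point the trivialisation would place an open set of real dimension 6, a
  piece of the base times the fibre, injectively into a chart of \<open>E\<close>, which has real
  dimension 4.\<close>

lemma bundle_base_no_interior:
  fixes E :: "('b, complex ^ 2) holspace" and Z :: "(complex ^ 2) set"
  assumes E: "complex_manifold E"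
    and fib: "holomorphic_fibre_bundle E (embedded Z) (embedded (UNIV :: complex set)) \<pi>" and p: "p \<in> Z"
    and "d > 0"
  shows "\<not> ball p d \<subseteq> Z"
proof
  assume ball: "ball p d \<subseteq> Z"
  define T where "T = underlying E"
  obtain U h k where U: "openin (top_of_set Z) U" "p \<in> U"
    and k: "continuous_map (top_of_set (U \<times> (UNIV :: complex set))) (subtopology T {x \<in> topspace T. \<pi> x \<in> U}) k"
    and hk: "\<And>y. y \<in> U \<times> UNIV \<Longrightarrow> h (k y) = y"
    by (rule bundle_trivialization[OF fib p, folded T_def]) blast
  have kT: "continuous_map (top_of_set (U \<times> UNIV)) T k"
    using k continuous_map_into_fulltopology by blast
  have kp: "k (p, 0) \<in> topspace T"
    using continuous_map_funspace[OF kT] U(2) by (auto simp: Pi_iff)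
  obtain V and \<phi> :: "'b \<Rightarrow> complex ^ 2" where V: "k (p, 0) \<in> V"
    and op: "openin T V" "homeomorphic_map (subtopology T V) (top_of_set (\<phi> ` V)) \<phi>"
    by (rule complex_manifold_chart[OF E, folded T_def, OF kp]) blast
  obtain W where W: "open W" "U = Z \<inter> W"
    using U(1) unfolding openin_open by blast
  have "openin (top_of_set (U \<times> UNIV)) {y \<in> topspace (top_of_set (U \<times> UNIV)). k y \<in> V}"
    using openin_continuous_map_preimage[OF kT op(1)] .
  then obtain O2 where O2: "open O2" "{y \<in> U \<times> UNIV. k y \<in> V} = (U \<times> UNIV) \<inter> O2"
    unfolding openin_open by auto
  define Q where "Q = ((ball p d \<inter> W) \<times> UNIV) \<inter> O2"
  have openQ: "open Q"
    unfolding Q_def using W(1) O2(1) by (intro open_Int open_Times) auto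
  have QU: "Q \<subseteq> U \<times> UNIV"
    using ball W(2) unfolding Q_def by blast
  have QV: "k y \<in> V" if "y \<in> Q" for y
    using O2(2) QU that unfolding Q_def by blast
  have "continuous_map (top_of_set Q) T k"
    using kT QU by (rule continuous_map_from_subtopology_mono)
  then have "continuous_map (top_of_set Q) (subtopology T V) k"
    using QV by (auto simp: continuous_map_in_subtopology)
  from continuous_map_compose[OF this homeomorphic_imp_continuous_map[OF op(2)]]
  have "continuous_on Q (\<phi> \<circ> k)"
    by simp
  moreover have "inj_on (\<phi> \<circ> k) Q"
  proof (rule comp_inj_on)
    show "inj_on k Q"
      using hk QU by (metis inj_on_inverseI subsetD)
    have "inj_on \<phi> V"
      using homeomorphic_imp_injective_map[OF op(2)] openin_subset[OF op(1)]
      by (simp add: Int_absorb1)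
    then show "inj_on \<phi> (k ` Q)"
      by (rule inj_on_subset) (use QV in blast)
  qed
  moreover have "(p, 0) \<in> Q"
    using O2(2) U(2) V W(2) \<open>d > 0\<close> unfolding Q_def by auto
  ultimately have "DIM((complex ^ 2) \<times> complex) \<le> DIM(complex ^ 2)"
    using invariance_of_dimension[of Q "\<phi> \<circ> k"] openQ by blast
  then show False
    by simp
qed

section \<open>Uniformization of the retract\<close>

theorem corollary1p6:
  fixes M :: "('a, complex ^ 2) holspace"
    and M_seq :: "nat \<Rightarrow> 'a set"
    and \<Omega> Z :: "(complex ^ 2) set"
    and E :: "('b, complex ^ 2) holspace"
    and \<pi> :: "'b \<Rightarrow> complex ^ 2"
  assumes "complex_manifold M"
    and "\<And>j. openin (underlying M) (M_seq j)"
    and "\<And>j. M_seq j \<subseteq> M_seq (Suc j)"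
    and "(\<Union>j. M_seq j) = topspace (underlying M)"
    and "\<And>j. biholomorphic (restrict_space_to M (M_seq j)) (embedded \<Omega>)"
    and "(bounded \<Omega> \<and> levi_corank_one_domain \<Omega>) \<or> smoothly_bounded_convex_domain \<Omega> \<or>
         strongly_pseudoconvex_polyhedral_domain \<Omega>"
    and "\<not> kobayashi_hyperbolic M"
    and "has_kobayashi_corank M 1"
    and "simply_connected \<Omega>"
    and "holomorphic_retract (embedded \<Omega>) Z"
    and "complex_manifold E"
    and "holomorphic_fibre_bundle E (embedded Z) (embedded (UNIV :: complex set)) \<pi>"
    and "biholomorphic M E"
  shows "simply_connected Z \<and> biholomorphic (embedded Z) (embedded unit_disc)"
proof -
  have "bounded \<Omega>" "domain \<Omega>"
    using assms(6)
    unfolding levi_corank_one_domain_def smoothly_bounded_convex_domain_def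
      strongly_pseudoconvex_polyhedral_domain_def by blast+
  then have op: "open \<Omega>" and "\<Omega> \<noteq> {}"
    by (simp_all add: domain_def)
  obtain r where r: "continuous_on \<Omega> r" "r ` \<Omega> \<subseteq> \<Omega>" "holo_on r \<Omega>"
    and idem: "\<And>z. z \<in> \<Omega> \<Longrightarrow> r (r z) = r z" and Z: "Z = r ` \<Omega>"
    using assms(10) unfolding holomorphic_retract_def holomorphic_map_embedded by (auto simp: embedded_def)
  interpret holomorphic_retraction \<Omega> r
  proof
    show "complex_differentiable_at r z" if "z \<in> \<Omega>" for z
      using holo_on_open[OF r(3) op that] .
    show "r z \<in> \<Omega>" if "z \<in> \<Omega>" for z
      using r(2) that by blast
  qed (fact op idem)+
  have Z\<Omega>: "Z \<subseteq> \<Omega>" and "Z \<noteq> {}"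
    using retract_subset \<open>\<Omega> \<noteq> {}\<close> unfolding Z by auto
  have sc: "simply_connected Z"
  proof (rule simply_connected_retraction_gen[OF assms(9) r(1) Z[symmetric] continuous_on_id])
    show "(\<lambda>x. x) \<in> Z \<rightarrow> \<Omega>"
      using Z\<Omega> by blast
    show "r z = z" if "z \<in> Z" for z
      using retract_fixed that unfolding Z by blast
  qed
  have charts: "\<exists>\<phi>\<in>disc_charts Z. \<phi> 0 = p" if p: "p \<in> Z" for p
  proof -
    have pr: "p \<in> r ` \<Omega>"
      using p by (simp add: Z)
    obtain P where P: "(r has_derivative P) (at p)" "\<And>c v. P (c *\<^sub>C v) = c *\<^sub>C P v" "\<And>v. P (P v) = P v"
      using derivative_projection[OF pr] by metis
    have "P \<noteq> (\<lambda>v. 0)"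
      using rank_zero_isolated[OF pr] P(1) bundle_base_not_isolated[OF assms(11,12) p] by (auto simp: Z)
    moreover have "P \<noteq> (\<lambda>v. v)"
      using full_rank_interior[OF pr] P(1) bundle_base_no_interior[OF assms(11,12) p] by (metis Z)
    ultimately obtain v :: "complex ^ 2" and j where "P v = v" "v $ j = 1" "\<And>w. P w = (P w $ j) *\<^sub>C v"
      using projection_rank_one[OF has_derivative_bounded_linear[OF P(1)] P(2,3)] by metis
    then show ?thesis
      using rank_one_chart[OF pr P(1,2)] by (simp add: Z)
  qed
  interpret riemann_surface Z "disc_charts Z"
    by (rule riemann_surface_disc_charts[OF simply_connected_imp_connected[OF sc] charts])
  \<comment> \<open>Two scalings are used later: \<open>2 * B\<close>, with \<open>B\<close> a bound
    for \<open>\<Omega>\<close>, produces the functions bounded by \<open>1 / 2\<close>, while 1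
    gives the plain coordinates, through which the inverse map is seen to be holomorphic.\<close>
  have coordinate: "hol (\<lambda>z. z $ i / of_real B)" if "B > 0" for i :: 2 and B :: real
    unfolding hol_def
  proof
    fix \<phi> assume \<phi>: "\<phi> \<in> disc_charts Z"
    have "(\<lambda>t. \<phi> t $ i) field_differentiable at t" if "t \<in> ball 0 2" for t
    proof -
      have "complex_differentiable_at \<phi> t"
        using \<phi> that by (simp add: disc_charts_def)
      from complex_differentiable_at_compose[OF this complex_differentiable_at_vec_nth]
      show ?thesis
        by (simp add: complex_differentiable_at_iff o_def)
    qed
    then have "(\<lambda>t. \<phi> t $ i) holomorphic_on ball 0 2"
      unfolding holomorphic_on_def using field_differentiable_at_within by blast
    then show "((\<lambda>z. z $ i / of_real B) \<circ> \<phi>) holomorphic_on ball 0 2"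
      using that by (auto simp: o_def intro!: holomorphic_intros)
  qed
  obtain B where B: "B > 0" "\<And>z. z \<in> \<Omega> \<Longrightarrow> norm z \<le> B"
    using \<open>bounded \<Omega>\<close> bounded_pos by blast
  have norm_le: "norm (z $ i / of_real (2 * B)) \<le> 1 / 2" if "z \<in> Z" for z and i :: 2
  proof -
    have "norm (z $ i) \<le> B"
      using Finite_Cartesian_Product.norm_nth_le[of z i] B(2)[of z] Z\<Omega> that by force
    then show ?thesis
      using B(1) by (simp add: norm_divide field_simps)
  qed
  interpret hyperbolic_surface Z "disc_charts Z" "\<lambda>z :: complex ^ 2. z $ 1 / of_real (2 * B)"
    "\<lambda>z :: complex ^ 2. z $ 2 / of_real (2 * B)"
  proof
    show "z = z'" if "z $ 1 / of_real (2 * B) = z' $ 1 / of_real (2 * B)"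
      "z $ 2 / of_real (2 * B) = z' $ 2 / of_real (2 * B)" for z z' :: "complex ^ 2"
      using that B(1) by (simp add: vec_eq_iff forall_2)
  qed (use sc coordinate[of "2 * B"] norm_le B(1) in auto)
  obtain F g where F: "hol F" "F ` Z = ball 0 1" and g: "continuous_on (ball 0 1) g"
    and gF: "\<And>z. z \<in> Z \<Longrightarrow> g (F z) = z" and Fg: "\<And>w. w \<in> ball 0 1 \<Longrightarrow> g w \<in> Z \<and> F (g w) = w"
    and hol_g: "\<And>h. hol h \<Longrightarrow> (h \<circ> g) holomorphic_on ball 0 1"
    using biholomorphic_to_disc[OF \<open>Z \<noteq> {}\<close>] by metis
  have "holomorphic_map (embedded Z) (embedded unit_disc) F"
    unfolding holomorphic_map_embedded
  proof (intro conjI hol_continuous[OF F(1)])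
    show "holo_on F Z"
      unfolding holo_on_def
    proof
      fix z assume "z \<in> Z"
      then obtain \<phi> where \<phi>: "\<phi> \<in> disc_charts Z" "\<phi> 0 = z"
        using charts by blast
      obtain W \<kappa> where *: "openin (top_of_set Z) (\<phi> ` ball 0 2)" "open W" "\<phi> ` ball 0 2 \<subseteq> W"
        "\<And>z. z \<in> W \<Longrightarrow> complex_differentiable_at \<kappa> z" "\<And>t. t \<in> ball 0 2 \<Longrightarrow> \<kappa> (\<phi> t) = t"
        by (rule disc_chartsD[OF \<phi>(1)]) blast
      obtain N where N: "open N" "\<phi> ` ball 0 2 = Z \<inter> N"
        using *(1) unfolding openin_open by blast
      have "continuous_on W \<kappa>"
        using *(4) complex_differentiable_at_continuous by (blast intro: continuous_at_imp_continuous_on)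
      \<comment> \<open>The ambient extension of \<open>F\<close> is
        \<open>F \<circ> \<phi> \<circ> \<kappa>\<close>. The condition on \<open>\<kappa>\<close>
        puts its values into the chart domain, and \<open>N\<close> restricts \<open>Z\<close> to
        the chart image, where \<open>\<kappa>\<close> inverts \<open>\<phi>\<close>.\<close>
      then have opU: "open (N \<inter> (W \<inter> \<kappa> -` ball 0 2))"
        using *(2) N(1) by (intro open_Int continuous_open_preimage) auto
      have zi: "z \<in> \<phi> ` ball 0 2"
        using \<phi>(2) by force
      then have zU: "z \<in> N \<inter> (W \<inter> \<kappa> -` ball 0 2)"
        using N(2) *(3) *(5)[of 0] \<phi>(2) by auto
      have "(F \<circ> \<phi>) holomorphic_on ball 0 2"
        using F(1) \<phi>(1) by (simp add: hol_def)
      then have "complex_differentiable_at (F \<circ> \<phi>) t" if "t \<in> ball 0 2" for t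
        using that holomorphic_on_imp_differentiable_at open_ball complex_differentiable_at_iff by blast
      then have "\<forall>y\<in>N \<inter> (W \<inter> \<kappa> -` ball 0 2). complex_differentiable_at ((F \<circ> \<phi>) \<circ> \<kappa>) y"
        using *(4) by (blast intro: complex_differentiable_at_compose)
      moreover have "((F \<circ> \<phi>) \<circ> \<kappa>) y = F y" if "y \<in> N \<inter> (W \<inter> \<kappa> -` ball 0 2) \<inter> Z" for y
      proof -
        have "y \<in> \<phi> ` ball 0 2"
          using N(2) that by blast
        then obtain t where "t \<in> ball 0 2" "y = \<phi> t"
          by blast
        then show ?thesis
          using *(5) by simp
      qed
      ultimately show "\<exists>U G. open U \<and> z \<in> U \<and> (\<forall>y\<in>U. complex_differentiable_at G y) \<and> (\<forall>y\<in>U \<inter> Z. G y = F y)"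
        using opU zU by blast
    qed
  qed (simp add: F(2))
  moreover have "holomorphic_map (embedded unit_disc) (embedded Z) g"
    unfolding holomorphic_map_embedded
  proof (intro conjI g holo_on_openI)
    show "complex_differentiable_at g w" if w: "w \<in> ball 0 1" for w
    proof (rule complex_differentiable_at_vec)
      fix i :: 2
      have "(\<lambda>w. g w $ i) holomorphic_on ball 0 1"
        using hol_g[OF coordinate[of 1 i]] by (simp add: o_def)
      then show "(\<lambda>w. g w $ i) field_differentiable at w"
        using w holomorphic_on_imp_differentiable_at open_ball by blast
    qed
  qed (use Fg in auto)
  ultimately have "biholomorphic (embedded Z) (embedded unit_disc)"
    unfolding biholomorphic_def biholomorphism_def topspace_embedded using gF Fg by blast
  then show ?thesis
    using sc by blast
qed

end
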